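(* Let $\Theta=\tilde p/p$ be a rational inner function on $\mathbb{D}^2$ of degree $(m,n)$, let $E_\Theta=\{\tau\in\mathbb{T}:\exists\,\tau_1\in\mathbb{T}\text{ with }p(\tau_1,\tau)=0\}$, let $\mathcal{K}_\Theta=\mathcal{S}_1\oplus\mathcal{S}_2$ be an orthogonal decomposition into closed subspaces with $\mathcal{S}_1$ invariant under $M_{z_1}$ and $\mathcal{S}_2$ invariant under $M_{z_2}$, and let $S^1_\Theta=P_{\mathcal{S}_2}M_{z_1}|_{\mathcal{S}_2}$. For $\tau\in\mathbb{T}\setminus E_\Theta$ let $\Theta_\tau=\Theta(\cdot,\tau)$ (a finite Blaschke product) and let $S_{\Theta_\tau}=P_{\mathcal{K}_{\Theta_\tau}}M_z|_{\mathcal{K}_{\Theta_\tau}}$ be the compressed shift on the one-variable model space $\mathcal{K}_{\Theta_\tau}=H^2(\mathbb{D})\ominus\Theta_\tau H^2(\mathbb{D})$. Then \[\mathrm{Clos}\big(\mathcal{W}(S^1_\Theta)\big)=\mathrm{Clos}\Big(\mathrm{Conv}\Big(\bigcup_{\tau\in\mathbb{T}\setminus E_\Theta}\mathcal{W}(S_{\Theta_\tau})\Big)\Big).\]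
   Context: $\mathbb{D}$ is the open unit disk, $\mathbb{T}$ the unit circle. A rational inner function on $\mathbb{D}^2$ is a rational function holomorphic on $\mathbb{D}^2$ with $|\Theta|=1$ a.e. on $\mathbb{T}^2$; its degree $(m,n)$: writing $\Theta=q/p$ in lowest terms, $m$ (resp. $n$) is the highest power of $z_1$ (resp. $z_2$) in $p$ or $q$. One may write $\Theta=\tilde p/p$ with $p$ a polynomial with no zeros on $\mathbb{D}^2$, $\tilde p(z)=z_1^mz_2^n\overline{p(1/\bar z_1,1/\bar z_2)}$, $p,\tilde p$ coprime; then $E_\Theta$ is finite. $\mathcal{K}_\Theta=H^2(\mathbb{D}^2)\ominus\Theta H^2(\mathbb{D}^2)$. $\mathcal{W}(T)=\{\langle Th,h\rangle:\|h\|=1\}$; Clos and Conv denote closure and convex hull. *)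

theory Defs
  imports "HOL-Analysis.Analysis" "HOL-Computational_Algebra.Polynomial"
begin

text \<open>A polynomial in two variables is an element of complex poly poly:
  the outer variable is z1, the coefficients are polynomials in z2.\<close>

definition bpoly :: "complex poly poly \<Rightarrow> complex \<Rightarrow> complex \<Rightarrow> complex" where
  "bpoly p z1 z2 = poly (map_poly (\<lambda>c. poly c z2) p) z1"

definition deg1 :: "complex poly poly \<Rightarrow> nat" where
  "deg1 p = degree p"

definition deg2 :: "complex poly poly \<Rightarrow> nat" where
  "deg2 p = Max ((\<lambda>i. degree (coeff p i)) ` {..degree p})"

text \<open>Reflection: tilde p (z) = z1^m z2^n conj (p (1/conj z1, 1/conj z2)).\<close>
definition reflect2 :: "nat \<Rightarrow> nat \<Rightarrow> complex poly poly \<Rightarrow> complex poly poly" where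
  "reflect2 m n p =
     (\<Sum>i\<le>m. monom (\<Sum>j\<le>n. monom (cnj (coeff (coeff p (m - i)) (n - j))) j) i)"

text \<open>Generic Hardy-type space of functions on a domain A, given by a square-summable
  coefficient family c with respect to monomials mn; functions vanish outside A
  (normalisation convention).\<close>

definition Hsp :: "'z set \<Rightarrow> ('k \<Rightarrow> 'z \<Rightarrow> complex) \<Rightarrow> ('z \<Rightarrow> complex) set" where
  "Hsp A mn = {f. \<exists>c. (\<lambda>k. (cmod (c k))\<^sup>2) summable_on UNIV \<and>
       (\<forall>z\<in>A. ((\<lambda>k. c k * mn k z) has_sum f z) UNIV) \<and>
       (\<forall>z. z \<notin> A \<longrightarrow> f z = 0)}"

definition hcoeff :: "'z set \<Rightarrow> ('k \<Rightarrow> 'z \<Rightarrow> complex) \<Rightarrow> ('z \<Rightarrow> complex) \<Rightarrow> 'k \<Rightarrow> complex" where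
  "hcoeff A mn f = (SOME c. (\<lambda>k. (cmod (c k))\<^sup>2) summable_on UNIV \<and>
       (\<forall>z\<in>A. ((\<lambda>k. c k * mn k z) has_sum f z) UNIV))"

definition hinner :: "'z set \<Rightarrow> ('k \<Rightarrow> 'z \<Rightarrow> complex) \<Rightarrow> ('z \<Rightarrow> complex) \<Rightarrow> ('z \<Rightarrow> complex) \<Rightarrow> complex" where
  "hinner A mn f g = (\<Sum>\<^sub>\<infinity>k. hcoeff A mn f k * cnj (hcoeff A mn g k))"

definition hnorm :: "'z set \<Rightarrow> ('k \<Rightarrow> 'z \<Rightarrow> complex) \<Rightarrow> ('z \<Rightarrow> complex) \<Rightarrow> real" where
  "hnorm A mn f = sqrt (\<Sum>\<^sub>\<infinity>k. (cmod (hcoeff A mn f k))\<^sup>2)"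

definition closed_subspace :: "'z set \<Rightarrow> ('k \<Rightarrow> 'z \<Rightarrow> complex) \<Rightarrow> ('z \<Rightarrow> complex) set \<Rightarrow> bool" where
  "closed_subspace A mn S \<longleftrightarrow>
     S \<subseteq> Hsp A mn \<and> (\<lambda>z. 0) \<in> S \<and>
     (\<forall>f\<in>S. \<forall>g\<in>S. (\<lambda>z. f z + g z) \<in> S) \<and>
     (\<forall>a. \<forall>f\<in>S. (\<lambda>z. a * f z) \<in> S) \<and>
     (\<forall>F f. (\<forall>i. F i \<in> S) \<and> f \<in> Hsp A mn \<and>
            (\<lambda>i. hnorm A mn (\<lambda>z. F i z - f z)) \<longlonglongrightarrow> 0 \<longrightarrow> f \<in> S)"

definition hproj :: "'z set \<Rightarrow> ('k \<Rightarrow> 'z \<Rightarrow> complex) \<Rightarrow> ('z \<Rightarrow> complex) set \<Rightarrow> ('z \<Rightarrow> complex) \<Rightarrow> ('z \<Rightarrow> complex)" where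
  "hproj A mn S f = (THE g. g \<in> S \<and> (\<forall>s\<in>S. hinner A mn (\<lambda>z. f z - g z) s = 0))"

definition model_space :: "'z set \<Rightarrow> ('k \<Rightarrow> 'z \<Rightarrow> complex) \<Rightarrow> ('z \<Rightarrow> complex) \<Rightarrow> ('z \<Rightarrow> complex) set" where
  "model_space A mn \<Theta> =
     {f \<in> Hsp A mn. \<forall>u\<in>Hsp A mn. hinner A mn f (\<lambda>z. \<Theta> z * u z) = 0}"

definition compression :: "'z set \<Rightarrow> ('k \<Rightarrow> 'z \<Rightarrow> complex) \<Rightarrow> ('z \<Rightarrow> complex) set \<Rightarrow> ('z \<Rightarrow> complex)
     \<Rightarrow> ('z \<Rightarrow> complex) \<Rightarrow> ('z \<Rightarrow> complex)" where
  "compression A mn S \<phi> h = hproj A mn S (\<lambda>z. \<phi> z * h z)"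

definition numrange :: "'z set \<Rightarrow> ('k \<Rightarrow> 'z \<Rightarrow> complex) \<Rightarrow> ('z \<Rightarrow> complex) set
     \<Rightarrow> (('z \<Rightarrow> complex) \<Rightarrow> ('z \<Rightarrow> complex)) \<Rightarrow> complex set" where
  "numrange A mn S T = {hinner A mn (T h) h | h. h \<in> S \<and> hnorm A mn h = 1}"

definition D2 :: "(complex \<times> complex) set" where
  "D2 = ball 0 1 \<times> ball 0 1"

definition mono2 :: "nat \<times> nat \<Rightarrow> complex \<times> complex \<Rightarrow> complex" where
  "mono2 k z = fst z ^ fst k * snd z ^ snd k"

definition D1 :: "complex set" where
  "D1 = ball 0 1"

definition mono1 :: "nat \<Rightarrow> complex \<Rightarrow> complex" where
  "mono1 k z = z ^ k"

end

theory Submission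
  imports Defs
    "HOL-Complex_Analysis.Complex_Analysis"
    "HOL-Computational_Algebra.Polynomial_Factorial"
    "HOL-Computational_Algebra.Field_as_Ring"
    "HOL-Computational_Algebra.Fundamental_Theorem_Algebra"
begin

text \<open>
  Everything is reduced to quadratic forms: by separating hyperplanes it suffices to show that
  Re (conj a <z1 f, f>) - b |f|^2 is nonnegative on S2 if and only if the corresponding
  one-variable form is nonnegative on the model space of every slice.

  Multiplying a function of the model space by the denominator p gives a polynomial of degree
  below m in z1, and p, up to a bounded factor, is bounded below by a polynomial r(z2). Hence
  r^2 f can be approximated by functions with slices that are continuous up to the boundary and
  lie in the model spaces of the slices of Theta; averaging the forms of the slices over roots
  of unity in z2 yields the form of the function. Conversely, each vector of a slice model space
  extends to such a function, and Fejer polynomials in z2 concentrate it on the given slice.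
  This produces elements of the largest z2-invariant subspace of the model space; after
  multiplication by high powers of z2 they are arbitrarily close to S2, since otherwise their
  components in S1 would generate a subspace invariant under multiplication by z1 and both
  powers of z2 that is orthogonal to Theta times the whole of L^2 of the torus.
\<close>

section \<open>Complex Hilbert spaces\<close>

text \<open>\<open>S2\<close> is not determined by \<Theta>, so nothing explicit is known about its
  elements. Its substitute \<open>model_inf\<close> depends on p alone and contains
  \<open>S2\<close>: orthogonality to \<Theta> H^2 after every power of z2 forces p f to have
  z1-degree below m, exactly as for a slice. The obstacle is that p may vanish on the torus, so that
  quotients by p need not extend continuously to the boundary. A Bezout identity a p + b pt = r(z2)
  together with |pt| \<le> |p| gives |r| \<le> C |p| on the bidisk. Multiplying by r repairs the
  boundary behaviour and loses nothing: a polynomial without zeros in the open disk has dense range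
  on every z2-invariant subspace. Since r times a bounded quotient by p is continuous on the closed
  bidisk, boundary values are never taken almost everywhere: norms and inner products are limits of
  means over K-th roots of unity. The decomposition enters only at the end, where high powers of z2
  also make the closed numerical range on \<open>S2\<close> convex.\<close>

class complex_hilbert = real_inner + complete_space +
  fixes scaleC :: "complex \<Rightarrow> 'a \<Rightarrow> 'a" (infixr "*\<^sub>C" 75)
  assumes scaleC_add_right: "c *\<^sub>C (x + y) = c *\<^sub>C x + c *\<^sub>C y"
    and scaleC_add_left: "(c + d) *\<^sub>C x = c *\<^sub>C x + d *\<^sub>C x"
    and scaleC_scaleC [simp]: "c *\<^sub>C d *\<^sub>C x = (c * d) *\<^sub>C x"
    and scaleC_of_real: "complex_of_real r *\<^sub>C x = r *\<^sub>R x"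
    and inner_scaleC_left: "inner (c *\<^sub>C x) y = inner x (cnj c *\<^sub>C y)"
begin

subclass banach ..

end

text \<open>Scalars form such a space as well, so each Parseval statement below serves scalar
  functions and functions with values in a Hilbert space alike.\<close>

instantiation complex :: complex_hilbert
begin

definition scaleC_complex :: "complex \<Rightarrow> complex \<Rightarrow> complex" where
  [simp]: "scaleC_complex = (*)"

instance
  by standard (auto simp: algebra_simps scaleR_conv_of_real inner_complex_def)

end

text \<open>The complex inner product, linear in the first argument, is recovered from its real
  part: Im <x, y> = Re (-\<i> <x, y>) = Re <x, \<i> y>.\<close>

definition cinner :: "'a::complex_hilbert \<Rightarrow> 'a \<Rightarrow> complex" where
  "cinner x y = Complex (inner x y) (inner x (\<i> *\<^sub>C y))"

lemma Re_cinner [simp]: "Re (cinner x y) = inner x y"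
  by (simp add: cinner_def)

lemma scaleC_zero_left [simp]: "0 *\<^sub>C x = (0::'a::complex_hilbert)"
  using scaleC_of_real[of 0 x] by simp

lemma scaleC_one [simp]: "1 *\<^sub>C x = (x::'a::complex_hilbert)"
  using scaleC_of_real[of 1 x] by simp

lemma scaleC_zero_right [simp]: "c *\<^sub>C 0 = (0::'a::complex_hilbert)"
  using scaleC_add_right[of c 0 0] by simp

lemma scaleC_minus_left: "(- c) *\<^sub>C x = - (c *\<^sub>C (x::'a::complex_hilbert))"
  using scaleC_add_left[of c "-c" x] by (simp add: add_eq_0_iff)

lemma scaleC_minus_right: "c *\<^sub>C (- x) = - (c *\<^sub>C (x::'a::complex_hilbert))"
  using scaleC_add_right[of c x "-x"] by (simp add: add_eq_0_iff)

lemma scaleC_diff_right: "c *\<^sub>C (x - y) = c *\<^sub>C x - c *\<^sub>C (y::'a::complex_hilbert)"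
  using scaleC_add_right[of c x "-y"] by (simp add: scaleC_minus_right)

lemma scaleC_sum_right: "c *\<^sub>C sum f A = (\<Sum>a\<in>A. c *\<^sub>C (f a::'a::complex_hilbert))"
  by (induction A rule: infinite_finite_induct) (auto simp: scaleC_add_right)

lemma scaleC_sum_left: "sum c A *\<^sub>C x = (\<Sum>a\<in>A. c a *\<^sub>C (x::'a::complex_hilbert))"
  by (induction A rule: infinite_finite_induct) (auto simp: scaleC_add_left)

lemma inner_scaleC_right: "inner x (c *\<^sub>C y) = inner (cnj c *\<^sub>C x) (y::'a::complex_hilbert)"
  by (simp add: inner_scaleC_left)

lemma norm_scaleC [simp]: "norm (c *\<^sub>C x) = cmod c * norm (x::'a::complex_hilbert)"
proof -
  have "(norm (c *\<^sub>C x))\<^sup>2 = inner x ((cnj c * c) *\<^sub>C x)"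
    by (simp add: power2_norm_eq_inner inner_scaleC_left)
  also have "cnj c * c = complex_of_real ((cmod c)\<^sup>2)"
    by (subst mult.commute) (rule complex_norm_square[symmetric])
  also have "inner x (\<dots> *\<^sub>C x) = (cmod c * norm x)\<^sup>2"
    by (simp only: scaleC_of_real) (simp add: power2_norm_eq_inner[symmetric] power_mult_distrib)
  finally show ?thesis by (simp add: power2_eq_iff_nonneg)
qed

lemma cinner_add_left: "cinner (x + y) z = cinner x z + cinner y z"
  by (simp add: cinner_def inner_add_left complex_eq_iff)

lemma cinner_add_right: "cinner z (x + y) = cinner z x + cinner z y"
  by (simp add: cinner_def inner_add_right scaleC_add_right complex_eq_iff)

lemma cinner_zero_left [simp]: "cinner 0 x = 0"
  and cinner_zero_right [simp]: "cinner x 0 = 0"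
  by (simp_all add: cinner_def complex_eq_iff)

lemma cnj_cinner: "cnj (cinner x y) = cinner y x"
proof -
  have "inner x (\<i> *\<^sub>C y) = - inner y (\<i> *\<^sub>C x)"
    unfolding inner_scaleC_right[of x] by (simp add: scaleC_minus_left inner_commute[of y])
  then show ?thesis by (simp add: cinner_def complex_eq_iff inner_commute)
qed

lemma cinner_scaleC_right: "cinner x (c *\<^sub>C y) = cnj c * cinner x y"
proof -
  have 1: "inner x (c *\<^sub>C y) = Re c * inner x y + Im c * inner x (\<i> *\<^sub>C y)" for c
  proof -
    have "c = complex_of_real (Re c) + complex_of_real (Im c) * \<i>"
      using complex_eq[of c] by (simp add: mult.commute)
    then have "c *\<^sub>C y = Re c *\<^sub>R y + Im c *\<^sub>R (\<i> *\<^sub>C y)"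
      by (metis scaleC_add_left scaleC_of_real scaleC_scaleC)
    then show ?thesis by (simp add: inner_add_right)
  qed
  have "inner x (\<i> *\<^sub>C c *\<^sub>C y) = - Im c * inner x y + Re c * inner x (\<i> *\<^sub>C y)"
    using 1[of "\<i> * c"] by simp
  then show ?thesis using 1[of c] by (simp add: cinner_def complex_eq_iff)
qed

lemma cinner_scaleC_left: "cinner (c *\<^sub>C x) y = c * cinner x y"
  by (metis cnj_cinner cinner_scaleC_right complex_cnj_cnj complex_cnj_mult)

lemma cinner_minus_left: "cinner (- x) y = - cinner x y"
  using cinner_scaleC_left[of "-1" x y] by (simp add: scaleC_minus_left)

lemma cinner_minus_right: "cinner x (- y) = - cinner x y"
  using cinner_scaleC_right[of x "-1" y] by (simp add: scaleC_minus_left)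

lemma cinner_diff_left: "cinner (x - y) z = cinner x z - cinner y z"
  using cinner_add_left[of x "-y" z] by (simp add: cinner_minus_left)

lemma cinner_diff_right: "cinner z (x - y) = cinner z x - cinner z y"
  using cinner_add_right[of z x "-y"] by (simp add: cinner_minus_right)

lemma cinner_sum_left: "cinner (sum f A) y = (\<Sum>a\<in>A. cinner (f a) y)"
  by (induction A rule: infinite_finite_induct) (auto simp: cinner_add_left)

lemma cinner_sum_right: "cinner y (sum f A) = (\<Sum>a\<in>A. cinner y (f a))"
  by (induction A rule: infinite_finite_induct) (auto simp: cinner_add_right)

lemma cinner_self: "cinner x x = complex_of_real ((norm x)\<^sup>2)"
proof -
  have "Im (cinner x x) = 0"
    using cnj_cinner[of x x] by (metis Reals_cnj_iff complex_is_Real_iff)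
  then show ?thesis by (simp add: complex_eq_iff power2_norm_eq_inner)
qed

text \<open>Rotating x by a unimodular scalar makes the inner product real and nonnegative, which
  reduces the bound to the real Cauchy-Schwarz inequality.\<close>

lemma cinner_bound: "cmod (cinner x y) \<le> norm x * norm y"
proof (cases "cinner x y = 0")
  case False
  define w where "w = cinner x y"
  define c where "c = cnj w / complex_of_real (cmod w)"
  have w: "cmod w \<noteq> 0" using False by (simp add: w_def)
  have c: "cmod c = 1" using w by (simp add: c_def norm_divide)
  have "cnj w * w = complex_of_real (cmod w) * complex_of_real (cmod w)"
    by (metis complex_norm_square mult.commute of_real_mult power2_eq_square)
  then have "c * w = complex_of_real (cmod w)"
    using w by (simp add: c_def)
  then have "c * cinner x y = complex_of_real (cmod (cinner x y))"
    by (simp add: w_def)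
  then have "cmod (cinner x y) = Re (cinner (c *\<^sub>C x) y)"
    by (simp add: cinner_scaleC_left)
  also have "\<dots> \<le> norm (c *\<^sub>C x) * norm y"
    unfolding Re_cinner by (rule norm_cauchy_schwarz)
  finally show ?thesis using c by simp
qed simp

lemma bounded_bilinear_scaleC: "bounded_bilinear (\<lambda>c (x::'a::complex_hilbert). c *\<^sub>C x)"
  by standard (auto simp: scaleC_add_left scaleC_add_right scaleC_of_real[symmetric]
      scaleR_conv_of_real mult_ac intro!: exI[of _ 1])

lemma bounded_bilinear_cinner: "bounded_bilinear (cinner :: 'a::complex_hilbert \<Rightarrow> 'a \<Rightarrow> complex)"
  by standard (auto simp: cinner_add_left cinner_add_right scaleC_of_real[symmetric]
      cinner_scaleC_left cinner_scaleC_right scaleR_conv_of_real cinner_bound intro!: exI[of _ 1])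

lemmas tendsto_scaleC [tendsto_intros] = bounded_bilinear.tendsto[OF bounded_bilinear_scaleC]
lemmas tendsto_cinner [tendsto_intros] = bounded_bilinear.tendsto[OF bounded_bilinear_cinner]
lemmas continuous_on_scaleC [continuous_intros] =
  bounded_bilinear.continuous_on[OF bounded_bilinear_scaleC]
lemmas continuous_on_cinner [continuous_intros] =
  bounded_bilinear.continuous_on[OF bounded_bilinear_cinner]

text \<open>Every limit formula for norms becomes one for inner products; this is how means of inner
  products of slices are computed.\<close>

lemma cinner_polarization:
  "cinner x y = (complex_of_real ((norm (x + y))\<^sup>2) - complex_of_real ((norm (x - y))\<^sup>2)
     + \<i> * complex_of_real ((norm (x + \<i> *\<^sub>C y))\<^sup>2) - \<i> * complex_of_real ((norm (x - \<i> *\<^sub>C y))\<^sup>2)) / 4"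
proof -
  have 1: "complex_of_real ((norm (x + y))\<^sup>2) = cinner x x + cinner x y + cinner y x + cinner y y" for x y :: 'a
    by (simp only: cinner_self[symmetric] cinner_add_left cinner_add_right add_ac)
  have 2: "complex_of_real ((norm (x - y))\<^sup>2) = cinner x x - cinner x y - cinner y x + cinner y y" for x y :: 'a
    by (simp only: cinner_self[symmetric] cinner_diff_left cinner_diff_right) simp
  show ?thesis
    unfolding 1 2 by (simp add: cinner_scaleC_left cinner_scaleC_right algebra_simps)
qed

section \<open>Orthogonal projection onto closed complex subspaces\<close>

definition csubspace :: "'a::complex_hilbert set \<Rightarrow> bool" where
  "csubspace S \<longleftrightarrow> 0 \<in> S \<and> (\<forall>x\<in>S. \<forall>y\<in>S. x + y \<in> S) \<and> (\<forall>c. \<forall>x\<in>S. c *\<^sub>C x \<in> S)"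

lemma csubspace_0: "csubspace S \<Longrightarrow> 0 \<in> S"
  and csubspace_add: "csubspace S \<Longrightarrow> x \<in> S \<Longrightarrow> y \<in> S \<Longrightarrow> x + y \<in> S"
  and csubspace_scaleC: "csubspace S \<Longrightarrow> x \<in> S \<Longrightarrow> c *\<^sub>C x \<in> S"
  by (auto simp: csubspace_def)

lemma csubspace_diff: "csubspace S \<Longrightarrow> x \<in> S \<Longrightarrow> y \<in> S \<Longrightarrow> x - y \<in> S"
  using csubspace_add[of S x "-y"] csubspace_scaleC[of S y "-1"] by (simp add: scaleC_minus_left)

lemma csubspace_sum: "csubspace S \<Longrightarrow> (\<And>a. a \<in> A \<Longrightarrow> f a \<in> S) \<Longrightarrow> sum f A \<in> S"
  by (induction A rule: infinite_finite_induct) (auto simp: csubspace_0 csubspace_add)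

lemma parallelogram: "(norm (x + y))\<^sup>2 + (norm (x - y))\<^sup>2 = 2 * (norm x)\<^sup>2 + 2 * (norm (y::'a::real_inner))\<^sup>2"
  by (simp add: power2_norm_eq_inner inner_add_left inner_add_right inner_diff_left inner_diff_right
      inner_commute)

text \<open>A minimizing sequence for the distance is Cauchy by the parallelogram law, and varying
  its limit along s shows that the remainder is orthogonal to s.\<close>

lemma projection_exists:
  fixes S :: "'a::complex_hilbert set"
  assumes S: "csubspace S" and cl: "closed S"
  shows "\<exists>p\<in>S. \<forall>s\<in>S. cinner (x - p) s = 0"
proof -
  define d where "d = infdist x S"
  have ne: "S \<noteq> {}" using csubspace_0[OF S] by auto
  have d0: "d \<ge> 0" by (simp add: d_def infdist_nonneg)
  have dle: "d \<le> norm (x - y)" if "y \<in> S" for y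
    using infdist_le[OF that, of x] by (simp add: d_def dist_norm)
  have "\<exists>y\<in>S. norm (x - y) < d + 1 / Suc n" for n
  proof -
    have "infdist x S < d + 1 / Suc n" by (simp add: d_def)
    then have "Inf (dist x ` S) < d + 1 / Suc n" using ne by (simp add: infdist_notempty)
    from cInf_lessD[OF _ this] ne show ?thesis by (auto simp: dist_norm)
  qed
  then obtain Y where Y: "\<And>n. Y n \<in> S" "\<And>n. norm (x - Y n) < d + 1 / Suc n" by metis
  have est: "(norm (Y k - Y l))\<^sup>2 \<le> 2 * (norm (x - Y k))\<^sup>2 + 2 * (norm (x - Y l))\<^sup>2 - 4 * d\<^sup>2" for k l
  proof -
    \<comment> \<open>The midpoint also lies in S, so its distance to x is at least d; this is what
      bounds \<open>norm (Y k - Y l)\<close> from above.\<close>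
    have mid: "(1/2) *\<^sub>C (Y k + Y l) \<in> S" using Y S by (simp add: csubspace_add csubspace_scaleC)
    have "(x - Y k) + (x - Y l) = 2 *\<^sub>C (x - (1/2) *\<^sub>C (Y k + Y l))"
      using scaleC_of_real[of 2 x] by (simp add: scaleC_diff_right scaleC_add_right scaleR_2)
    then have "2 * d \<le> norm ((x - Y k) + (x - Y l))"
      using dle[OF mid] by simp
    then have "(2 * d)\<^sup>2 \<le> (norm ((x - Y k) + (x - Y l)))\<^sup>2" using d0 by (intro power_mono) auto
    moreover have "norm ((x - Y k) - (x - Y l)) = norm (Y k - Y l)"
      by (metis diff_diff_eq2 add_diff_cancel_left' diff_add_cancel norm_minus_commute)
    ultimately show ?thesis using parallelogram[of "x - Y k" "x - Y l"]
      by (simp add: power_mult_distrib)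
  qed
  have "Cauchy Y"
  proof (rule CauchyI)
    fix e :: real assume e: "e > 0"
    have "(\<lambda>n. 4 * (d + 1 / real (Suc n))\<^sup>2 - 4 * d\<^sup>2) \<longlonglongrightarrow> 4 * (d + 0)\<^sup>2 - 4 * d\<^sup>2"
      by (intro tendsto_intros LIMSEQ_inverse_real_of_nat[unfolded inverse_eq_divide])
    then have "eventually (\<lambda>n. 4 * (d + 1 / real (Suc n))\<^sup>2 - 4 * d\<^sup>2 < e\<^sup>2) sequentially"
      using e by (intro order_tendstoD) auto
    then obtain M where M: "4 * (d + 1 / real (Suc M))\<^sup>2 - 4 * d\<^sup>2 < e\<^sup>2"
      by (auto simp: eventually_sequentially)
    have b: "(norm (x - Y k))\<^sup>2 \<le> (d + 1 / real (Suc M))\<^sup>2" if "k \<ge> M" for k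
    proof (rule power_mono)
      have "1 / real (Suc k) \<le> 1 / real (Suc M)" using that by (simp add: frac_le)
      then show "norm (x - Y k) \<le> d + 1 / real (Suc M)" using Y(2)[of k] by linarith
    qed simp
    have "norm (Y k - Y l) < e" if "k \<ge> M" "l \<ge> M" for k l
    proof -
      have "(norm (Y k - Y l))\<^sup>2 < e\<^sup>2" using est[of k l] b[OF that(1)] b[OF that(2)] M by linarith
      then show ?thesis using e by (simp add: power2_less_imp_less)
    qed
    then show "\<exists>M. \<forall>m\<ge>M. \<forall>n\<ge>M. norm (Y m - Y n) < e" by blast
  qed
  then obtain p where p: "Y \<longlonglongrightarrow> p" using Cauchy_convergent_iff convergent_def by blast
  have pS: "p \<in> S" using closed_sequentially[OF cl] Y(1) p by blast
  have "(\<lambda>n. norm (x - Y n)) \<longlonglongrightarrow> norm (x - p)" by (intro tendsto_intros p)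
  moreover have "(\<lambda>n. d + 1 / real (Suc n)) \<longlonglongrightarrow> d + 0"
    by (intro tendsto_intros LIMSEQ_inverse_real_of_nat[unfolded inverse_eq_divide])
  ultimately have "norm (x - p) \<le> d + 0"
    by (rule LIMSEQ_le) (use Y(2) less_imp_le in blast)
  then have np: "norm (x - p) = d" using dle[OF pS] by simp
  have "cinner (x - p) s = 0" if s: "s \<in> S" for s
  proof (cases "s = 0")
    case False
    \<comment> \<open>The coefficient of the projection of x - p onto s: subtracting c s lowers the
      squared distance by |<x - p, s>|^2 / |s|^2, which minimality forbids unless it is 0.\<close>
    define c where "c = cinner (x - p) s / complex_of_real ((norm s)\<^sup>2)"
    have "p + c *\<^sub>C s \<in> S" using pS s S by (simp add: csubspace_add csubspace_scaleC)
    from dle[OF this] have "d\<^sup>2 \<le> (norm ((x - p) - c *\<^sub>C s))\<^sup>2"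
      using d0 by (intro power_mono) (auto simp: algebra_simps)
    moreover have "complex_of_real ((norm ((x - p) - c *\<^sub>C s))\<^sup>2) =
        complex_of_real ((norm (x - p))\<^sup>2 - (cmod (cinner (x - p) s))\<^sup>2 / (norm s)\<^sup>2)"
    proof -
      define w where "w = cinner (x - p) s"
      define N where "N = complex_of_real ((norm s)\<^sup>2)"
      have N: "N \<noteq> 0" "cnj N = N" using False by (simp_all add: N_def)
      have cw: "cinner s (x - p) = cnj w" by (simp add: cnj_cinner w_def)
      have "cinner (y - c *\<^sub>C s) (y - c *\<^sub>C s)
          = cinner y y - cnj c * cinner y s - c * cinner s y + c * cnj c * N" for y
        unfolding N_def cinner_self[of s, symmetric]
        by (simp only: cinner_diff_left cinner_diff_right cinner_scaleC_left cinner_scaleC_right)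
           (simp add: algebra_simps)
      from this[of "x - p"] have "cinner ((x - p) - c *\<^sub>C s) ((x - p) - c *\<^sub>C s)
          = cinner (x - p) (x - p) - cnj c * w - c * cnj w + c * cnj c * N"
        unfolding cw w_def[symmetric] .
      also have "\<dots> = cinner (x - p) (x - p) - w * cnj w / N"
      proof -
        have "c = w / N" unfolding c_def w_def N_def ..
        then have w: "w = N * c" using N(1) by simp
        show ?thesis using N by (simp add: w field_simps)
      qed
      also have "w * cnj w = complex_of_real ((cmod w)\<^sup>2)" by (simp add: complex_norm_square del: of_real_power)
      finally show ?thesis by (simp add: cinner_self N_def w_def)
    qed
    ultimately have "(cmod (cinner (x - p) s))\<^sup>2 / (norm s)\<^sup>2 \<le> 0"
      unfolding of_real_eq_iff np by linarith
    then show ?thesis using False by (simp add: divide_le_0_iff)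
  qed simp
  then show ?thesis using pS by blast
qed


section \<open>Square-summable families\<close>

text \<open>All Hilbert space work is done on coefficient families: index type \<open>nat\<close>
  gives the disk, \<open>nat \<times> nat\<close> the bidisk.\<close>

typedef 'k ell2 = "{f :: 'k \<Rightarrow> complex. (\<lambda>k. (cmod (f k))\<^sup>2) summable_on UNIV}"
  morphisms coord Abs_ell2
  by (rule exI[of _ "\<lambda>_. 0"]) simp

lemma coord_summable: "(\<lambda>k. (cmod (coord x k))\<^sup>2) summable_on UNIV"
  using coord[of x] by simp

lemma ell2_eqI: "(\<And>k. coord x k = coord y k) \<Longrightarrow> x = y"
  by (metis coord_inject ext)

lemma coord_Abs: "(\<lambda>k. (cmod (f k))\<^sup>2) summable_on UNIV \<Longrightarrow> coord (Abs_ell2 f) k = f k"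
  by (simp add: Abs_ell2_inverse)

lemma sq_summable_add:
  fixes f g :: "'k \<Rightarrow> complex"
  assumes "(\<lambda>k. (cmod (f k))\<^sup>2) summable_on UNIV" "(\<lambda>k. (cmod (g k))\<^sup>2) summable_on UNIV"
  shows "(\<lambda>k. (cmod (f k + g k))\<^sup>2) summable_on UNIV"
proof (rule summable_on_comparison_test)
  show "(\<lambda>k. 2 * (cmod (f k))\<^sup>2 + 2 * (cmod (g k))\<^sup>2) summable_on UNIV"
    by (intro summable_on_add summable_on_cmult_right assms)
  fix k
  have "(cmod (f k + g k))\<^sup>2 \<le> (cmod (f k) + cmod (g k))\<^sup>2"
    by (intro power_mono norm_triangle_ineq) simp
  also have "\<dots> \<le> 2 * (cmod (f k))\<^sup>2 + 2 * (cmod (g k))\<^sup>2"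
    using sum_squares_bound[of "cmod (f k)" "cmod (g k)"] by (simp add: power2_sum)
  finally show "(cmod (f k + g k))\<^sup>2 \<le> 2 * (cmod (f k))\<^sup>2 + 2 * (cmod (g k))\<^sup>2" .
qed simp

lemma sq_summable_scale:
  fixes f :: "'k \<Rightarrow> complex"
  assumes "(\<lambda>k. (cmod (f k))\<^sup>2) summable_on UNIV"
  shows "(\<lambda>k. (cmod (c * f k))\<^sup>2) summable_on UNIV"
  using summable_on_cmult_right[OF assms, of "(cmod c)\<^sup>2"] by (simp add: norm_mult power_mult_distrib)

lemma sq_summable_product:
  fixes f g :: "'k \<Rightarrow> complex"
  assumes "(\<lambda>k. (cmod (f k))\<^sup>2) summable_on UNIV" "(\<lambda>k. (cmod (g k))\<^sup>2) summable_on UNIV"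
  shows "(\<lambda>k. norm (f k * cnj (g k))) summable_on UNIV"
  using assms abs_summable_product[of f UNIV "\<lambda>k. cnj (g k)"]
  by (simp add: norm_mult power2_eq_square)

instantiation ell2 :: (type) ab_group_add
begin

definition "0 = Abs_ell2 (\<lambda>_. 0)"
definition "x + y = Abs_ell2 (\<lambda>k. coord x k + coord y k)"
definition "- x = Abs_ell2 (\<lambda>k. - 1 * coord x k)" for x :: "'a ell2"
definition "x - y = Abs_ell2 (\<lambda>k. coord x k + - 1 * coord y k)" for x :: "'a ell2"

lemma coord_zero [simp]: "coord 0 k = 0"
  by (simp add: zero_ell2_def coord_Abs)

lemma coord_add [simp]: "coord (x + y) k = coord x k + coord y k"
  unfolding plus_ell2_def by (subst coord_Abs, rule sq_summable_add[OF coord_summable coord_summable]) simp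

lemma coord_minus [simp]: "coord (- x) k = - coord x k"
  unfolding uminus_ell2_def by (subst coord_Abs, rule sq_summable_scale[OF coord_summable]) simp

lemma coord_diff [simp]: "coord (x - y) k = coord x k - coord y k"
  unfolding minus_ell2_def
  by (subst coord_Abs, rule sq_summable_add[OF coord_summable sq_summable_scale[OF coord_summable]]) simp

instance
  by standard (auto intro!: ell2_eqI)

end

instantiation ell2 :: (type) real_vector
begin

definition "r *\<^sub>R x = Abs_ell2 (\<lambda>k. complex_of_real r * coord x k)"

lemma coord_scaleR [simp]: "coord (r *\<^sub>R x) k = complex_of_real r * coord x k"
  unfolding scaleR_ell2_def by (subst coord_Abs, rule sq_summable_scale[OF coord_summable]) simp

instance
proof
  fix a b :: real and x y :: "'a ell2"
  show "a *\<^sub>R (x + y) = a *\<^sub>R x + a *\<^sub>R y" by (rule ell2_eqI) (simp add: distrib_left)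
  show "(a + b) *\<^sub>R x = a *\<^sub>R x + b *\<^sub>R x" by (rule ell2_eqI) (simp add: distrib_right)
  show "a *\<^sub>R b *\<^sub>R x = (a * b) *\<^sub>R x" by (rule ell2_eqI) simp
  show "1 *\<^sub>R x = x" by (rule ell2_eqI) simp
qed

end

lemma summable_coord_product: "(\<lambda>k. coord x k * cnj (coord y k)) summable_on UNIV"
  by (rule abs_summable_summable[OF sq_summable_product[OF coord_summable coord_summable]])

instantiation ell2 :: (type) real_inner
begin

definition inner_ell2 :: "'a ell2 \<Rightarrow> 'a ell2 \<Rightarrow> real" where
  "inner_ell2 x y = Re (\<Sum>\<^sub>\<infinity>k. coord x k * cnj (coord y k))"
definition norm_ell2 :: "'a ell2 \<Rightarrow> real" where "norm_ell2 x = sqrt (inner x x)"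
definition dist_ell2 :: "'a ell2 \<Rightarrow> 'a ell2 \<Rightarrow> real" where "dist_ell2 x y = norm (x - y)"
definition sgn_ell2 :: "'a ell2 \<Rightarrow> 'a ell2" where "sgn_ell2 x = inverse (norm x) *\<^sub>R x"
definition uniformity_ell2 :: "('a ell2 \<times> 'a ell2) filter" where
  "uniformity_ell2 = (INF e\<in>{0<..}. principal {(x, y). dist x y < e})"
definition open_ell2 :: "'a ell2 set \<Rightarrow> bool" where
  "open_ell2 U = (\<forall>x\<in>U. eventually (\<lambda>(x', y). x' = x \<longrightarrow> y \<in> U) uniformity)"

lemma inner_ell2_self: "inner x x = (\<Sum>\<^sub>\<infinity>k. (cmod (coord x k))\<^sup>2)"
proof -
  have "(\<Sum>\<^sub>\<infinity>k. coord x k * cnj (coord x k)) = (\<Sum>\<^sub>\<infinity>k. complex_of_real ((cmod (coord x k))\<^sup>2))"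
    by (simp only: complex_norm_square)
  then show ?thesis
    unfolding inner_ell2_def infsum_Re[OF summable_coord_product, symmetric]
    by (simp only: complex_norm_square[symmetric] Re_complex_of_real)
qed

instance
proof
  fix x y z :: "'a ell2" and r :: real
  show "inner x y = inner y x"
  proof -
    have "(\<Sum>\<^sub>\<infinity>k. coord y k * cnj (coord x k)) = (\<Sum>\<^sub>\<infinity>k. cnj (coord x k * cnj (coord y k)))"
      by (simp add: mult.commute)
    then show ?thesis unfolding inner_ell2_def infsum_cnj by simp
  qed
  show "inner (x + y) z = inner x z + inner y z"
    by (simp add: inner_ell2_def algebra_simps infsum_add summable_coord_product)
  show "inner (r *\<^sub>R x) y = r * inner x y"
    by (simp add: inner_ell2_def mult.assoc infsum_cmult_right' )
  show "0 \<le> inner x x" by (simp add: inner_ell2_self infsum_nonneg)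
  show "inner x x = 0 \<longleftrightarrow> x = 0"
  proof
    assume "inner x x = 0"
    then have "(cmod (coord x k))\<^sup>2 = 0" for k
      unfolding inner_ell2_self
      using nonneg_infsum_le_0D[of "\<lambda>k. (cmod (coord x k))\<^sup>2" UNIV k] coord_summable[of x] by simp
    then show "x = 0" by (intro ell2_eqI) simp
  qed (simp add: inner_ell2_def)
qed (auto simp: norm_ell2_def dist_ell2_def sgn_ell2_def uniformity_ell2_def open_ell2_def)

end

lemma norm_ell2_square: "(norm x)\<^sup>2 = (\<Sum>\<^sub>\<infinity>k. (cmod (coord x k))\<^sup>2)"
  by (subst power2_norm_eq_inner) (rule inner_ell2_self)

lemma norm_ell2_has_sum: "((\<lambda>k. (cmod (coord x k))\<^sup>2) has_sum (norm x)\<^sup>2) UNIV"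
  unfolding norm_ell2_square by (rule has_sum_infsum[OF coord_summable])

lemma sum_coord_le: "finite F \<Longrightarrow> (\<Sum>k\<in>F. (cmod (coord x k))\<^sup>2) \<le> (norm x)\<^sup>2"
  unfolding norm_ell2_square by (intro finite_sum_le_infsum coord_summable) auto

text \<open>The way new elements arise: coefficients are constructed first, and a bound on finite
  partial sums yields membership and the norm estimate together.\<close>

lemma ell2_exists:
  assumes "\<And>F. finite F \<Longrightarrow> (\<Sum>k\<in>F. (cmod (f k))\<^sup>2) \<le> B\<^sup>2" and B: "B \<ge> 0"
  obtains x where "\<And>k. coord x k = f k" "norm x \<le> B"
proof -
  have s: "(\<lambda>k. (cmod (f k))\<^sup>2) summable_on UNIV"
    by (rule nonneg_bdd_above_summable_on) (auto intro!: bdd_aboveI[of _ "B\<^sup>2"] assms)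
  define x where "x = Abs_ell2 f"
  have x: "\<And>k. coord x k = f k" using s by (simp add: x_def coord_Abs)
  have "(norm x)\<^sup>2 \<le> B\<^sup>2"
    unfolding norm_ell2_square x by (rule infsum_le_finite_sums[OF s]) (use assms in auto)
  then have "norm x \<le> B" using B by (rule power2_le_imp_le)
  with x that show thesis by blast
qed

lemma norm_coord_le: "cmod (coord x k) \<le> norm x"
  by (rule power2_le_imp_le) (use sum_coord_le[of "{k}" x] in auto)

lemma bounded_linear_coord: "bounded_linear (\<lambda>x. coord x k)"
  by (rule bounded_linear_intro[of _ 1]) (auto simp: scaleR_conv_of_real norm_coord_le)


lemma coord_sum: "coord (sum f A) k = (\<Sum>a\<in>A. coord (f a) k)"
  by (induction A rule: infinite_finite_induct) auto

instance ell2 :: (type) complete_space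
proof
  fix X :: "nat \<Rightarrow> 'a ell2"
  assume X: "Cauchy X"
  have "Cauchy (\<lambda>n. coord (X n) k)" for k
    by (rule bounded_linear.Cauchy[OF bounded_linear_coord X])
  then have "\<exists>l. (\<lambda>n. coord (X n) k) \<longlonglongrightarrow> l" for k
    by (simp add: Cauchy_convergent_iff convergent_def)
  then obtain l where l: "\<And>k. (\<lambda>n. coord (X n) k) \<longlonglongrightarrow> l k" by metis
  have est: "(\<Sum>k\<in>F. (cmod (coord (X n) k - l k))\<^sup>2) \<le> e\<^sup>2"
    if "finite F" "e > 0" "\<forall>m\<ge>M. \<forall>n\<ge>M. norm (X m - X n) < e" "n \<ge> M" for F e M n
  proof (rule LIMSEQ_le_const2)
    show "(\<lambda>m. \<Sum>k\<in>F. (cmod (coord (X n) k - coord (X m) k))\<^sup>2) \<longlonglongrightarrow> (\<Sum>k\<in>F. (cmod (coord (X n) k - l k))\<^sup>2)"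
      by (intro tendsto_intros l)
    have "(\<Sum>k\<in>F. (cmod (coord (X n) k - coord (X m) k))\<^sup>2) \<le> e\<^sup>2" if "m \<ge> M" for m
    proof -
      have "(\<Sum>k\<in>F. (cmod (coord (X n) k - coord (X m) k))\<^sup>2) \<le> (norm (X n - X m))\<^sup>2"
        using sum_coord_le[OF \<open>finite F\<close>, of "X n - X m"] by simp
      also have "\<dots> \<le> e\<^sup>2"
        using that \<open>n \<ge> M\<close> \<open>\<forall>m\<ge>M. \<forall>n\<ge>M. norm (X m - X n) < e\<close> by (intro power_mono) (auto simp: less_imp_le)
      finally show ?thesis .
    qed
    then show "\<exists>N. \<forall>m\<ge>N. (\<Sum>k\<in>F. (cmod (coord (X n) k - coord (X m) k))\<^sup>2) \<le> e\<^sup>2" by blast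
  qed
  obtain M1 where M1: "\<forall>m\<ge>M1. \<forall>n\<ge>M1. norm (X m - X n) < 1"
    using CauchyD[OF X, of 1] by auto
  \<comment> \<open>Only the difference between \<open>X M1\<close> and the coordinatewise limit has
    bounded partial sums so far, so the limit is represented as \<open>X M1 - d\<close>.\<close>
  obtain d where d: "\<And>k. coord d k = coord (X M1) k - l k"
    by (rule ell2_exists[of "\<lambda>k. coord (X M1) k - l k" 1]) (use est[OF _ _ M1] in auto)
  define L where "L = X M1 - d"
  have L: "coord L k = l k" for k by (simp add: L_def d)
  have "X \<longlonglongrightarrow> L"
  proof (rule LIMSEQ_I)
    fix e :: real assume e: "e > 0"
    obtain M where M: "\<forall>m\<ge>M. \<forall>n\<ge>M. norm (X m - X n) < e / 2"
      using CauchyD[OF X, of "e/2"] e by auto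
    have "norm (X n - L) < e" if n: "n \<ge> M" for n
    proof -
      obtain y where y: "\<And>k. coord y k = coord (X n) k - l k" "norm y \<le> e / 2"
        by (rule ell2_exists[of "\<lambda>k. coord (X n) k - l k" "e / 2"]) (use est[OF _ _ M n] e in auto)
      have "y = X n - L" by (rule ell2_eqI) (simp add: y L)
      then show ?thesis using y(2) e by auto
    qed
    then show "\<exists>no. \<forall>n\<ge>no. norm (X n - L) < e" by blast
  qed
  then show "convergent X" by (auto simp: convergent_def)
qed

instantiation ell2 :: (type) complex_hilbert
begin

definition scaleC_ell2 :: "complex \<Rightarrow> 'a ell2 \<Rightarrow> 'a ell2" where
  "scaleC_ell2 c x = Abs_ell2 (\<lambda>k. c * coord x k)"

lemma coord_scaleC [simp]: "coord (c *\<^sub>C x) k = c * coord x k"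
  unfolding scaleC_ell2_def by (subst coord_Abs, rule sq_summable_scale[OF coord_summable]) simp

instance
proof
  fix c d :: complex and r :: real and x y :: "'a ell2"
  show "c *\<^sub>C (x + y) = c *\<^sub>C x + c *\<^sub>C y" by (rule ell2_eqI) (simp add: distrib_left)
  show "(c + d) *\<^sub>C x = c *\<^sub>C x + d *\<^sub>C x" by (rule ell2_eqI) (simp add: distrib_right)
  show "c *\<^sub>C d *\<^sub>C x = (c * d) *\<^sub>C x" by (rule ell2_eqI) simp
  show "complex_of_real r *\<^sub>C x = r *\<^sub>R x" by (rule ell2_eqI) simp
  show "inner (c *\<^sub>C x) y = inner x (cnj c *\<^sub>C y)" by (simp add: inner_ell2_def mult_ac)
qed

end

lemma cinner_ell2: "cinner x y = (\<Sum>\<^sub>\<infinity>k. coord x k * cnj (coord y k))"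
proof -
  have "(\<Sum>\<^sub>\<infinity>k. coord x k * cnj (coord (\<i> *\<^sub>C y) k)) = - \<i> * (\<Sum>\<^sub>\<infinity>k. coord x k * cnj (coord y k))"
    by (simp add: infsum_cmult_right'[symmetric] mult_ac)
  then show ?thesis by (simp add: complex_eq_iff cinner_def inner_ell2_def)
qed

lemma cinner_has_sum: "((\<lambda>k. coord x k * cnj (coord y k)) has_sum cinner x y) UNIV"
  unfolding cinner_ell2 by (rule has_sum_infsum[OF summable_coord_product])

definition basis :: "'k \<Rightarrow> 'k ell2" where
  "basis k = Abs_ell2 (\<lambda>i. if i = k then 1 else 0)"

lemma coord_basis: "coord (basis k) i = (if i = k then 1 else 0)"
proof -
  have "(\<lambda>i. (cmod (if i = k then 1 else 0))\<^sup>2) summable_on {k}"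
    by simp
  then have "(\<lambda>i. (cmod (if i = k then 1 else 0))\<^sup>2) summable_on UNIV"
    by (rule summable_on_cong_neutral[THEN iffD1, rotated -1]) auto
  then show ?thesis by (simp add: basis_def coord_Abs)
qed

lemma cinner_basis [simp]: "cinner x (basis k) = coord x k"
proof -
  have "cinner x (basis k) = (\<Sum>\<^sub>\<infinity>i\<in>{k}. coord x i * cnj (coord (basis k) i))"
    unfolding cinner_ell2 by (rule infsum_cong_neutral) (auto simp: coord_basis)
  then show ?thesis by (simp add: coord_basis)
qed

lemma norm_basis [simp]: "norm (basis k) = 1"
  using cinner_self[of "basis k"] by (simp add: coord_basis norm_eq_sqrt_inner del: of_real_power
    flip: Re_cinner)

section \<open>Finite truncations and density of the basis\<close>

definition trunc :: "'k set \<Rightarrow> 'k ell2 \<Rightarrow> 'k ell2" where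
  "trunc F x = (\<Sum>k\<in>F. coord x k *\<^sub>C basis k)"

lemma coord_trunc: "finite F \<Longrightarrow> coord (trunc F x) k = (if k \<in> F then coord x k else 0)"
  by (simp add: trunc_def coord_sum coord_basis if_distrib cong: if_cong)

text \<open>By Pythagoras the squared error is the squared norm minus a partial sum of the
  convergent series of squares.\<close>

lemma tendsto_trunc: "((\<lambda>F. trunc F x) \<longlongrightarrow> x) (finite_subsets_at_top UNIV)"
proof -
  have eq: "(norm (x - trunc F x))\<^sup>2 = (norm x)\<^sup>2 - (\<Sum>k\<in>F. (cmod (coord x k))\<^sup>2)" if F: "finite F" for F
  proof -
    have "((\<lambda>k. if k \<in> F then (cmod (coord x k))\<^sup>2 else 0) has_sum (\<Sum>k\<in>F. (cmod (coord x k))\<^sup>2)) UNIV"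
      by (rule has_sum_cong_neutral[THEN iffD1, OF _ _ _ has_sum_finite[OF F]]) auto
    then have "((\<lambda>k. - (if k \<in> F then (cmod (coord x k))\<^sup>2 else 0)) has_sum - (\<Sum>k\<in>F. (cmod (coord x k))\<^sup>2)) UNIV"
      by (simp add: has_sum_uminus)
    from has_sum_add[OF norm_ell2_has_sum[of x] this]
    have "((\<lambda>k. (cmod (coord (x - trunc F x) k))\<^sup>2) has_sum (norm x)\<^sup>2 - (\<Sum>k\<in>F. (cmod (coord x k))\<^sup>2)) UNIV"
      unfolding add_uminus_conv_diff
      by (rule has_sum_cong[THEN iffD1, rotated -1]) (auto simp: coord_trunc F)
    then show ?thesis using has_sum_unique norm_ell2_has_sum by blast
  qed
  have "((\<lambda>F. (norm x)\<^sup>2 - (\<Sum>k\<in>F. (cmod (coord x k))\<^sup>2)) \<longlongrightarrow> (norm x)\<^sup>2 - (norm x)\<^sup>2) (finite_subsets_at_top UNIV)"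
    using norm_ell2_has_sum[of x] by (intro tendsto_intros) (simp add: has_sum_def)
  moreover have "eventually (\<lambda>F. (norm x)\<^sup>2 - (\<Sum>k\<in>F. (cmod (coord x k))\<^sup>2) = (norm (x - trunc F x))\<^sup>2) (finite_subsets_at_top UNIV)"
    using eventually_finite_subsets_at_top_weakI[of UNIV] by (rule eventually_mono) (simp_all add: eq)
  ultimately have "((\<lambda>F. (norm (x - trunc F x))\<^sup>2) \<longlongrightarrow> 0) (finite_subsets_at_top UNIV)"
    by (simp add: tendsto_cong)
  then have "((\<lambda>F. sqrt ((norm (x - trunc F x))\<^sup>2)) \<longlongrightarrow> sqrt 0) (finite_subsets_at_top UNIV)"
    by (intro tendsto_intros)
  then have "((\<lambda>F. norm (trunc F x - x)) \<longlongrightarrow> 0) (finite_subsets_at_top UNIV)"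
    by (simp add: norm_minus_commute)
  then show ?thesis by (rule LIM_zero_cancel[OF tendsto_norm_zero_cancel])
qed

lemma ell2_induct [consumes 2, case_names basis]:
  assumes "csubspace V" "closed V" "\<And>k. basis k \<in> V"
  shows "x \<in> V"
proof (rule Lim_in_closed_set[OF \<open>closed V\<close> _ _ tendsto_trunc])
  have "trunc F x \<in> V" for F
    unfolding trunc_def
    by (rule csubspace_sum[OF assms(1)], rule csubspace_scaleC[OF assms(1)], rule assms(3))
  then show "\<forall>\<^sub>F F in finite_subsets_at_top UNIV. trunc F x \<in> V" by simp
qed simp

section \<open>Averages over roots of unity\<close>

text \<open>The discrete counterpart of the normalized integral over the circle. For K = 0 the
  convention \<open>1 / 0 = 0\<close> makes the mean 0.\<close>

definition circle_avg :: "nat \<Rightarrow> (complex \<Rightarrow> 'a::real_vector) \<Rightarrow> 'a" where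
  "circle_avg K g = (1 / real K) *\<^sub>R (\<Sum>j<K. g (cis (2 * pi * real j / real K)))"

lemma circle_avg_add: "circle_avg K (\<lambda>w. f w + g w) = circle_avg K f + circle_avg K g"
  by (simp add: circle_avg_def sum.distrib scaleR_add_right)

lemma circle_avg_diff: "circle_avg K (\<lambda>w. f w - g w) = circle_avg K f - circle_avg K g"
  by (simp add: circle_avg_def sum_subtractf scaleR_diff_right)

lemma circle_avg_cmult: "circle_avg K (\<lambda>w. c * g w) = c * circle_avg K (g :: _ \<Rightarrow> 'a::real_algebra)"
  by (simp add: circle_avg_def sum_distrib_left[symmetric])

lemma circle_avg_sum: "circle_avg K (\<lambda>w. \<Sum>a\<in>A. f a w) = (\<Sum>a\<in>A. circle_avg K (f a))"
  unfolding circle_avg_def scaleR_sum_right[symmetric] by (subst sum.swap) simp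

lemma circle_avg_of_real: "circle_avg K (\<lambda>w. complex_of_real (g w)) = complex_of_real (circle_avg K g)"
  by (simp add: circle_avg_def scaleR_conv_of_real)

lemma circle_avg_cong: "(\<And>w. cmod w = 1 \<Longrightarrow> f w = g w) \<Longrightarrow> circle_avg K f = circle_avg K g"
  by (simp add: circle_avg_def)

lemma circle_avg_mono:
  "(\<And>w. cmod w = 1 \<Longrightarrow> f w \<le> g w) \<Longrightarrow> circle_avg K f \<le> circle_avg K (g :: _ \<Rightarrow> real)"
  by (simp add: circle_avg_def divide_right_mono sum_mono)

lemma circle_avg_const: "K > 0 \<Longrightarrow> circle_avg K (\<lambda>_. c) = (c::real)"
  by (simp add: circle_avg_def)

lemma circle_avg_bound:
  assumes "\<And>w. cmod w = 1 \<Longrightarrow> \<bar>f w\<bar> \<le> e" "0 \<le> e"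
  shows "\<bar>circle_avg K f\<bar> \<le> (e::real)"
proof (cases "K = 0")
  case False
  have "circle_avg K f \<le> circle_avg K (\<lambda>_. e)" "circle_avg K (\<lambda>_. -e) \<le> circle_avg K f"
    by (intro circle_avg_mono; use assms in \<open>force simp: abs_le_iff\<close>)+
  then show ?thesis using False by (simp add: circle_avg_const)
qed (use assms in \<open>simp add: circle_avg_def\<close>)

text \<open>After the roles of exponent and node are exchanged, the mean is a geometric sum in
  powers of u, a K-th root of unity that equals 1 only for k = l, since both indices are below
  K.\<close>

lemma circle_avg_orthogonal:
  assumes "k < K" "l < K"
  shows "circle_avg K (\<lambda>w. w ^ k * cnj (w ^ l)) = (if k = l then 1 else 0)"
proof -
  define v where "v i = cis (2 * pi * real i / real K)" for i
  define u where "u = v k * cnj (v l)"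
  have K: "K > 0" using assms by simp
  have cv: "cmod (v i) = 1" for i by (simp add: v_def)
  have "v j ^ k * cnj (v j ^ l) = u ^ j" for j
  proof -
    have "real k * (2 * pi * real j / real K) = real j * (2 * pi * real k / real K)" for k by simp
    then have "v j ^ k = v k ^ j" for k unfolding v_def Complex.DeMoivre by (simp only:)
    then show ?thesis by (simp add: u_def power_mult_distrib)
  qed
  then have eq: "circle_avg K (\<lambda>w. w ^ k * cnj (w ^ l)) = (1 / real K) *\<^sub>R (\<Sum>j<K. u ^ j)"
    by (simp add: circle_avg_def v_def)
  have vK: "v i ^ K = 1" for i
  proof -
    have "v i ^ K = cis (2 * pi * real i)" unfolding v_def Complex.DeMoivre using K by simp
    also have "\<dots> = 1" by (rule cis_multiple_2pi) simp
    finally show ?thesis .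
  qed
  show ?thesis
  proof (cases "k = l")
    case True
    have "u = 1"
      unfolding u_def True using cv[of l] by (simp add: complex_norm_square[symmetric])
    then show ?thesis unfolding eq using True K by (simp add: scaleR_conv_of_real)
  next
    case False
    have "u \<noteq> 1"
    proof
      assume "u = 1"
      then have "v k * (cnj (v l) * v l) = v l" by (simp add: u_def)
      moreover have "cnj (v l) * v l = 1"
        using cv[of l] by (simp add: complex_norm_square[symmetric] mult.commute)
      ultimately have "v k = v l" by simp
      then show False
        using False Complex.bij_betw_roots_unity[OF K] assms unfolding bij_betw_def inj_on_def v_def by blast
    qed
    moreover have "u ^ K = 1" by (simp add: u_def power_mult_distrib vK flip: complex_cnj_power)
    ultimately show ?thesis unfolding eq using False by (simp add: sum_gp_strict)
  qed
qed

lemma circle_avg_parseval_finite: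
  fixes y :: "nat \<Rightarrow> 'a::complex_hilbert"
  shows "circle_avg K (\<lambda>w. (norm (\<Sum>k<K. w ^ k *\<^sub>C y k))\<^sup>2) = (\<Sum>k<K. (norm (y k))\<^sup>2)"
proof -
  have "complex_of_real (circle_avg K (\<lambda>w. (norm (\<Sum>k<K. w ^ k *\<^sub>C y k))\<^sup>2))
      = circle_avg K (\<lambda>w. cinner (\<Sum>k<K. w ^ k *\<^sub>C y k) (\<Sum>k<K. w ^ k *\<^sub>C y k))"
    by (simp only: cinner_self circle_avg_of_real)
  also have "\<dots> = circle_avg K (\<lambda>w. \<Sum>l<K. cnj (w ^ l) * (\<Sum>k<K. w ^ k * cinner (y k) (y l)))"
    by (simp only: cinner_sum_left cinner_sum_right cinner_scaleC_left cinner_scaleC_right)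
  also have "\<dots> = circle_avg K (\<lambda>w. \<Sum>l<K. \<Sum>k<K. cinner (y k) (y l) * (w ^ k * cnj (w ^ l)))"
    by (simp only: sum_distrib_left mult_ac)
  also have "\<dots> = (\<Sum>l<K. \<Sum>k<K. cinner (y k) (y l) * circle_avg K (\<lambda>w. w ^ k * cnj (w ^ l)))"
    by (simp only: circle_avg_sum circle_avg_cmult)
  also have "\<dots> = (\<Sum>l<K. \<Sum>k<K. if k = l then cinner (y k) (y l) else 0)"
    by (intro sum.cong refl) (simp add: circle_avg_orthogonal del: complex_cnj_power)
  also have "\<dots> = complex_of_real (\<Sum>k<K. (norm (y k))\<^sup>2)"
    by (simp add: cinner_self)
  finally show ?thesis unfolding of_real_eq_iff .
qed

section \<open>Parseval's identity for power series with Hilbert space coefficients\<close>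

text \<open>K serves twice: for the partial sum of length K the mean over K nodes is exact, because
  distinct exponents below K are not congruent modulo K, and the remainder is uniformly small on the
  circle.\<close>

lemma circle_avg_parseval:
  fixes y :: "nat \<Rightarrow> 'a::complex_hilbert"
  assumes sy: "summable (\<lambda>k. norm (y k))"
  shows "summable (\<lambda>k. (norm (y k))\<^sup>2)"
    and "(\<lambda>K. circle_avg K (\<lambda>w. (norm (\<Sum>k. w ^ k *\<^sub>C y k))\<^sup>2)) \<longlonglongrightarrow> (\<Sum>k. (norm (y k))\<^sup>2)"
proof -
  show sq: "summable (\<lambda>k. (norm (y k))\<^sup>2)"
  proof (rule summable_comparison_test_ev[OF _ sy])
    have "eventually (\<lambda>k. norm (y k) < 1) sequentially"
      using order_tendstoD(2)[OF summable_LIMSEQ_zero[OF sy]] by simp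
    then show "\<forall>\<^sub>F k in sequentially. norm ((norm (y k))\<^sup>2) \<le> norm (y k)"
      by eventually_elim (simp add: power2_eq_square mult_left_le)
  qed
  define L where "L = (\<Sum>k. norm (y k))"
  define Y where "Y w = (\<Sum>k. w ^ k *\<^sub>C y k)" for w
  define tail where "tail K = (\<Sum>k. norm (y (k + K)))" for K
  have L0: "L \<ge> 0" unfolding L_def by (intro suminf_nonneg sy) simp
  have t0: "tail \<longlonglongrightarrow> 0"
    unfolding tail_def using suminf_exist_split2[OF sy] by simp
  have est: "\<bar>(norm (Y w))\<^sup>2 - (norm (\<Sum>k<K. w ^ k *\<^sub>C y k))\<^sup>2\<bar> \<le> 2 * L * tail K" if w: "cmod w = 1" for w K
  proof -
    have n: "norm (w ^ k *\<^sub>C y k) = norm (y k)" for k by (simp add: norm_power w)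
    have sw: "summable (\<lambda>k. w ^ k *\<^sub>C y k)" by (rule summable_norm_cancel) (simp only: n sy)
    have "Y w - (\<Sum>k<K. w ^ k *\<^sub>C y k) = (\<Sum>k. w ^ (k + K) *\<^sub>C y (k + K))"
      unfolding Y_def using suminf_split_initial_segment[OF sw, of K] by simp
    moreover have "norm \<dots> \<le> tail K" unfolding tail_def
      by (rule order_trans[OF summable_norm]) (simp_all only: n summable_ignore_initial_segment[OF sy] order_refl)
    ultimately have d: "norm (Y w - (\<Sum>k<K. w ^ k *\<^sub>C y k)) \<le> tail K" by simp
    have b1: "norm (Y w) \<le> L" unfolding Y_def L_def
      by (rule order_trans[OF summable_norm]) (simp_all only: n sy order_refl)
    have "norm (\<Sum>k<K. w ^ k *\<^sub>C y k) \<le> (\<Sum>k<K. norm (y k))"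
      by (rule order_trans[OF norm_sum]) (simp only: n order_refl)
    also have "\<dots> \<le> L" unfolding L_def by (rule sum_le_suminf[OF sy]) auto
    finally have b2: "norm (\<Sum>k<K. w ^ k *\<^sub>C y k) \<le> L" .
    define a b where "a = norm (Y w)" and "b = norm (\<Sum>k<K. w ^ k *\<^sub>C y k)"
    have "\<bar>a\<^sup>2 - b\<^sup>2\<bar> = \<bar>a - b\<bar> * (a + b)"
      by (simp add: power2_eq_square square_diff_square_factored abs_mult a_def b_def)
    also have "\<dots> \<le> tail K * (2 * L)"
      using b1 b2 order_trans[OF norm_triangle_ineq3 d]
      by (intro mult_mono) (auto simp: a_def b_def order_trans[OF norm_ge_zero d])
    finally show ?thesis by (simp add: a_def b_def mult_ac)
  qed
  have lim1: "(\<lambda>K. \<Sum>k<K. (norm (y k))\<^sup>2) \<longlonglongrightarrow> (\<Sum>k. (norm (y k))\<^sup>2)"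
    by (rule summable_LIMSEQ[OF sq])
  have "(\<lambda>K. circle_avg K (\<lambda>w. (norm (Y w))\<^sup>2) - (\<Sum>k<K. (norm (y k))\<^sup>2)) \<longlonglongrightarrow> 0"
  proof (rule Lim_null_comparison)
    have tail0: "tail K \<ge> 0" for K
      unfolding tail_def by (intro suminf_nonneg summable_ignore_initial_segment sy) simp
    have "\<bar>circle_avg K (\<lambda>w. (norm (Y w))\<^sup>2) - (\<Sum>k<K. (norm (y k))\<^sup>2)\<bar> \<le> 2 * L * tail K" for K
      unfolding circle_avg_parseval_finite[symmetric] circle_avg_diff[symmetric]
      by (rule circle_avg_bound[OF est]) (simp_all add: L0 tail0)
    then show "\<forall>\<^sub>F K in sequentially. norm (circle_avg K (\<lambda>w. (norm (Y w))\<^sup>2) - (\<Sum>k<K. (norm (y k))\<^sup>2)) \<le> 2 * L * tail K"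
      by simp
    show "(\<lambda>K. 2 * L * tail K) \<longlonglongrightarrow> 0"
      using tendsto_mult_right_zero[OF t0] by simp
  qed
  from tendsto_add[OF this lim1]
  show "(\<lambda>K. circle_avg K (\<lambda>w. (norm (\<Sum>k. w ^ k *\<^sub>C y k))\<^sup>2)) \<longlonglongrightarrow> (\<Sum>k. (norm (y k))\<^sup>2)"
    by (simp add: Y_def)
qed

text \<open>The terms are bounded at a radius r between \<rho> and 1, so at \<rho> they decay like
  the powers of \<rho> / r.\<close>

lemma summable_dilation:
  fixes x :: "nat \<Rightarrow> 'a::complex_hilbert"
  assumes "\<And>\<zeta>. cmod \<zeta> < 1 \<Longrightarrow> summable (\<lambda>k. \<zeta> ^ k *\<^sub>C x k)" "0 \<le> \<rho>" "\<rho> < 1"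
  shows "summable (\<lambda>k. norm (complex_of_real \<rho> ^ k *\<^sub>C x k))"
proof -
  define r where "r = (1 + \<rho>) / 2"
  have r: "\<rho> < r" "r < 1" "0 < r" using assms by (auto simp: r_def)
  have "summable (\<lambda>k. complex_of_real r ^ k *\<^sub>C x k)" using assms(1)[of "of_real r"] r by simp
  from summable_imp_bounded[OF this] obtain B where B: "\<And>k. norm (complex_of_real r ^ k *\<^sub>C x k) \<le> B"
    by (auto simp: bounded_iff)
  show ?thesis
  proof (rule summable_comparison_test)
    show "summable (\<lambda>k. B * (\<rho> / r) ^ k)"
      using r assms by (intro summable_mult summable_geometric) auto
    have "norm (complex_of_real \<rho> ^ k *\<^sub>C x k) \<le> B * (\<rho> / r) ^ k" for k
    proof -
      have "norm (complex_of_real \<rho> ^ k *\<^sub>C x k) = norm (complex_of_real r ^ k *\<^sub>C x k) * (\<rho> / r) ^ k"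
        using r assms by (simp add: norm_power power_divide)
      also have "\<dots> \<le> B * (\<rho> / r) ^ k" using r assms by (intro mult_right_mono B) simp
      finally show ?thesis .
    qed
    then show "\<exists>N. \<forall>k\<ge>N. norm (norm (complex_of_real \<rho> ^ k *\<^sub>C x k)) \<le> B * (\<rho> / r) ^ k" by auto
  qed
qed

lemma circle_avg_parseval_dilated:
  fixes x :: "nat \<Rightarrow> 'a::complex_hilbert" and G :: "complex \<Rightarrow> 'a"
  assumes sums: "\<And>\<zeta>. cmod \<zeta> < 1 \<Longrightarrow> (\<lambda>k. \<zeta> ^ k *\<^sub>C x k) sums G \<zeta>"
    and that: "0 \<le> \<rho>" "\<rho> < 1"
  shows "summable (\<lambda>k. \<rho> ^ (2 * k) * (norm (x k))\<^sup>2)"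
    and "(\<lambda>K. circle_avg K (\<lambda>w. (norm (G (complex_of_real \<rho> * w)))\<^sup>2)) \<longlonglongrightarrow> (\<Sum>k. \<rho> ^ (2 * k) * (norm (x k))\<^sup>2)"
proof -
  have Grho: "G (complex_of_real \<rho> * w) = (\<Sum>k. w ^ k *\<^sub>C (complex_of_real \<rho> ^ k *\<^sub>C x k))"
    if "cmod w = 1" for w
    using sums_unique[OF sums[of "of_real \<rho> * w"]] that assms(2,3)
    by (simp add: norm_mult power_mult_distrib mult.commute)
  have s: "summable (\<lambda>k. norm (complex_of_real \<rho> ^ k *\<^sub>C x k))"
    by (rule summable_dilation[OF _ that]) (use sums in \<open>auto simp: sums_iff\<close>)
  have n: "(norm (complex_of_real \<rho> ^ k *\<^sub>C x k))\<^sup>2 = \<rho> ^ (2 * k) * (norm (x k))\<^sup>2" for k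
    using that by (simp add: norm_power power_mult_distrib power_mult[symmetric] mult.commute)
  have e: "circle_avg K (\<lambda>w. (norm (G (complex_of_real \<rho> * w)))\<^sup>2) =
      circle_avg K (\<lambda>w. (norm (\<Sum>k. w ^ k *\<^sub>C (complex_of_real \<rho> ^ k *\<^sub>C x k)))\<^sup>2)" for K
    by (rule circle_avg_cong) (simp only: Grho)
  show "(\<lambda>K. circle_avg K (\<lambda>w. (norm (G (complex_of_real \<rho> * w)))\<^sup>2)) \<longlonglongrightarrow> (\<Sum>k. \<rho> ^ (2 * k) * (norm (x k))\<^sup>2)"
    unfolding e using circle_avg_parseval(2)[OF s] unfolding n .
  show "summable (\<lambda>k. \<rho> ^ (2 * k) * (norm (x k))\<^sup>2)"
    using circle_avg_parseval(1)[OF s] unfolding n .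
qed

text \<open>Radial limits are uniform, so the averages over roots of unity can be compared with
  those over a smaller circle.\<close>

lemma circle_avg_parseval_continuous:
  fixes x :: "nat \<Rightarrow> 'a::complex_hilbert" and G :: "complex \<Rightarrow> 'a"
  assumes G: "continuous_on (cball 0 1) G"
    and sums: "\<And>\<zeta>. cmod \<zeta> < 1 \<Longrightarrow> (\<lambda>k. \<zeta> ^ k *\<^sub>C x k) sums G \<zeta>"
  shows "summable (\<lambda>k. (norm (x k))\<^sup>2)"
    and "(\<lambda>K. circle_avg K (\<lambda>w. (norm (G w))\<^sup>2)) \<longlonglongrightarrow> (\<Sum>k. (norm (x k))\<^sup>2)"
proof -
  define g where "g w = (norm (G w))\<^sup>2" for w
  have gc: "continuous_on (cball 0 1) g" unfolding g_def by (intro continuous_intros G)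
  have "bounded (g ` cball 0 1)" by (intro compact_imp_bounded compact_continuous_image gc) simp
  then obtain M where M: "\<And>w. cmod w \<le> 1 \<Longrightarrow> \<bar>g w\<bar> \<le> M" by (force simp: bounded_iff)
  have rho: "(\<lambda>K. circle_avg K (\<lambda>w. g (complex_of_real \<rho> * w))) \<longlonglongrightarrow> (\<Sum>k. \<rho> ^ (2 * k) * (norm (x k))\<^sup>2)"
    "summable (\<lambda>k. \<rho> ^ (2 * k) * (norm (x k))\<^sup>2)" if "0 \<le> \<rho>" "\<rho> < 1" for \<rho>
    unfolding g_def
    by (rule circle_avg_parseval_dilated(2); use sums that in blast)
      (rule circle_avg_parseval_dilated(1); use sums that in blast)
  define rs where "rs n = 1 - 1 / real (Suc n)" for n
  have rs: "0 \<le> rs n" "rs n < 1" for n by (auto simp: rs_def field_simps)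
  have rs1: "rs \<longlonglongrightarrow> 1 - 0" unfolding rs_def
    by (intro tendsto_intros LIMSEQ_inverse_real_of_nat[unfolded inverse_eq_divide])
  \<comment> \<open>Every mean is at most M, hence so is each dilated series; letting the radius
    tend to 1 in a finite sum gives square summability.\<close>
  have part: "(\<Sum>k<N. (norm (x k))\<^sup>2) \<le> M" for N
  proof (rule LIMSEQ_le_const2)
    show "(\<lambda>n. \<Sum>k<N. rs n ^ (2 * k) * (norm (x k))\<^sup>2) \<longlonglongrightarrow> (\<Sum>k<N. (norm (x k))\<^sup>2)"
      using rs1 by (auto intro!: tendsto_eq_intros)
    have "(\<Sum>k<N. rs n ^ (2 * k) * (norm (x k))\<^sup>2) \<le> M" for n
    proof -
      have "(\<Sum>k<N. rs n ^ (2 * k) * (norm (x k))\<^sup>2) \<le> (\<Sum>k. rs n ^ (2 * k) * (norm (x k))\<^sup>2)"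
        by (rule sum_le_suminf[OF rho(2)[OF rs]]) (use rs in auto)
      also have "\<dots> \<le> M"
      proof (rule LIMSEQ_le_const2[OF rho(1)[OF rs]])
        have "\<bar>circle_avg K (\<lambda>w. g (complex_of_real (rs n) * w))\<bar> \<le> M" for K
          using rs[of n] order_trans[OF abs_ge_zero M[of 0]]
          by (intro circle_avg_bound M) (auto simp: norm_mult)
        then show "\<exists>N. \<forall>K\<ge>N. circle_avg K (\<lambda>w. g (complex_of_real (rs n) * w)) \<le> M"
          by (auto simp: abs_le_iff)
      qed
      finally show ?thesis .
    qed
    then show "\<exists>n0. \<forall>n\<ge>n0. (\<Sum>k<N. rs n ^ (2 * k) * (norm (x k))\<^sup>2) \<le> M" by blast
  qed
  show sq: "summable (\<lambda>k. (norm (x k))\<^sup>2)"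
    by (rule summableI_nonneg_bounded[of _ M]) (use part in auto)
  \<comment> \<open>Domination by the undilated series, now known to converge, allows the radius to
    tend to 1 under the infinite sum.\<close>
  have sconv: "(\<lambda>n. \<Sum>k. rs n ^ (2 * k) * (norm (x k))\<^sup>2) \<longlonglongrightarrow> (\<Sum>k. (norm (x k))\<^sup>2)"
  proof (rule tannerys_theorem[THEN conjunct2, THEN conjunct2])
    show "summable (\<lambda>k. (norm (x k))\<^sup>2)" by (rule sq)
    show "(\<lambda>n. rs n ^ (2 * k) * (norm (x k))\<^sup>2) \<longlonglongrightarrow> (norm (x k))\<^sup>2" for k
      using rs1 by (auto intro!: tendsto_eq_intros)
    have "norm (rs n ^ (2 * k) * (norm (x k))\<^sup>2) \<le> (norm (x k))\<^sup>2" for n k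
      using rs[of n] by (auto simp: mult_left_le_one_le power_le_one abs_mult)
    then show "\<forall>\<^sub>F (k, n) in sequentially \<times>\<^sub>F sequentially. norm (rs n ^ (2 * k) * (norm (x k))\<^sup>2) \<le> (norm (x k))\<^sup>2"
      by (simp add: case_prod_unfold)
  qed simp
  have uc: "uniformly_continuous_on (cball 0 1) g"
    by (rule compact_uniformly_continuous[OF gc]) simp
  show "(\<lambda>K. circle_avg K (\<lambda>w. (norm (G w))\<^sup>2)) \<longlonglongrightarrow> (\<Sum>k. (norm (x k))\<^sup>2)"
    unfolding g_def[symmetric]
  proof (rule LIMSEQ_I)
    fix e :: real assume e: "e > 0"
    have "e / 3 > 0" using e by simp
    with uc obtain d where d: "d > 0"
      "\<forall>w\<in>cball 0 1. \<forall>w'\<in>cball 0 1. dist w' w < d \<longrightarrow> dist (g w') (g w) < e / 3"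
      unfolding uniformly_continuous_on_def by blast
    have "eventually (\<lambda>n. \<bar>(\<Sum>k. rs n ^ (2 * k) * (norm (x k))\<^sup>2) - (\<Sum>k. (norm (x k))\<^sup>2)\<bar> < e / 3) sequentially"
      using tendstoD[OF sconv, of "e/3"] e by (simp add: dist_real_def)
    moreover have "eventually (\<lambda>n. 1 - d < rs n) sequentially"
      using d by (intro order_tendstoD[OF rs1]) simp
    ultimately have "eventually (\<lambda>n. \<bar>(\<Sum>k. rs n ^ (2 * k) * (norm (x k))\<^sup>2) - (\<Sum>k. (norm (x k))\<^sup>2)\<bar> < e / 3 \<and> 1 - d < rs n) sequentially"
      by eventually_elim simp
    then obtain n where n: "\<bar>(\<Sum>k. rs n ^ (2 * k) * (norm (x k))\<^sup>2) - (\<Sum>k. (norm (x k))\<^sup>2)\<bar> < e / 3" "1 - d < rs n"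
      by (auto simp: eventually_sequentially)
    obtain K0 where K0: "\<And>K. K \<ge> K0 \<Longrightarrow>
        \<bar>circle_avg K (\<lambda>w. g (complex_of_real (rs n) * w)) - (\<Sum>k. rs n ^ (2 * k) * (norm (x k))\<^sup>2)\<bar> < e / 3"
      using LIMSEQ_D[OF rho(1)[OF rs[of n]], of "e/3"] e by auto
    \<comment> \<open>The radius was fixed before K: uniform continuity makes this error small for
      all K simultaneously, so the two limits may be exchanged.\<close>
    have close: "\<bar>circle_avg K g - circle_avg K (\<lambda>w. g (complex_of_real (rs n) * w))\<bar> \<le> e / 3" for K
      unfolding circle_avg_diff[symmetric]
    proof (rule circle_avg_bound)
      fix w :: complex assume w: "cmod w = 1"
      have "dist w (of_real (rs n) * w) = cmod ((1 - complex_of_real (rs n)) * w)"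
        by (simp add: dist_norm algebra_simps)
      also have "1 - complex_of_real (rs n) = complex_of_real (1 - rs n)" by simp
      also have "cmod (\<dots> * w) = 1 - rs n" using rs[of n] w by (simp only: norm_mult norm_of_real) simp
      finally have "dist w (of_real (rs n) * w) < d" using n(2) by simp
      then have "dist (g w) (g (of_real (rs n) * w)) < e / 3"
        using rs[of n] w by (intro d(2)[rule_format]) (auto simp: norm_mult)
      then show "\<bar>g w - g (of_real (rs n) * w)\<bar> \<le> e / 3" by (simp add: dist_real_def)
    qed (use e in simp)
    have "norm (circle_avg K g - (\<Sum>k. (norm (x k))\<^sup>2)) < e" if "K \<ge> K0" for K
      using K0[OF that] n(1) close[of K] unfolding real_norm_def by arith
    then show "\<exists>no. \<forall>K\<ge>no. norm (circle_avg K g - (\<Sum>k. (norm (x k))\<^sup>2)) < e" by blast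
  qed
qed

section \<open>Hardy spaces\<close>

text \<open>Backward shifts, rows and columns are all restrictions along an injection. Injectivity
  keeps the family square-summable, so that \<open>Abs_ell2\<close> is applied inside its
  domain.\<close>

definition pull :: "('i \<Rightarrow> 'k) \<Rightarrow> 'k ell2 \<Rightarrow> 'i ell2" where
  "pull g x = Abs_ell2 (\<lambda>i. coord x (g i))"

lemma coord_pull: "inj g \<Longrightarrow> coord (pull g x) i = coord x (g i)"
proof -
  assume g: "inj g"
  have "(\<lambda>k. (cmod (coord x k))\<^sup>2) summable_on range g"
    using coord_summable by (rule summable_on_subset_banach) simp
  then have "(\<lambda>i. (cmod (coord x (g i)))\<^sup>2) summable_on UNIV"
    using summable_on_reindex[OF g, of "\<lambda>k. (cmod (coord x k))\<^sup>2"] by (simp add: o_def)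
  then show ?thesis by (simp add: pull_def coord_Abs)
qed

lemma norm_pull_le: "inj g \<Longrightarrow> norm (pull g x) \<le> norm x"
proof (rule power2_le_imp_le)
  assume g: "inj g"
  show "(norm (pull g x))\<^sup>2 \<le> (norm x)\<^sup>2"
    unfolding norm_ell2_square[of "pull g x"]
  proof (rule infsum_le_finite_sums[OF coord_summable])
    fix F :: "'a set" assume F: "finite F"
    have "(\<Sum>i\<in>F. (cmod (coord (pull g x) i))\<^sup>2) = (\<Sum>k\<in>g ` F. (cmod (coord x k))\<^sup>2)"
      using g by (simp add: coord_pull sum.reindex inj_on_def)
    also have "\<dots> \<le> (norm x)\<^sup>2" by (intro sum_coord_le finite_imageI F)
    finally show "(\<Sum>i\<in>F. (cmod (coord (pull g x) i))\<^sup>2) \<le> (norm x)\<^sup>2" .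
  qed
qed simp

section \<open>Forward and backward shifts\<close>

text \<open>Multiplication by the monomial with exponent a. Membership in
  \<open>range ((+) a)\<close> expresses divisibility by that monomial, which treats one and two
  variables at once.\<close>

definition shift :: "'k::cancel_comm_monoid_add \<Rightarrow> 'k ell2 \<Rightarrow> 'k ell2" where
  "shift a x = Abs_ell2 (\<lambda>k. if k \<in> range ((+) a) then coord x (inv ((+) a) k) else 0)"

abbreviation bshift :: "'k::cancel_comm_monoid_add \<Rightarrow> 'k ell2 \<Rightarrow> 'k ell2" where
  "bshift a \<equiv> pull ((+) a)"

lemma inj_plus: "inj ((+) (a::'k::cancel_comm_monoid_add))"
  by (simp add: inj_def)

lemma coord_shift_aux:
  "coord (shift a x) k = (if k \<in> range ((+) a) then coord x (inv ((+) a) k) else 0)"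
proof -
  have "((\<lambda>k. (cmod (coord x (inv ((+) a) k)))\<^sup>2) \<circ> (+) a) summable_on UNIV"
    using coord_summable[of x] by (simp add: o_def inv_f_f[OF inj_plus])
  then have "(\<lambda>k. (cmod (coord x (inv ((+) a) k)))\<^sup>2) summable_on range ((+) a)"
    using summable_on_reindex[OF inj_plus] by blast
  then have "(\<lambda>k. (cmod (if k \<in> range ((+) a) then coord x (inv ((+) a) k) else 0))\<^sup>2) summable_on UNIV"
    by (rule summable_on_cong_neutral[THEN iffD1, rotated -1]) auto
  then show ?thesis unfolding shift_def by (subst coord_Abs) auto
qed

lemma coord_shift [simp]: "coord (shift a x) (a + k) = coord x k"
  by (simp add: coord_shift_aux inv_f_f[OF inj_plus])

lemma coord_shift_0: "k \<notin> range ((+) a) \<Longrightarrow> coord (shift a x) k = 0"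
  by (simp add: coord_shift_aux)

lemma coord_bshift [simp]: "coord (bshift a x) k = coord x (a + k)"
  by (simp add: coord_pull[OF inj_plus])

lemma coord_shift_nat: "coord (shift a x) k = (if a \<le> k then coord x (k - a) else 0)" for a :: nat
proof (cases "a \<le> k")
  case True
  then show ?thesis using coord_shift[of a x "k - a"] by simp
qed (auto intro!: coord_shift_0)

lemma cinner_shift: "cinner (shift a x) y = cinner x (bshift a y)"
proof -
  have "cinner (shift a x) y = (\<Sum>\<^sub>\<infinity>k\<in>range ((+) a). coord (shift a x) k * cnj (coord y k))"
    unfolding cinner_ell2 by (rule infsum_cong_neutral) (auto simp: coord_shift_0)
  also have "\<dots> = (\<Sum>\<^sub>\<infinity>k. coord x k * cnj (coord y (a + k)))"
    by (subst infsum_reindex[OF inj_plus]) (simp add: o_def)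
  finally show ?thesis by (simp add: cinner_ell2)
qed

lemma bshift_shift [simp]: "bshift a (shift a x) = x"
  by (rule ell2_eqI) simp

lemma cinner_shift_shift [simp]: "cinner (shift a x) (shift a y) = cinner x y"
  by (simp add: cinner_shift)

lemma norm_shift [simp]: "norm (shift a x) = norm x"
  by (simp add: norm_eq_sqrt_inner flip: Re_cinner)

lemma shift_add: "shift a (x + y) = shift a x + shift a y"
  by (rule ell2_eqI) (simp add: coord_shift_aux)

lemma shift_diff: "shift a (x - y) = shift a x - shift a y"
  by (rule ell2_eqI) (simp add: coord_shift_aux)

lemma shift_scaleC: "shift a (c *\<^sub>C x) = c *\<^sub>C shift a x"
  by (rule ell2_eqI) (simp add: coord_shift_aux)

lemma shift_sum: "shift a (sum f A) = (\<Sum>i\<in>A. shift a (f i))"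
  by (rule ell2_eqI) (simp add: coord_shift_aux coord_sum)

lemma shift_shift: "shift a (shift b x) = shift (a + b) x"
proof (rule ell2_eqI)
  fix k
  show "coord (shift a (shift b x)) k = coord (shift (a + b) x) k"
  proof (cases "k \<in> range ((+) a)")
    case True
    then obtain l where l: "k = a + l" by auto
    show ?thesis
    proof (cases "l \<in> range ((+) b)")
      case True
      then obtain i where "l = b + i" by auto
      then show ?thesis using coord_shift[of "a + b" x i] by (simp add: l add.assoc)
    next
      case False
      moreover have "k \<notin> range ((+) (a + b))"
        using False by (auto simp: l add.assoc)
      ultimately show ?thesis by (simp add: l coord_shift_0)
    qed
  next
    case False
    moreover have "k \<notin> range ((+) (a + b))" using False by (auto simp: add.assoc)
    ultimately show ?thesis by (simp add: coord_shift_0)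
  qed
qed

lemma shift_zero [simp]: "shift 0 x = x"
  by (rule ell2_eqI) (metis add_0 coord_shift)

lemma shift_basis: "shift a (basis k) = basis (a + k)"
proof (rule ell2_eqI)
  fix i
  show "coord (shift a (basis k)) i = coord (basis (a + k)) i"
    by (cases "i \<in> range ((+) a)") (auto simp: coord_basis coord_shift_0)
qed

lemma bounded_linear_shift: "bounded_linear (shift a)"
  by (rule bounded_linear_intro[of _ 1]) (auto simp: shift_add shift_scaleC simp flip: scaleC_of_real)

lemmas tendsto_shift [tendsto_intros] = bounded_linear.tendsto[OF bounded_linear_shift]
lemmas continuous_on_shift [continuous_intros] = bounded_linear.continuous_on[OF bounded_linear_shift]

text \<open>Both Hardy spaces are reproducing kernel Hilbert spaces of power series; the index
  type carries the addition under which monomials multiply.\<close>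

locale power_series_space =
  fixes A :: "'z set" and mn :: "'k::cancel_comm_monoid_add \<Rightarrow> 'z \<Rightarrow> complex"
  assumes summable_mn: "z \<in> A \<Longrightarrow> (\<lambda>k. (cmod (mn k z))\<^sup>2) summable_on UNIV"
    and mn_add: "mn (a + b) z = mn a z * mn b z"
    and separating: "(\<And>z. z \<in> A \<Longrightarrow> (\<Sum>\<^sub>\<infinity>k. coord x k * mn k z) = 0) \<Longrightarrow> x = 0"
begin

text \<open>The reproducing kernel at z: evaluation becomes an inner product, hence linear and
  continuous.\<close>

definition kern :: "'z \<Rightarrow> 'k ell2" where
  "kern z = Abs_ell2 (\<lambda>k. cnj (mn k z))"

definition ev :: "'k ell2 \<Rightarrow> 'z \<Rightarrow> complex" where
  "ev x z = cinner x (kern z)"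

definition toF :: "'k ell2 \<Rightarrow> 'z \<Rightarrow> complex" where
  "toF x z = (if z \<in> A then ev x z else 0)"

lemma coord_kern: "z \<in> A \<Longrightarrow> coord (kern z) k = cnj (mn k z)"
  unfolding kern_def by (subst coord_Abs) (auto simp: summable_mn)

lemma ev_has_sum: "z \<in> A \<Longrightarrow> ((\<lambda>k. coord x k * mn k z) has_sum ev x z) UNIV"
  using cinner_has_sum[of x "kern z"] by (simp add: coord_kern ev_def)

lemma ev_add [simp]: "ev (x + y) z = ev x z + ev y z"
  and ev_diff [simp]: "ev (x - y) z = ev x z - ev y z"
  and ev_scaleC [simp]: "ev (c *\<^sub>C x) z = c * ev x z"
  and ev_zero [simp]: "ev 0 z = 0"
  and ev_sum: "ev (sum f I) z = (\<Sum>i\<in>I. ev (f i) z)"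
  by (simp_all add: ev_def cinner_add_left cinner_diff_left cinner_scaleC_left cinner_sum_left)

lemma ev_basis: "z \<in> A \<Longrightarrow> ev (basis k) z = mn k z"
  unfolding ev_def by (subst cnj_cinner[symmetric]) (simp add: coord_kern)

lemma ev_shift: "z \<in> A \<Longrightarrow> ev (shift a x) z = mn a z * ev x z"
proof -
  assume z: "z \<in> A"
  have "bshift a (kern z) = cnj (mn a z) *\<^sub>C kern z"
    by (rule ell2_eqI) (simp add: coord_kern z mn_add)
  then show ?thesis by (simp add: ev_def cinner_shift cinner_scaleC_right)
qed

lemma ev_eqI: "(\<And>z. z \<in> A \<Longrightarrow> ev x z = ev y z) \<Longrightarrow> x = y"
proof -
  assume eq: "\<And>z. z \<in> A \<Longrightarrow> ev x z = ev y z"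
  have "(\<Sum>\<^sub>\<infinity>k. coord (x - y) k * mn k z) = 0" if "z \<in> A" for z
    using infsumI[OF ev_has_sum[OF that, of "x - y"]] eq[OF that] by simp
  then have "x - y = 0" by (rule separating)
  then show ?thesis by simp
qed

lemma toF_inject [simp]: "toF x = toF y \<longleftrightarrow> x = y"
proof
  assume eq: "toF x = toF y"
  have "ev x z = ev y z" if "z \<in> A" for z
    using that fun_cong[OF eq, of z] by (simp add: toF_def)
  then show "x = y" by (rule ev_eqI)
qed simp

lemma toF_add: "toF (x + y) = (\<lambda>z. toF x z + toF y z)"
  and toF_diff: "toF (x - y) = (\<lambda>z. toF x z - toF y z)"
  and toF_scaleC: "toF (c *\<^sub>C x) = (\<lambda>z. c * toF x z)"
  and toF_zero: "toF 0 = (\<lambda>z. 0)"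
  by (auto simp: toF_def)

lemma ev_unique:
  assumes "(\<lambda>k. (cmod (c k))\<^sup>2) summable_on UNIV"
    and "\<And>z. z \<in> A \<Longrightarrow> ((\<lambda>k. c k * mn k z) has_sum ev x z) UNIV"
  shows "c = coord x"
proof -
  define y where "y = Abs_ell2 c"
  have y: "coord y k = c k" for k by (simp add: y_def coord_Abs assms)
  have "ev y z = ev x z" if "z \<in> A" for z
    using ev_has_sum[OF that, of y] assms(2)[OF that] has_sum_unique unfolding y by blast
  then have "y = x" by (rule ev_eqI)
  then show ?thesis using y by auto
qed

text \<open>\<open>ev_unique\<close> leaves only one candidate for the choice in
  \<open>hcoeff\<close>, so inner products and norms of functions reduce to those of their
  coefficient families.\<close>

lemma hcoeff_toF [simp]: "hcoeff A mn (toF x) = coord x"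
  unfolding hcoeff_def
proof (rule some_equality)
  show "(\<lambda>k. (cmod (coord x k))\<^sup>2) summable_on UNIV \<and> (\<forall>z\<in>A. ((\<lambda>k. coord x k * mn k z) has_sum toF x z) UNIV)"
    using ev_has_sum by (auto simp: coord_summable toF_def)
qed (auto simp: toF_def intro!: ev_unique)

lemma hinner_toF [simp]: "hinner A mn (toF x) (toF y) = cinner x y"
  by (simp add: hinner_def cinner_ell2)

lemma hnorm_toF [simp]: "hnorm A mn (toF x) = norm x"
  by (simp add: hnorm_def norm_ell2_square[symmetric])

lemma Hsp_eq: "Hsp A mn = range toF"
proof (intro equalityI subsetI)
  fix f assume "f \<in> Hsp A mn"
  then obtain c where c: "(\<lambda>k. (cmod (c k))\<^sup>2) summable_on UNIV"
    "\<forall>z\<in>A. ((\<lambda>k. c k * mn k z) has_sum f z) UNIV" "\<forall>z. z \<notin> A \<longrightarrow> f z = 0"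
    unfolding Hsp_def by blast
  have cA: "coord (Abs_ell2 c) k = c k" for k by (simp add: coord_Abs c)
  have "f z = toF (Abs_ell2 c) z" for z
  proof (cases "z \<in> A")
    case True
    have hs: "((\<lambda>k. c k * mn k z) has_sum ev (Abs_ell2 c) z) UNIV"
      using ev_has_sum[OF True, of "Abs_ell2 c"] unfolding cA .
    show ?thesis using has_sum_unique[OF c(2)[rule_format, OF True] hs] True by (simp add: toF_def)
  qed (use c in \<open>simp add: toF_def\<close>)
  then have "f = toF (Abs_ell2 c)" by blast
  then show "f \<in> range toF" by blast
next
  fix f assume "f \<in> range toF"
  then show "f \<in> Hsp A mn"
    unfolding Hsp_def using ev_has_sum coord_summable by (fastforce simp: toF_def)
qed

lemma closed_subspaceD:
  assumes S: "closed_subspace A mn S"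
  obtains V where "csubspace V" "closed V" "S = toF ` V"
proof
  define V where "V = toF -` S"
  show SV: "S = toF ` V"
    using S by (auto simp: closed_subspace_def Hsp_eq V_def)
  show "csubspace V"
    using S unfolding closed_subspace_def csubspace_def V_def
    by (simp add: toF_add toF_scaleC toF_zero)
  show "closed V"
    unfolding closed_sequential_limits
  proof safe
    fix X x assume X: "\<forall>n::nat. X n \<in> V" "X \<longlonglongrightarrow> x"
    have "(\<lambda>i. hnorm A mn (\<lambda>z. toF (X i) z - toF x z)) \<longlonglongrightarrow> 0"
      using X(2) by (simp add: toF_diff[symmetric] tendsto_norm_zero_iff LIM_zero_iff)
    moreover have "toF x \<in> Hsp A mn" "\<forall>i. toF (X i) \<in> S" using X by (auto simp: Hsp_eq V_def)
    moreover have "\<forall>F f. (\<forall>i. F i \<in> S) \<and> f \<in> Hsp A mn \<and>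
        (\<lambda>i. hnorm A mn (\<lambda>z. F i z - f z)) \<longlonglongrightarrow> 0 \<longrightarrow> f \<in> S"
      using S unfolding closed_subspace_def by (elim conjE)
    ultimately have "toF x \<in> S" by (elim allE[of _ "\<lambda>i. toF (X i)"] allE[of _ "toF x"]) simp
    then show "x \<in> V" by (simp add: V_def)
  qed
qed

lemma hproj_toF:
  assumes "csubspace V" "closed V"
  obtains p where "p \<in> V" "\<And>s. s \<in> V \<Longrightarrow> cinner (x - p) s = 0" "hproj A mn (toF ` V) (toF x) = toF p"
proof -
  obtain p where p: "p \<in> V" "\<And>s. s \<in> V \<Longrightarrow> cinner (x - p) s = 0"
    using projection_exists[OF assms] by blast
  have "hproj A mn (toF ` V) (toF x) = toF p"
    unfolding hproj_def
  proof (rule the_equality)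
    show "toF p \<in> toF ` V \<and> (\<forall>s\<in>toF ` V. hinner A mn (\<lambda>z. toF x z - toF p z) s = 0)"
      using p by (auto simp: toF_diff[symmetric])
    fix g assume g: "g \<in> toF ` V \<and> (\<forall>s\<in>toF ` V. hinner A mn (\<lambda>z. toF x z - g z) s = 0)"
    then obtain q where q: "q \<in> V" "g = toF q" by blast
    have qs: "cinner (x - q) s = 0" if "s \<in> V" for s
      using g that by (auto simp: q toF_diff[symmetric])
    have "p - q \<in> V" using assms(1) p(1) q(1) by (rule csubspace_diff)
    then have "cinner (x - q) (p - q) - cinner (x - p) (p - q) = 0" using qs p(2) by simp
    then have "cinner (p - q) (p - q) = 0" by (simp flip: cinner_diff_left)
    then show "g = toF p" by (simp add: cinner_self q)
  qed
  with p that show thesis by blast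
qed

text \<open>The projection disappears from the quadratic form: it changes M x by a vector orthogonal
  to V, and x lies in V.\<close>

lemma numrange_compression:
  assumes V: "csubspace V" "closed V"
    and M: "\<And>x. x \<in> V \<Longrightarrow> (\<lambda>z. \<phi> z * toF x z) = toF (M x)"
  shows "numrange A mn (toF ` V) (compression A mn (toF ` V) \<phi>) = {cinner (M x) x | x. x \<in> V \<and> norm x = 1}"
proof -
  have "hinner A mn (compression A mn (toF ` V) \<phi> (toF x)) (toF x) = cinner (M x) x" if x: "x \<in> V" for x
  proof -
    obtain p where p: "\<And>s. s \<in> V \<Longrightarrow> cinner (M x - p) s = 0" "hproj A mn (toF ` V) (toF (M x)) = toF p"
      using hproj_toF[OF V] by metis
    then show ?thesis using p(1)[OF x] by (simp add: compression_def M[OF x] cinner_diff_left)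
  qed
  then show ?thesis unfolding numrange_def by force
qed

end

section \<open>The Hardy space of the disk\<close>

lemma powser_zero_coeffs:
  fixes a :: "nat \<Rightarrow> complex"
  assumes "\<And>z. cmod z < 1 \<Longrightarrow> (\<lambda>k. a k * z ^ k) sums 0"
  shows "a k = 0"
proof (rule ccontr)
  assume k: "a k \<noteq> 0"
  have "a 0 = 0" using assms[of 0] powser_sums_zero_iff[of a 0] by simp
  with k have "k > 0" by (cases k) auto
  show False
  proof (rule powser_0_nonzero[of 1 0 a "\<lambda>_. 0" k])
    fix s :: real assume "0 < s" and ne: "\<And>z::complex. z \<in> cball 0 s - {0} \<Longrightarrow> (0::complex) \<noteq> 0"
    then show False using ne[of "complex_of_real s"] by simp
  qed (use assms k \<open>k > 0\<close> in auto)
qed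

lemma geometric_sq_summable:
  fixes z :: complex
  assumes "cmod z < 1"
  shows "(\<lambda>k. (cmod (z ^ k))\<^sup>2) summable_on UNIV"
proof (rule norm_summable_imp_summable_on)
  have "(cmod (z ^ k))\<^sup>2 = ((cmod z)\<^sup>2) ^ k" for k
    by (simp add: norm_power power_mult[symmetric] mult.commute)
  moreover have "(cmod z)\<^sup>2 < 1" using assms by (simp add: abs_square_less_1)
  ultimately show "summable (\<lambda>k. norm ((cmod (z ^ k))\<^sup>2))"
    by (simp add: summable_geometric)
qed

interpretation H1: power_series_space D1 mono1
proof
  fix z assume "z \<in> D1"
  then show "(\<lambda>k. (cmod (mono1 k z))\<^sup>2) summable_on UNIV"
    using geometric_sq_summable[of z] by (simp add: D1_def mono1_def)
next
  fix a b z show "mono1 (a + b) z = mono1 a z * mono1 b z"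
    by (simp add: mono1_def power_add)
next
  fix x :: "nat ell2"
  assume x: "\<And>z. z \<in> D1 \<Longrightarrow> (\<Sum>\<^sub>\<infinity>k. coord x k * mono1 k z) = 0"
  have "(\<lambda>k. coord x k * z ^ k) sums 0" if z: "cmod z < 1" for z
  proof -
    have "(\<lambda>k. coord x k * z ^ k) summable_on UNIV"
      by (rule abs_summable_summable, rule abs_summable_product)
        (use coord_summable[of x] geometric_sq_summable[OF z] in \<open>simp_all add: power2_eq_square norm_mult\<close>)
    from has_sum_infsum[OF this] x[of z] z show ?thesis
      by (auto dest: has_sum_imp_sums simp: D1_def mono1_def)
  qed
  then have "coord x k = 0" for k by (rule powser_zero_coeffs)
  then show "x = 0" by (intro ell2_eqI) simp
qed

lemma H1_ev_sums: "cmod z < 1 \<Longrightarrow> (\<lambda>k. coord x k * z ^ k) sums H1.ev x z"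
proof -
  assume "cmod z < 1"
  then have "z \<in> D1" by (simp add: D1_def)
  from has_sum_imp_sums[OF H1.ev_has_sum[OF this, of x]] show ?thesis by (simp add: mono1_def)
qed

lemma H1_ev_holomorphic: "H1.ev x holomorphic_on ball 0 1"
  by (rule power_series_holomorphic[of 0 1 "coord x"]) (use H1_ev_sums in simp)

section \<open>Rows, columns and slices of elements over the bidisk\<close>

text \<open>In an index (j, k) the first entry is the exponent of z1. Row j is thus the coefficient
  of z1^j as a series in z2, and column k the coefficient of z2^k as a series in z1.\<close>

definition row :: "nat \<Rightarrow> (nat \<times> nat) ell2 \<Rightarrow> nat ell2" where
  "row j = pull (\<lambda>k. (j, k))"

definition col :: "nat \<Rightarrow> (nat \<times> nat) ell2 \<Rightarrow> nat ell2" where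
  "col k = pull (\<lambda>j. (j, k))"

lemma coord_row [simp]: "coord (row j F) k = coord F (j, k)"
  unfolding row_def by (rule coord_pull) (simp add: inj_def)

lemma coord_col [simp]: "coord (col k F) j = coord F (j, k)"
  unfolding col_def by (rule coord_pull) (simp add: inj_def)

lemma norm_col_le: "norm (col k F) \<le> norm F"
  unfolding col_def by (rule norm_pull_le) (simp add: inj_def)

lemma norm_cols_sums: "(\<lambda>k. (norm (col k F))\<^sup>2) sums (norm F)\<^sup>2"
proof -
  have F: "(\<lambda>(j, k). (cmod (coord F (j, k)))\<^sup>2) summable_on UNIV \<times> UNIV"
    using coord_summable[of F] by (simp add: case_prod_unfold)
  have "(\<lambda>(k, j). (cmod (coord F (j, k)))\<^sup>2) summable_on UNIV \<times> UNIV"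
    using F summable_on_reindex[of prod.swap "UNIV \<times> UNIV" "\<lambda>(k, j). (cmod (coord F (j, k)))\<^sup>2"]
    by (simp add: o_def case_prod_unfold product_swap)
  from summable_on_Sigma_banach[OF this] have s: "(\<lambda>k. (norm (col k F))\<^sup>2) summable_on UNIV"
    by (simp add: norm_ell2_square)
  have "(norm F)\<^sup>2 = (\<Sum>\<^sub>\<infinity>j. \<Sum>\<^sub>\<infinity>k. (cmod (coord F (j, k)))\<^sup>2)"
    unfolding norm_ell2_square infsum_Sigma'_banach[OF F] by (simp add: case_prod_unfold)
  also have "\<dots> = (\<Sum>\<^sub>\<infinity>k. (norm (col k F))\<^sup>2)"
    unfolding infsum_swap_banach[OF F] by (simp add: norm_ell2_square)
  finally show ?thesis using has_sum_imp_sums[OF has_sum_infsum[OF s]] by simp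
qed

text \<open>Freezing z2 = \<zeta>: an element over the bidisk becomes a power series in \<zeta> with
  coefficients in the one-variable space, convergent for |\<zeta>| < 1.\<close>

definition slice :: "(nat \<times> nat) ell2 \<Rightarrow> complex \<Rightarrow> nat ell2" where
  "slice F \<zeta> = (\<Sum>k. \<zeta> ^ k *\<^sub>C col k F)"

lemma slice_sums:
  assumes "cmod \<zeta> < 1"
  shows "(\<lambda>k. \<zeta> ^ k *\<^sub>C col k F) sums slice F \<zeta>"
  unfolding slice_def
proof (rule summable_sums, rule summable_comparison_test)
  have "norm (\<zeta> ^ k *\<^sub>C col k F) \<le> norm F * cmod \<zeta> ^ k" for k
    using mult_right_mono[OF norm_col_le[of k F], of "cmod \<zeta> ^ k"] by (simp add: norm_power mult.commute)
  then show "\<exists>N. \<forall>k\<ge>N. norm (\<zeta> ^ k *\<^sub>C col k F) \<le> norm F * cmod \<zeta> ^ k" by blast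
  show "summable (\<lambda>k. norm F * cmod \<zeta> ^ k)"
    using assms by (intro summable_mult summable_geometric) simp
qed

lemma coord_slice:
  assumes "cmod \<zeta> < 1"
  shows "coord (slice F \<zeta>) j = H1.ev (row j F) \<zeta>"
proof -
  have "(\<lambda>k. coord (\<zeta> ^ k *\<^sub>C col k F) j) sums coord (slice F \<zeta>) j"
    by (rule bounded_linear.sums[OF bounded_linear_coord slice_sums[OF assms]])
  moreover have "(\<lambda>k. coord (\<zeta> ^ k *\<^sub>C col k F) j) sums H1.ev (row j F) \<zeta>"
    using H1_ev_sums[OF assms, of "row j F"] by (simp add: mult.commute)
  ultimately show ?thesis by (rule sums_unique2)
qed

lemma mono2_pair: "mono2 (j, k) (z, \<zeta>) = z ^ j * \<zeta> ^ k"
  by (simp add: mono2_def)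

lemma mono2_sq_summable:
  assumes "cmod z < 1" "cmod \<zeta> < 1"
  shows "(\<lambda>k. (cmod (mono2 k (z, \<zeta>)))\<^sup>2) summable_on UNIV"
proof -
  have e: "norm ((cmod (z ^ j))\<^sup>2 * (cmod (\<zeta> ^ k))\<^sup>2) = (cmod (z ^ j))\<^sup>2 * (cmod (\<zeta> ^ k))\<^sup>2" for j k
    by simp
  have "(\<lambda>jk. norm ((cmod (z ^ fst jk))\<^sup>2 * (cmod (\<zeta> ^ snd jk))\<^sup>2)) summable_on UNIV \<times> UNIV"
  proof (rule Infinite_Sum.abs_summable_on_Sigma_iff[THEN iffD2], intro conjI ballI)
    show "(\<lambda>k. norm ((cmod (z ^ fst (j, k)))\<^sup>2 * (cmod (\<zeta> ^ snd (j, k)))\<^sup>2)) summable_on UNIV" for j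
      using summable_on_cmult_right[OF geometric_sq_summable[OF assms(2)], of "(cmod (z ^ j))\<^sup>2"] by simp
    have "(\<lambda>j. (cmod (z ^ j))\<^sup>2 * (\<Sum>\<^sub>\<infinity>k. (cmod (\<zeta> ^ k))\<^sup>2)) summable_on UNIV"
      by (rule summable_on_cmult_left[OF geometric_sq_summable[OF assms(1)]])
    then show "(\<lambda>j. norm (\<Sum>\<^sub>\<infinity>k. norm ((cmod (z ^ fst (j, k)))\<^sup>2 * (cmod (\<zeta> ^ snd (j, k)))\<^sup>2))) summable_on UNIV"
      by (simp add: infsum_cmult_right' abs_mult infsum_nonneg)
  qed
  from abs_summable_summable[OF this] show ?thesis
    by (simp add: mono2_def norm_mult power_mult_distrib)
qed

lemma summable_coord_mono2:
  assumes "cmod z < 1" "cmod \<zeta> < 1"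
  shows "(\<lambda>k. coord F k * mono2 k (z, \<zeta>)) summable_on UNIV"
  by (rule abs_summable_summable, rule abs_summable_product)
    (use coord_summable[of F] mono2_sq_summable[OF assms] in \<open>simp_all add: power2_eq_square norm_mult\<close>)

lemma slice_eq_infsum:
  assumes "cmod z < 1" "cmod \<zeta> < 1"
  shows "H1.ev (slice F \<zeta>) z = (\<Sum>\<^sub>\<infinity>k. coord F k * mono2 k (z, \<zeta>))"
proof -
  have row: "H1.ev (row j F) \<zeta> = (\<Sum>\<^sub>\<infinity>k. coord F (j, k) * \<zeta> ^ k)" for j
    using infsumI[OF H1.ev_has_sum[of \<zeta> "row j F"]] assms by (simp add: D1_def mono1_def)
  have s: "(\<lambda>(j, k). coord F (j, k) * mono2 (j, k) (z, \<zeta>)) summable_on UNIV \<times> UNIV"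
    using summable_coord_mono2[OF assms, of F] by (simp add: case_prod_unfold)
  have "H1.ev (slice F \<zeta>) z = (\<Sum>\<^sub>\<infinity>j. coord (slice F \<zeta>) j * z ^ j)"
    using infsumI[OF H1.ev_has_sum[of z "slice F \<zeta>"]] assms by (simp add: D1_def mono1_def)
  also have "\<dots> = (\<Sum>\<^sub>\<infinity>j. \<Sum>\<^sub>\<infinity>k. coord F (j, k) * mono2 (j, k) (z, \<zeta>))"
    unfolding coord_slice[OF assms(2)] row mono2_pair infsum_cmult_left'[symmetric]
    by (simp add: mult_ac)
  also have "\<dots> = (\<Sum>\<^sub>\<infinity>k. coord F k * mono2 k (z, \<zeta>))"
    unfolding infsum_Sigma'_banach[OF s] by (simp add: case_prod_unfold)
  finally show ?thesis .
qed

lemma slice_eq_0_imp: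
  assumes "\<And>\<zeta>. cmod \<zeta> < 1 \<Longrightarrow> slice F \<zeta> = 0"
  shows "F = 0"
proof (rule ell2_eqI)
  fix jk :: "nat \<times> nat"
  obtain j k where jk: "jk = (j, k)" by fastforce
  have "(\<lambda>k. coord (row j F) k * \<zeta> ^ k) sums 0" if "cmod \<zeta> < 1" for \<zeta>
    using H1_ev_sums[OF that, of "row j F"] coord_slice[OF that, of F j] assms[OF that] by simp
  then have "coord (row j F) k = 0" by (rule powser_zero_coeffs)
  then show "coord F jk = coord 0 jk" by (simp add: jk)
qed

interpretation H2: power_series_space D2 mono2
proof
  fix z assume "z \<in> D2"
  then show "(\<lambda>k. (cmod (mono2 k z))\<^sup>2) summable_on UNIV"
    using mono2_sq_summable[of "fst z" "snd z"] by (auto simp: D2_def)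
next
  fix a b z show "mono2 (a + b) z = mono2 a z * mono2 b z"
    by (simp add: mono2_def power_add)
next
  fix F :: "(nat \<times> nat) ell2"
  assume F: "\<And>z. z \<in> D2 \<Longrightarrow> (\<Sum>\<^sub>\<infinity>k. coord F k * mono2 k z) = 0"
  show "F = 0"
  proof (rule slice_eq_0_imp)
    fix \<zeta> :: complex assume "cmod \<zeta> < 1"
    then show "slice F \<zeta> = 0"
      using F by (intro H1.ev_eqI) (auto simp: D1_def D2_def slice_eq_infsum)
  qed
qed

lemma ev_slice:
  assumes "cmod z < 1" "cmod \<zeta> < 1"
  shows "H1.ev (slice F \<zeta>) z = H2.ev F (z, \<zeta>)"
  using infsumI[OF H2.ev_has_sum[of "(z, \<zeta>)" F]] assms by (simp add: D2_def slice_eq_infsum)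

lemma circle_avg_norm_scalar:
  assumes W: "continuous_on (cball 0 1) W" and "\<And>z. cmod z < 1 \<Longrightarrow> W z = H1.ev x z"
  shows "(\<lambda>K. circle_avg K (\<lambda>w. (cmod (W w))\<^sup>2)) \<longlonglongrightarrow> (norm x)\<^sup>2"
proof -
  have s: "(\<lambda>k. z ^ k *\<^sub>C coord x k) sums W z" if "cmod z < 1" for z
    using H1_ev_sums[OF that, of x] assms(2)[OF that] by (simp add: mult.commute)
  have "(\<Sum>k. (cmod (coord x k))\<^sup>2) = (norm x)\<^sup>2"
    using has_sum_imp_sums[OF norm_ell2_has_sum[of x]] by (simp add: sums_iff)
  then show ?thesis
    using circle_avg_parseval_continuous(2)[of W "coord x", OF W s] by simp
qed

text \<open>The columns of F are the Taylor coefficients of G, so this is Parseval for a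
  vector-valued function, followed by summing the squared column norms.\<close>

lemma circle_avg_norm_slices:
  assumes G: "continuous_on (cball 0 1) G"
    and ev: "\<And>z \<zeta>. cmod z < 1 \<Longrightarrow> cmod \<zeta> < 1 \<Longrightarrow> H1.ev (G \<zeta>) z = H2.ev F (z, \<zeta>)"
  shows "(\<lambda>K. circle_avg K (\<lambda>w. (norm (G w))\<^sup>2)) \<longlonglongrightarrow> (norm F)\<^sup>2"
proof -
  have "(\<lambda>k. \<zeta> ^ k *\<^sub>C col k F) sums G \<zeta>" if "cmod \<zeta> < 1" for \<zeta>
  proof -
    have "slice F \<zeta> = G \<zeta>"
      by (rule H1.ev_eqI) (use that ev in \<open>auto simp: D1_def ev_slice\<close>)
    then show ?thesis using slice_sums[OF that, of F] by simp
  qed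
  from circle_avg_parseval_continuous(2)[OF G this] show ?thesis
    using norm_cols_sums[of F] by (simp add: sums_iff)
qed

lemma circle_avg_cinner_slices:
  assumes G: "continuous_on (cball 0 1) G" "continuous_on (cball 0 1) G'"
    and ev: "\<And>z \<zeta>. cmod z < 1 \<Longrightarrow> cmod \<zeta> < 1 \<Longrightarrow> H1.ev (G \<zeta>) z = H2.ev F (z, \<zeta>)"
      "\<And>z \<zeta>. cmod z < 1 \<Longrightarrow> cmod \<zeta> < 1 \<Longrightarrow> H1.ev (G' \<zeta>) z = H2.ev F' (z, \<zeta>)"
  shows "(\<lambda>K. circle_avg K (\<lambda>w. cinner (G w) (G' w))) \<longlonglongrightarrow> cinner F F'"
proof -
  have n: "(\<lambda>K. complex_of_real (circle_avg K (\<lambda>w. (norm (G w + c *\<^sub>C G' w))\<^sup>2)))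
      \<longlonglongrightarrow> complex_of_real ((norm (F + c *\<^sub>C F'))\<^sup>2)" for c
    by (intro tendsto_of_real circle_avg_norm_slices continuous_intros G) (simp add: ev)
  have m: "x - c *\<^sub>C y = x + (- c) *\<^sub>C y" for x y :: "'z::complex_hilbert" and c
    by (simp add: scaleC_minus_left)
  have p: "cinner x y = (1/4) * complex_of_real ((norm (x + 1 *\<^sub>C y))\<^sup>2) - (1/4) * complex_of_real ((norm (x + (-1) *\<^sub>C y))\<^sup>2)
     + (\<i>/4) * complex_of_real ((norm (x + \<i> *\<^sub>C y))\<^sup>2) - (\<i>/4) * complex_of_real ((norm (x + (-\<i>) *\<^sub>C y))\<^sup>2)"
    for x y :: "'z::complex_hilbert"
    unfolding cinner_polarization[of x y] by (simp add: scaleC_minus_left field_simps)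
  show ?thesis
    unfolding p circle_avg_add circle_avg_diff circle_avg_cmult circle_avg_of_real
    by (intro tendsto_add tendsto_diff tendsto_mult_left n)
qed

section \<open>Elements constructed from pointwise bounds\<close>

lemma radial_sum_le:
  fixes a :: "'i \<Rightarrow> real"
  assumes "\<And>\<rho>. 0 \<le> \<rho> \<Longrightarrow> \<rho> < 1 \<Longrightarrow> (\<Sum>i\<in>I. \<rho> ^ e i * a i) \<le> B"
  shows "(\<Sum>i\<in>I. a i) \<le> B"
proof (rule tendsto_upperbound)
  have "((\<lambda>\<rho>. \<Sum>i\<in>I. \<rho> ^ e i * a i) \<longlongrightarrow> (\<Sum>i\<in>I. 1 ^ e i * a i)) (at_left (1::real))"
    by (intro tendsto_intros)
  then show "((\<lambda>\<rho>. \<Sum>i\<in>I. \<rho> ^ e i * a i) \<longlongrightarrow> (\<Sum>i\<in>I. a i)) (at_left (1::real))"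
    by simp
  have "eventually (\<lambda>\<rho>. \<rho> \<in> {0<..<1}) (at_left (1::real))"
    by (rule eventually_at_left_real) simp
  then show "\<forall>\<^sub>F \<rho> in at_left 1. (\<Sum>i\<in>I. \<rho> ^ e i * a i) \<le> B"
    by eventually_elim (use assms in auto)
qed simp

lemma taylor_coefficients:
  assumes "h holomorphic_on ball 0 1"
  obtains c :: "nat \<Rightarrow> complex" where "\<And>z. cmod z < 1 \<Longrightarrow> (\<lambda>k. c k * z ^ k) sums h z"
proof
  show "(\<lambda>k. (deriv ^^ k) h 0 / fact k * z ^ k) sums h z" if "cmod z < 1" for z
    using holomorphic_power_series[OF assms, of z] that by simp
qed

lemma sum_le_of_lessThan_le:
  fixes a :: "nat \<Rightarrow> real"
  assumes "\<And>N. (\<Sum>k<N. a k) \<le> B" "\<And>k. a k \<ge> 0" "finite F"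
  shows "(\<Sum>k\<in>F. a k) \<le> B"
proof -
  obtain N where "F \<subseteq> {..<N}" using \<open>finite F\<close> unfolding finite_nat_iff_bounded by auto
  then have "(\<Sum>k\<in>F. a k) \<le> (\<Sum>k<N. a k)" by (intro sum_mono2) (use assms in auto)
  with assms(1)[of N] show ?thesis by linarith
qed

text \<open>Pointwise domination passes to the means over circles of radius \<rho> < 1, hence by
  Parseval to weighted sums of squared coefficients, and with \<rho> tending to 1 to the norms.
  Every division by p rests on this comparison.\<close>

lemma H1_majorized:
  assumes h: "h holomorphic_on ball 0 1" and C: "C \<ge> 0"
    and le: "\<And>z. cmod z < 1 \<Longrightarrow> cmod (h z) \<le> C * cmod (H1.ev u z)"
  obtains v where "\<And>z. cmod z < 1 \<Longrightarrow> H1.ev v z = h z" "norm v \<le> C * norm u"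
proof -
  obtain c where c: "\<And>z. cmod z < 1 \<Longrightarrow> (\<lambda>k. c k * z ^ k) sums h z"
    using taylor_coefficients[OF h] by blast
  have c': "(\<lambda>k. z ^ k *\<^sub>C c k) sums h z" if "cmod z < 1" for z
    using c[OF that] by (simp add: mult.commute)
  have u': "(\<lambda>k. z ^ k *\<^sub>C coord u k) sums H1.ev u z" if "cmod z < 1" for z
    using H1_ev_sums[OF that, of u] by (simp add: mult.commute)
  have u2: "(\<lambda>k. (cmod (coord u k))\<^sup>2) sums (norm u)\<^sup>2"
    by (rule has_sum_imp_sums[OF norm_ell2_has_sum])
  have part: "(\<Sum>k<N. (cmod (c k))\<^sup>2) \<le> (C * norm u)\<^sup>2" for N
  proof (rule radial_sum_le[where e = "\<lambda>k. 2 * k"])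
    fix \<rho> :: real assume r: "0 \<le> \<rho>" "\<rho> < 1"
    have s1: "summable (\<lambda>k. \<rho> ^ (2 * k) * (cmod (c k))\<^sup>2)"
      "(\<lambda>K. circle_avg K (\<lambda>w. (cmod (h (complex_of_real \<rho> * w)))\<^sup>2)) \<longlonglongrightarrow> (\<Sum>k. \<rho> ^ (2 * k) * (cmod (c k))\<^sup>2)"
      by (rule circle_avg_parseval_dilated; use c' r in blast)+
    have s2: "summable (\<lambda>k. \<rho> ^ (2 * k) * (cmod (coord u k))\<^sup>2)"
      "(\<lambda>K. circle_avg K (\<lambda>w. (cmod (H1.ev u (complex_of_real \<rho> * w)))\<^sup>2)) \<longlonglongrightarrow> (\<Sum>k. \<rho> ^ (2 * k) * (cmod (coord u k))\<^sup>2)"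
      by (rule circle_avg_parseval_dilated; use u' r in blast)+
    have "(\<Sum>k<N. \<rho> ^ (2 * k) * (cmod (c k))\<^sup>2) \<le> (\<Sum>k. \<rho> ^ (2 * k) * (cmod (c k))\<^sup>2)"
      by (rule sum_le_suminf[OF s1(1)]) (use r in auto)
    also have "\<dots> \<le> C\<^sup>2 * (\<Sum>k. \<rho> ^ (2 * k) * (cmod (coord u k))\<^sup>2)"
    proof (rule LIMSEQ_le[OF s1(2) tendsto_mult_left[OF s2(2)]], intro exI allI impI)
      fix K
      show "circle_avg K (\<lambda>w. (cmod (h (complex_of_real \<rho> * w)))\<^sup>2)
          \<le> C\<^sup>2 * circle_avg K (\<lambda>w. (cmod (H1.ev u (complex_of_real \<rho> * w)))\<^sup>2)"
        unfolding circle_avg_cmult[symmetric] power_mult_distrib[symmetric]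
        by (intro circle_avg_mono power_mono le) (use r in \<open>auto simp: norm_mult\<close>)
    qed
    also have "\<dots> \<le> C\<^sup>2 * (norm u)\<^sup>2"
    proof (intro mult_left_mono)
      have "(\<Sum>k. \<rho> ^ (2 * k) * (cmod (coord u k))\<^sup>2) \<le> (\<Sum>k. (cmod (coord u k))\<^sup>2)"
        using r by (intro suminf_le s2(1) sums_summable[OF u2]) (auto simp: mult_left_le_one_le power_le_one)
      then show "(\<Sum>k. \<rho> ^ (2 * k) * (cmod (coord u k))\<^sup>2) \<le> (norm u)\<^sup>2"
        using sums_unique[OF u2] by simp
    qed simp
    finally show "(\<Sum>k<N. \<rho> ^ (2 * k) * (cmod (c k))\<^sup>2) \<le> (C * norm u)\<^sup>2"
      by (simp add: power_mult_distrib)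
  qed
  obtain v where v: "\<And>k. coord v k = c k" "norm v \<le> C * norm u"
    by (rule ell2_exists[of c "C * norm u"]) (use part C in \<open>auto intro: sum_le_of_lessThan_le\<close>)
  have "H1.ev v z = h z" if "cmod z < 1" for z
    using H1_ev_sums[OF that, of v] c[OF that] unfolding v by (rule sums_unique2)
  with v that show thesis by blast
qed

lemma H1_bounded:
  assumes h: "h holomorphic_on ball 0 1" and C: "C \<ge> 0"
    and le: "\<And>z. cmod z < 1 \<Longrightarrow> cmod (h z) \<le> C"
  obtains v where "\<And>z. cmod z < 1 \<Longrightarrow> H1.ev v z = h z" "norm v \<le> C"
\<comment> \<open>The element \<open>basis 0\<close> is the constant 1, so a bounded function is a
  majorized one.\<close>
proof (rule H1_majorized[OF h C, of "basis 0"])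
  have e: "H1.ev (basis 0) z = 1" if "cmod z < 1" for z
    using that H1.ev_basis[of z 0] by (simp add: D1_def mono1_def)
  show "cmod (h z) \<le> C * cmod (H1.ev (basis 0) z)" if "cmod z < 1" for z
    using le that e by simp
qed (use that in auto)

text \<open>Holomorphy is asked of the scalar coordinates, which have Taylor series; the norm bound
  on each slice then makes the double family of Taylor coefficients square-summable.\<close>

lemma slice_majorized:
  assumes hol: "\<And>j. (\<lambda>\<zeta>. coord (X \<zeta>) j) holomorphic_on ball 0 1" and C: "C \<ge> 0"
    and le: "\<And>\<zeta>. cmod \<zeta> < 1 \<Longrightarrow> norm (X \<zeta>) \<le> C * norm (slice U \<zeta>)"
  obtains F where "\<And>\<zeta>. cmod \<zeta> < 1 \<Longrightarrow> slice F \<zeta> = X \<zeta>" "norm F \<le> C * norm U"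
proof -
  have "\<exists>c. \<forall>z. cmod z < 1 \<longrightarrow> (\<lambda>k. c k * z ^ k) sums coord (X z) j" for j
    using taylor_coefficients[OF hol[of j]] by metis
  then obtain c where c: "\<And>j z. cmod z < 1 \<Longrightarrow> (\<lambda>k. c j k * z ^ k) sums coord (X z) j"
    by metis
  have c': "(\<lambda>k. z ^ k *\<^sub>C c j k) sums coord (X z) j" if "cmod z < 1" for z j
    using c[OF that, of j] by (simp add: mult.commute)
  have u2: "(\<lambda>k. (norm (col k U))\<^sup>2) sums (norm U)\<^sup>2" by (rule norm_cols_sums)
  \<comment> \<open>Finite rectangles turn the left side into finitely many scalar means, bounded
    together by one vector norm. Only z2 is dilated, hence the exponent
    \<open>2 * snd jk\<close>.\<close>
  have part: "(\<Sum>jk\<in>{..<J}\<times>{..<N}. (cmod (c (fst jk) (snd jk)))\<^sup>2) \<le> (C * norm U)\<^sup>2" for J N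
  proof (rule radial_sum_le[where e = "\<lambda>jk. 2 * snd jk"])
    fix \<rho> :: real assume r: "0 \<le> \<rho>" "\<rho> < 1"
    have s1: "summable (\<lambda>k. \<rho> ^ (2 * k) * (cmod (c j k))\<^sup>2)"
      "(\<lambda>K. circle_avg K (\<lambda>w. (cmod (coord (X (complex_of_real \<rho> * w)) j))\<^sup>2)) \<longlonglongrightarrow> (\<Sum>k. \<rho> ^ (2 * k) * (cmod (c j k))\<^sup>2)" for j
      by (rule circle_avg_parseval_dilated; use c' r in blast)+
    have s2: "summable (\<lambda>k. \<rho> ^ (2 * k) * (norm (col k U))\<^sup>2)"
      "(\<lambda>K. circle_avg K (\<lambda>w. (norm (slice U (complex_of_real \<rho> * w)))\<^sup>2)) \<longlonglongrightarrow> (\<Sum>k. \<rho> ^ (2 * k) * (norm (col k U))\<^sup>2)"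
      by (rule circle_avg_parseval_dilated; use slice_sums r in blast)+
    have L: "(\<lambda>K. \<Sum>j<J. circle_avg K (\<lambda>w. (cmod (coord (X (complex_of_real \<rho> * w)) j))\<^sup>2))
        \<longlonglongrightarrow> (\<Sum>j<J. \<Sum>k. \<rho> ^ (2 * k) * (cmod (c j k))\<^sup>2)"
      by (intro tendsto_sum s1(2))
    have "(\<Sum>jk\<in>{..<J}\<times>{..<N}. \<rho> ^ (2 * snd jk) * (cmod (c (fst jk) (snd jk)))\<^sup>2)
        = (\<Sum>j<J. \<Sum>k<N. \<rho> ^ (2 * k) * (cmod (c j k))\<^sup>2)"
      by (simp add: sum.cartesian_product case_prod_unfold)
    also have "\<dots> \<le> (\<Sum>j<J. \<Sum>k. \<rho> ^ (2 * k) * (cmod (c j k))\<^sup>2)"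
      by (intro sum_mono sum_le_suminf s1(1)) (use r in auto)
    also have "\<dots> \<le> C\<^sup>2 * (\<Sum>k. \<rho> ^ (2 * k) * (norm (col k U))\<^sup>2)"
    proof (rule LIMSEQ_le[OF L tendsto_mult_left[OF s2(2)]], intro exI allI impI)
      fix K
      show "(\<Sum>j<J. circle_avg K (\<lambda>w. (cmod (coord (X (complex_of_real \<rho> * w)) j))\<^sup>2))
          \<le> C\<^sup>2 * circle_avg K (\<lambda>w. (norm (slice U (complex_of_real \<rho> * w)))\<^sup>2)"
        unfolding circle_avg_cmult[symmetric] circle_avg_sum[symmetric]
      proof (rule circle_avg_mono)
        fix w :: complex assume "cmod w = 1"
        then have lt: "cmod (complex_of_real \<rho> * w) < 1" using r by (simp add: norm_mult)
        have "(\<Sum>j<J. (cmod (coord (X (complex_of_real \<rho> * w)) j))\<^sup>2) \<le> (norm (X (complex_of_real \<rho> * w)))\<^sup>2"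
          by (rule sum_coord_le) simp
        also have "\<dots> \<le> (C * norm (slice U (complex_of_real \<rho> * w)))\<^sup>2"
          by (intro power_mono le lt) simp
        finally show "(\<Sum>j<J. (cmod (coord (X (complex_of_real \<rho> * w)) j))\<^sup>2)
            \<le> C\<^sup>2 * (norm (slice U (complex_of_real \<rho> * w)))\<^sup>2" by (simp add: power_mult_distrib)
      qed
    qed
    also have "\<dots> \<le> C\<^sup>2 * (norm U)\<^sup>2"
    proof (intro mult_left_mono)
      have "(\<Sum>k. \<rho> ^ (2 * k) * (norm (col k U))\<^sup>2) \<le> (\<Sum>k. (norm (col k U))\<^sup>2)"
        using r by (intro suminf_le s2(1) sums_summable[OF u2]) (auto simp: mult_left_le_one_le power_le_one)
      then show "(\<Sum>k. \<rho> ^ (2 * k) * (norm (col k U))\<^sup>2) \<le> (norm U)\<^sup>2"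
        using sums_unique[OF u2] by simp
    qed simp
    finally show "(\<Sum>jk\<in>{..<J}\<times>{..<N}. \<rho> ^ (2 * snd jk) * (cmod (c (fst jk) (snd jk)))\<^sup>2) \<le> (C * norm U)\<^sup>2"
      by (simp add: power_mult_distrib)
  qed
  have fin: "(\<Sum>jk\<in>S. (cmod (c (fst jk) (snd jk)))\<^sup>2) \<le> (C * norm U)\<^sup>2" if "finite S" for S
  proof -
    obtain J where J: "fst ` S \<subseteq> {..<J}" using finite_imageI[OF \<open>finite S\<close>, of fst] unfolding finite_nat_iff_bounded by auto
    obtain N where N: "snd ` S \<subseteq> {..<N}" using finite_imageI[OF \<open>finite S\<close>, of snd] unfolding finite_nat_iff_bounded by auto
    have "S \<subseteq> {..<J} \<times> {..<N}"
      using J N by (force simp: image_subset_iff)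
    then have "(\<Sum>jk\<in>S. (cmod (c (fst jk) (snd jk)))\<^sup>2) \<le> (\<Sum>jk\<in>{..<J}\<times>{..<N}. (cmod (c (fst jk) (snd jk)))\<^sup>2)"
      by (intro sum_mono2) auto
    with part[of J N] show ?thesis by linarith
  qed
  obtain F where F: "\<And>jk. coord F jk = c (fst jk) (snd jk)" "norm F \<le> C * norm U"
    by (rule ell2_exists[of "\<lambda>jk. c (fst jk) (snd jk)" "C * norm U"]) (use fin C in auto)
  have "slice F \<zeta> = X \<zeta>" if \<zeta>: "cmod \<zeta> < 1" for \<zeta>
  proof (rule ell2_eqI)
    fix j
    have "(\<lambda>k. c j k * \<zeta> ^ k) sums H1.ev (row j F) \<zeta>"
      using H1_ev_sums[OF \<zeta>, of "row j F"] by (simp add: F)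
    then show "coord (slice F \<zeta>) j = coord (X \<zeta>) j"
      using c[OF \<zeta>, of j] coord_slice[OF \<zeta>, of F j] sums_unique2 by metis
  qed
  with F that show thesis by blast
qed

text \<open>A bounded function has Hardy norm at most its supremum, so uniform continuity on the
  closed bidisk yields norm continuity of the slices, also at boundary points.\<close>

lemma continuous_slices:
  assumes W: "continuous_on (cball 0 1 \<times> cball 0 1) (\<lambda>z\<zeta>. W (fst z\<zeta>) (snd z\<zeta>))"
    and hol: "\<And>\<zeta>. cmod \<zeta> \<le> 1 \<Longrightarrow> (\<lambda>z. W z \<zeta>) holomorphic_on ball 0 1"
  obtains G where "continuous_on (cball 0 1) G"
    "\<And>z \<zeta>. cmod z < 1 \<Longrightarrow> cmod \<zeta> \<le> 1 \<Longrightarrow> H1.ev (G \<zeta>) z = W z \<zeta>"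
proof -
  have cpt: "compact (cball (0::complex) 1 \<times> cball (0::complex) 1)" by (intro compact_Times) auto
  have "bounded ((\<lambda>z\<zeta>. W (fst z\<zeta>) (snd z\<zeta>)) ` (cball 0 1 \<times> cball 0 1))"
    by (intro compact_imp_bounded compact_continuous_image W cpt)
  then obtain M where "\<forall>x\<in>cball 0 1 \<times> cball 0 1. cmod (W (fst x) (snd x)) \<le> M"
    unfolding bounded_iff by auto
  then have M: "cmod (W z \<zeta>) \<le> M" if "cmod z \<le> 1" "cmod \<zeta> \<le> 1" for z \<zeta> using that by force
  have M0: "M \<ge> 0" using order_trans[OF norm_ge_zero M[of 0 0]] by simp
  have "\<exists>v. \<forall>z. cmod z < 1 \<longrightarrow> H1.ev v z = W z \<zeta>" if "cmod \<zeta> \<le> 1" for \<zeta>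
    by (rule H1_bounded[OF hol[OF that] M0]) (use M that in \<open>auto simp: less_imp_le\<close>)
  then obtain G where G: "\<And>\<zeta> z. cmod \<zeta> \<le> 1 \<Longrightarrow> cmod z < 1 \<Longrightarrow> H1.ev (G \<zeta>) z = W z \<zeta>"
    by metis
  have "continuous_on (cball 0 1) G"
    unfolding continuous_on_iff
  proof (intro ballI allI impI)
    fix \<zeta> :: complex and e :: real assume \<zeta>: "\<zeta> \<in> cball 0 1" and e: "e > 0"
    have "uniformly_continuous_on (cball 0 1 \<times> cball 0 1) (\<lambda>z\<zeta>. W (fst z\<zeta>) (snd z\<zeta>))"
      by (rule compact_uniformly_continuous[OF W cpt])
    then obtain d where d: "d > 0" "\<forall>x\<in>cball 0 1 \<times> cball 0 1. \<forall>x'\<in>cball 0 1 \<times> cball 0 1.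
        dist x' x < d \<longrightarrow> dist (W (fst x') (snd x')) (W (fst x) (snd x)) < e / 2"
      unfolding uniformly_continuous_on_def using e half_gt_zero by blast
    show "\<exists>d>0. \<forall>\<zeta>'\<in>cball 0 1. dist \<zeta>' \<zeta> < d \<longrightarrow> dist (G \<zeta>') (G \<zeta>) < e"
    proof (intro exI[of _ d] conjI ballI impI d(1))
      fix \<zeta>' :: complex assume \<zeta>': "\<zeta>' \<in> cball 0 1" "dist \<zeta>' \<zeta> < d"
      have le: "cmod (W z \<zeta>' - W z \<zeta>) \<le> e / 2" if "cmod z < 1" for z
        using d(2)[rule_format, of "(z, \<zeta>)" "(z, \<zeta>')"] that \<zeta> \<zeta>' by (simp add: dist_Pair_Pair dist_norm)
      have "(\<lambda>z. W z \<zeta>' - W z \<zeta>) holomorphic_on ball 0 1"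
        using \<zeta> \<zeta>' by (intro holomorphic_intros hol) auto
      then obtain v where v: "\<And>z. cmod z < 1 \<Longrightarrow> H1.ev v z = W z \<zeta>' - W z \<zeta>" "norm v \<le> e / 2"
        by (rule H1_bounded[of _ "e/2"]) (use e le in auto)
      have "v = G \<zeta>' - G \<zeta>"
        by (rule H1.ev_eqI) (use v G \<zeta> \<zeta>' in \<open>auto simp: D1_def\<close>)
      then show "dist (G \<zeta>') (G \<zeta>) < e" using v(2) e by (simp add: dist_norm)
    qed
  qed
  with G that show thesis by blast
qed

section \<open>Polynomials in two variables\<close>

lemma bpoly_0 [simp]: "bpoly 0 z \<zeta> = 0"
  by (simp add: bpoly_def)

lemma bpoly_pCons [simp]: "bpoly (pCons c p) z \<zeta> = poly c \<zeta> + z * bpoly p z \<zeta>"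
  by (simp add: bpoly_def map_poly_pCons)

lemma bpoly_eq_poly_poly: "bpoly p z \<zeta> = poly (poly p [:z:]) \<zeta>"
  by (induction p) auto

lemma bpoly_add: "bpoly (p + q) z \<zeta> = bpoly p z \<zeta> + bpoly q z \<zeta>"
  and bpoly_mult: "bpoly (p * q) z \<zeta> = bpoly p z \<zeta> * bpoly q z \<zeta>"
  by (simp_all add: bpoly_eq_poly_poly)

lemma poly_eq_sum_atMost:
  fixes p :: "'a::comm_semiring_1 poly"
  assumes "degree p \<le> n"
  shows "poly p x = (\<Sum>i\<le>n. coeff p i * x ^ i)"
  unfolding poly_altdef using assms
  by (intro sum.mono_neutral_left) (auto simp: coeff_eq_0)

lemma bpoly_eq_sum1:
  assumes "deg1 p \<le> m"
  shows "bpoly p z \<zeta> = (\<Sum>i\<le>m. poly (coeff p i) \<zeta> * z ^ i)"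
proof -
  have "degree p \<le> m" using assms by (simp add: deg1_def)
  from poly_eq_sum_atMost[OF this] show ?thesis
    by (simp add: bpoly_eq_poly_poly poly_sum poly_power)
qed

lemma degree_coeff_le_deg2: "degree (coeff p i) \<le> deg2 p"
proof (cases "i \<le> degree p")
  case True
  then show ?thesis unfolding deg2_def by (intro Max_ge) auto
qed (simp add: coeff_eq_0)

lemma bpoly_eq_sum:
  assumes "deg1 p \<le> m" "deg2 p \<le> n"
  shows "bpoly p z \<zeta> = (\<Sum>i\<le>m. \<Sum>j\<le>n. coeff (coeff p i) j * z ^ i * \<zeta> ^ j)"
proof -
  have "poly (coeff p i) \<zeta> = (\<Sum>j\<le>n. coeff (coeff p i) j * \<zeta> ^ j)" for i
    using degree_coeff_le_deg2[of p i] assms by (intro poly_eq_sum_atMost) linarith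
  then show ?thesis
    unfolding bpoly_eq_sum1[OF assms(1)] by (simp add: sum_distrib_left sum_distrib_right mult_ac)
qed

section \<open>The reflected polynomial\<close>

lemma coeff_reflect2:
  "coeff (coeff (reflect2 m n p) i) j =
    (if i \<le> m \<and> j \<le> n then cnj (coeff (coeff p (m - i)) (n - j)) else 0)"
  by (auto simp: reflect2_def coeff_sum coeff_monom)

lemma deg1_reflect2: "deg1 (reflect2 m n p) \<le> m"
  unfolding deg1_def
proof (rule degree_le, intro allI impI)
  fix i assume "m < i"
  then show "coeff (reflect2 m n p) i = 0"
    by (intro poly_eqI) (simp add: coeff_reflect2)
qed

lemma deg2_reflect2: "deg2 (reflect2 m n p) \<le> n"
  unfolding deg2_def by (auto intro!: degree_le simp: coeff_reflect2)

lemma bpoly_reflect2_eq_sum: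
  "bpoly (reflect2 m n p) z \<zeta> = (\<Sum>i\<le>m. \<Sum>j\<le>n. cnj (coeff (coeff p (m - i)) (n - j)) * z ^ i * \<zeta> ^ j)"
  unfolding bpoly_eq_sum[OF deg1_reflect2 deg2_reflect2] coeff_reflect2 by (intro sum.cong) auto

lemma continuous_on_bpoly [continuous_intros]:
  assumes "continuous_on S f" "continuous_on S g"
  shows "continuous_on S (\<lambda>x. bpoly p (f x) (g x))"
proof (induction p)
  case (pCons c p)
  then show ?case by (simp, intro continuous_intros assms)
qed simp

lemma tendsto_bpoly:
  assumes "(f \<longlongrightarrow> a) F" "(g \<longlongrightarrow> b) F"
  shows "((\<lambda>x. bpoly p (f x) (g x)) \<longlongrightarrow> bpoly p a b) F"
proof (induction p)
  case (pCons c p)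
  then show ?case by (simp, intro tendsto_intros assms)
qed simp

lemma holomorphic_on_bpoly [holomorphic_intros]:
  assumes "f holomorphic_on S" "g holomorphic_on S"
  shows "(\<lambda>x. bpoly p (f x) (g x)) holomorphic_on S"
proof (induction p)
  case (pCons c p)
  have "(\<lambda>x. poly c (g x)) holomorphic_on S"
    by (induction c) (auto intro!: holomorphic_intros assms)
  then show ?case using pCons by (simp, intro holomorphic_intros assms)
qed simp

lemma max_modulus_cball:
  assumes "continuous_on (cball 0 r) f" "f holomorphic_on ball 0 r"
    and "\<And>z. cmod z = r \<Longrightarrow> cmod (f z) \<le> B" "cmod z \<le> r"
  shows "cmod (f z) \<le> B"
  by (rule maximum_modulus_frontier[of f "cball 0 r" B])
    (use assms in \<open>auto simp: sphere_def frontier_cball interior_cball\<close>)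

text \<open>On the torus conjugation inverts both variables, so z^m \<zeta>^n times the conjugate of
  p(\<rho> z, \<rho> \<zeta>) is again a polynomial. Its coefficient at (i, j) carries the dilation
  factor of the index (m - i, n - j), which explains the exponent of \<rho>.\<close>

lemma reflect2_dilated_torus:
  assumes deg: "deg1 p \<le> m" "deg2 p \<le> n" and that: "cmod z = 1" "cmod \<zeta> = 1"
  shows "cmod (\<Sum>i\<le>m. \<Sum>j\<le>n. cnj (coeff (coeff p (m - i)) (n - j)) * complex_of_real \<rho> ^ ((m - i) + (n - j)) * z ^ i * \<zeta> ^ j)
    = cmod (bpoly p (complex_of_real \<rho> * z) (complex_of_real \<rho> * \<zeta>))"
proof -
  define c where "c i j = coeff (coeff p i) j" for i j
  define f where "f = (\<Sum>i\<le>m. \<Sum>j\<le>n. cnj (c (m - i) (n - j)) * complex_of_real \<rho> ^ ((m - i) + (n - j)) * z ^ i * \<zeta> ^ j)"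
  define g where "g = bpoly p (complex_of_real \<rho> * z) (complex_of_real \<rho> * \<zeta>)"
  have inv: "w ^ i * cnj w ^ k = w ^ (i - k)" if "cmod w = 1" "k \<le> i" for w i k
  proof -
    have "w * cnj w = 1" using that by (simp add: complex_norm_square[symmetric])
    then have "w ^ k * cnj w ^ k = 1" by (simp flip: power_mult_distrib)
    moreover have "w ^ i = w ^ (i - k) * w ^ k" using that(2) by (simp flip: power_add)
    ultimately show ?thesis by (simp add: mult.assoc)
  qed
  have flip: "(\<Sum>i\<le>k. h (k - i)) = (\<Sum>i\<le>k. h i)" for h :: "nat \<Rightarrow> complex" and k
    by (rule sum.reindex_bij_witness[of _ "\<lambda>i. k - i" "\<lambda>i. k - i"]) auto
  have "z ^ m * \<zeta> ^ n * cnj g =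
      (\<Sum>i\<le>m. \<Sum>j\<le>n. cnj (c i j) * complex_of_real \<rho> ^ (i + j) * (z ^ m * cnj z ^ i) * (\<zeta> ^ n * cnj \<zeta> ^ j))"
    unfolding g_def bpoly_eq_sum[OF deg] c_def
    by (simp add: sum_distrib_left power_mult_distrib power_add mult_ac)
  also have "\<dots> = (\<Sum>i\<le>m. \<Sum>j\<le>n. cnj (c i j) * complex_of_real \<rho> ^ (i + j) * z ^ (m - i) * \<zeta> ^ (n - j))"
    by (intro sum.cong refl) (simp add: inv that)
  also have "\<dots> = (\<Sum>i\<le>m. \<Sum>j\<le>n. cnj (c (m - i) (n - j)) * complex_of_real \<rho> ^ ((m - i) + (n - j)) * z ^ i * \<zeta> ^ j)"
  proof -
    define T where "T i j = cnj (c i j) * complex_of_real \<rho> ^ (i + j) * z ^ (m - i) * \<zeta> ^ (n - j)" for i j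
    have "(\<Sum>i\<le>m. \<Sum>j\<le>n. T i j) = (\<Sum>i\<le>m. \<Sum>j\<le>n. T (m - i) (n - j))"
      using flip[of "\<lambda>i. \<Sum>j\<le>n. T i j" m] flip[of "T i" n for i] by simp
    then show ?thesis by (simp add: T_def)
  qed
  finally have "f = z ^ m * \<zeta> ^ n * cnj g" by (simp add: f_def)
  then have "cmod f = cmod g" using that by (simp add: norm_mult norm_power)
  then show ?thesis by (simp add: f_def g_def c_def)
qed


lemma bpoly_reflect2_torus:
  assumes deg: "deg1 p \<le> m" "deg2 p \<le> n" and "cmod z = 1" "cmod \<zeta> = 1"
  shows "cmod (bpoly (reflect2 m n p) z \<zeta>) = cmod (bpoly p z \<zeta>)"
  using reflect2_dilated_torus[OF assms, of 1] by (simp add: bpoly_reflect2_eq_sum)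

text \<open>On the torus the reflection has the modulus of the polynomial itself. Dilating makes
  the polynomial zero-free on the closed bidisk, where the maximum principle applies.\<close>

lemma reflect2_le:
  assumes deg: "deg1 p \<le> m" "deg2 p \<le> n"
    and nz: "\<And>z \<zeta>. cmod z < 1 \<Longrightarrow> cmod \<zeta> < 1 \<Longrightarrow> bpoly p z \<zeta> \<noteq> 0"
    and z: "cmod z < 1" "cmod \<zeta> < 1"
  shows "cmod (bpoly (reflect2 m n p) z \<zeta>) \<le> cmod (bpoly p z \<zeta>)"
proof -
  define c where "c i j = coeff (coeff p i) j" for i j
  define f where "f \<rho> z \<zeta> = (\<Sum>i\<le>m. \<Sum>j\<le>n. cnj (c (m - i) (n - j)) * complex_of_real \<rho> ^ ((m - i) + (n - j)) * z ^ i * \<zeta> ^ j)" for \<rho> z \<zeta>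
  define g where "g \<rho> z \<zeta> = bpoly p (complex_of_real \<rho> * z) (complex_of_real \<rho> * \<zeta>)" for \<rho> z \<zeta>
  have fg: "cmod (f \<rho> z \<zeta>) = cmod (g \<rho> z \<zeta>)" if "cmod z = 1" "cmod \<zeta> = 1" for \<rho> z \<zeta>
    using reflect2_dilated_torus[OF deg that, of \<rho>] by (simp add: f_def g_def c_def)
  have le: "cmod (f \<rho> z \<zeta>) \<le> cmod (g \<rho> z \<zeta>)" if r: "0 < \<rho>" "\<rho> < 1" and "cmod z \<le> 1" "cmod \<zeta> \<le> 1" for \<rho> z \<zeta>
  proof -
    have gnz: "g \<rho> z \<zeta> \<noteq> 0" if "cmod z \<le> 1" "cmod \<zeta> \<le> 1" for z \<zeta>
    proof -
      have "cmod (complex_of_real \<rho> * w) < 1" if "cmod w \<le> 1" for w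
      proof -
        have "\<rho> * cmod w \<le> \<rho> * 1" using r that by (intro mult_left_mono) auto
        then have "\<rho> * cmod w < 1" using r by linarith
        then show ?thesis using r by (simp add: norm_mult)
      qed
      then show ?thesis unfolding g_def using that by (intro nz)
    qed
    \<comment> \<open>One variable at a time: here z runs over the disk with \<zeta> on the circle,
      and the second application of the maximum principle starts from this bound.\<close>
    have step: "cmod (f \<rho> z \<zeta> / g \<rho> z \<zeta>) \<le> 1" if "cmod z \<le> 1" "cmod \<zeta> = 1" for z \<zeta>
    proof (rule max_modulus_cball[where f = "\<lambda>z. f \<rho> z \<zeta> / g \<rho> z \<zeta>" and r = 1])
      show "continuous_on (cball 0 1) (\<lambda>z. f \<rho> z \<zeta> / g \<rho> z \<zeta>)"
        unfolding f_def g_def using gnz that by (intro continuous_intros) (auto simp: g_def)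
      show "(\<lambda>z. f \<rho> z \<zeta> / g \<rho> z \<zeta>) holomorphic_on ball 0 1"
        unfolding f_def g_def using gnz that by (intro holomorphic_intros) (auto simp: g_def)
      show "cmod (f \<rho> w \<zeta> / g \<rho> w \<zeta>) \<le> 1" if "cmod w = 1" for w
        using fg[OF that \<open>cmod \<zeta> = 1\<close>, of \<rho>] by (simp add: norm_divide)
    qed (use that in auto)
    have "cmod (f \<rho> z \<zeta> / g \<rho> z \<zeta>) \<le> 1"
    proof (rule max_modulus_cball[where f = "\<lambda>\<zeta>. f \<rho> z \<zeta> / g \<rho> z \<zeta>" and r = 1])
      show "continuous_on (cball 0 1) (\<lambda>\<zeta>. f \<rho> z \<zeta> / g \<rho> z \<zeta>)"
        unfolding f_def g_def using gnz that by (intro continuous_intros) (auto simp: g_def)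
      show "(\<lambda>\<zeta>. f \<rho> z \<zeta> / g \<rho> z \<zeta>) holomorphic_on ball 0 1"
        unfolding f_def g_def using gnz that by (intro holomorphic_intros) (auto simp: g_def)
    qed (use that step in auto)
    then show ?thesis using gnz[OF that(3,4)] by (simp add: norm_divide)
  qed
  show ?thesis
  proof (rule tendsto_le[of "at_left (1::real)"])
    have "((\<lambda>\<rho>. f \<rho> z \<zeta>) \<longlongrightarrow> f 1 z \<zeta>) (at_left 1)"
      unfolding f_def by (intro tendsto_intros)
    moreover have "f 1 z \<zeta> = bpoly (reflect2 m n p) z \<zeta>"
      by (simp add: f_def c_def bpoly_reflect2_eq_sum)
    ultimately show "((\<lambda>\<rho>. cmod (f \<rho> z \<zeta>)) \<longlongrightarrow> cmod (bpoly (reflect2 m n p) z \<zeta>)) (at_left 1)"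
      using tendsto_norm by metis
    have "((\<lambda>\<rho>. g \<rho> z \<zeta>) \<longlongrightarrow> bpoly p (complex_of_real 1 * z) (complex_of_real 1 * \<zeta>)) (at_left 1)"
      unfolding g_def by (intro tendsto_bpoly tendsto_intros)
    then show "((\<lambda>\<rho>. cmod (g \<rho> z \<zeta>)) \<longlongrightarrow> cmod (bpoly p z \<zeta>)) (at_left 1)"
      using tendsto_norm by fastforce
    have "eventually (\<lambda>\<rho>. \<rho> \<in> {0<..<1}) (at_left (1::real))"
      by (rule eventually_at_left_real) simp
    then show "\<forall>\<^sub>F \<rho> in at_left 1. cmod (f \<rho> z \<zeta>) \<le> cmod (g \<rho> z \<zeta>)"
      by eventually_elim (use le z in auto)
  qed simp
qed

section \<open>Bezout identity and polynomial minorants\<close>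

text \<open>Polynomials in z1 over polynomials in z2 do not form a principal ideal domain. But the
  primitive part of an element of least z1-degree in the ideal of p and q divides both; coprimality
  makes it constant, so that element is a nonzero polynomial in z2 alone.\<close>

lemma coprime_bezout:
  fixes p q :: "complex poly poly"
  assumes cop: "coprime p q" and p: "p \<noteq> 0"
  obtains a b r where "r \<noteq> 0" "a * p + b * q = [:r:]"
proof -
  define I where "I = {f. f \<noteq> 0 \<and> (\<exists>a b. f = a * p + b * q)}"
  have "p = 1 * p + 0 * q" by simp
  then have "p \<in> I" unfolding I_def using p by blast
  then obtain g where g: "g \<in> I" "\<And>f. f \<in> I \<Longrightarrow> degree g \<le> degree f"
    using arg_min_natI[of "\<lambda>f. f \<in> I" p degree] arg_min_nat_le[of "\<lambda>f. f \<in> I" _ degree] by metis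
  obtain a b where ab: "g = a * p + b * q" using g(1) by (auto simp: I_def)
  have g0: "g \<noteq> 0" using g(1) by (simp add: I_def)
  define h where "h = primitive_part g"
  have gh: "g = smult (content g) h" by (simp add: h_def)
  have hdvd: "h dvd f" if f: "f = a' * p + b' * q" for f a' b'
  proof -
    \<comment> \<open>Pseudo-division stays inside the ideal, and minimality of the degree forces
      the remainder to vanish.\<close>
    obtain d s where ds: "d \<noteq> 0" "smult d f = g * s + pseudo_mod f g"
      using pseudo_mod(1)[OF g0] by blast
    have "pseudo_mod f g = (smult d a' - s * a) * p + (smult d b' - s * b) * q"
      using ds(2) by (simp add: f ab algebra_simps smult_add_right)
    then have "pseudo_mod f g = 0"
      using pseudo_mod(2)[OF g0, of f] g(2)[of "pseudo_mod f g"] unfolding I_def by fastforce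
    then have "smult d f = smult (content g) h * s" using ds(2) gh by simp
    then have "h dvd smult d f" by (simp add: dvd_def) (metis mult_smult_right)
    \<comment> \<open>Over the fraction field the factor d is invertible; Gauss's lemma for the
      primitive h brings divisibility back.\<close>
    then have "fract_poly h dvd smult (to_fract d) (fract_poly f)"
      by (metis dvdE dvdI fract_poly_mult fract_poly_smult)
    then have "fract_poly h dvd fract_poly f" using ds(1) by (auto dest: dvd_smult_cancel)
    moreover have "content h = 1" using g0 by (simp add: h_def)
    ultimately show "h dvd f" by (rule fract_poly_dvdD)
  qed
  have "h dvd p" "h dvd q" using hdvd[of p 1 0] hdvd[of q 0 1] by simp_all
  then have "is_unit h" using cop by (meson coprime_common_divisor)
  then obtain c where "h = [:c:]" by (auto simp: is_unit_poly_iff)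
  then have "g = [:content g * c:]" using gh by simp
  then have "a * p + b * q = [:content g * c:]" "content g * c \<noteq> 0" using ab g0 by (metis, metis pCons_0_0)
  then show thesis using that by blast
qed


lemma cball_Times_closure: "closure (ball (0::complex) 1 \<times> ball (0::complex) 1) = cball 0 1 \<times> cball 0 1"
  by (simp add: closure_Times)

lemma le_on_closed_bidisk:
  assumes "continuous_on (cball 0 1 \<times> cball 0 1) f" "continuous_on (cball 0 1 \<times> cball 0 1) g"
    and "\<And>z \<zeta>. cmod z < 1 \<Longrightarrow> cmod \<zeta> < 1 \<Longrightarrow> f (z, \<zeta>) \<le> (g (z, \<zeta>) :: real)"
    and "cmod z \<le> 1" "cmod \<zeta> \<le> 1"
  shows "f (z, \<zeta>) \<le> g (z, \<zeta>)"
proof -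
  have "0 \<le> g x - f x" if "x \<in> cball 0 1 \<times> cball 0 1" for x
  proof (rule continuous_ge_on_closure[of "ball 0 1 \<times> ball 0 1"])
    show "continuous_on (closure (ball 0 1 \<times> ball 0 1)) (\<lambda>x. g x - f x)"
      unfolding cball_Times_closure by (intro continuous_intros assms)
    show "x \<in> closure (ball 0 1 \<times> ball 0 1)" unfolding cball_Times_closure by (rule that)
  qed (use assms(3) in auto)
  from this[of "(z, \<zeta>)"] show ?thesis using assms by simp
qed

text \<open>A polynomial minorant in the second variable of least degree has no removable zeros.\<close>

lemma polynomial_minorant:
  assumes nz: "\<And>z \<zeta>. cmod z < 1 \<Longrightarrow> cmod \<zeta> < 1 \<Longrightarrow> bpoly p z \<zeta> \<noteq> 0"
    and ex: "r0 \<noteq> 0" "\<And>z \<zeta>. cmod z < 1 \<Longrightarrow> cmod \<zeta> < 1 \<Longrightarrow> cmod (poly r0 \<zeta>) \<le> C0 * cmod (bpoly p z \<zeta>)"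
  obtains r C where "r \<noteq> 0" "C \<ge> 0"
    "\<And>z \<zeta>. cmod z \<le> 1 \<Longrightarrow> cmod \<zeta> \<le> 1 \<Longrightarrow> cmod (poly r \<zeta>) \<le> C * cmod (bpoly p z \<zeta>)"
    "\<And>\<mu>. cmod \<mu> < 1 \<Longrightarrow> poly r \<mu> \<noteq> 0"
    "\<And>\<mu>. cmod \<mu> \<le> 1 \<Longrightarrow> (\<And>z. cmod z \<le> 1 \<Longrightarrow> bpoly p z \<mu> \<noteq> 0) \<Longrightarrow> poly r \<mu> \<noteq> 0"
proof -
  define maj where "maj r C \<longleftrightarrow> (\<forall>z \<zeta>. cmod z < 1 \<longrightarrow> cmod \<zeta> < 1 \<longrightarrow> cmod (poly r \<zeta>) \<le> C * cmod (bpoly p z \<zeta>))" for r C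
  have "\<exists>r. (r \<noteq> 0 \<and> (\<exists>C. maj r C)) \<and> (\<forall>r'. r' \<noteq> 0 \<and> (\<exists>C. maj r' C) \<longrightarrow> degree r \<le> degree r')"
    by (rule exI[of _ "arg_min degree (\<lambda>r. r \<noteq> 0 \<and> (\<exists>C. maj r C))"], rule arg_min_nat_lemma[of _ r0])
      (use ex in \<open>auto simp: maj_def\<close>)
  then obtain r C where r: "r \<noteq> 0" "maj r C" and rmin: "\<And>r' C'. r' \<noteq> 0 \<Longrightarrow> maj r' C' \<Longrightarrow> degree r \<le> degree r'"
    by blast
  have le: "cmod (poly r \<zeta>) \<le> C * cmod (bpoly p z \<zeta>)" if "cmod z < 1" "cmod \<zeta> < 1" for z \<zeta>
    using r(2) that by (simp add: maj_def)
  have C: "C \<ge> 0"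
    using order_trans[OF norm_ge_zero le[of 0 0]] nz[of 0 0] by (simp add: zero_le_mult_iff)
  have cle: "cmod (poly r \<zeta>) \<le> C * cmod (bpoly p z \<zeta>)" if "cmod z \<le> 1" "cmod \<zeta> \<le> 1" for z \<zeta>
    using le_on_closed_bidisk[of "\<lambda>x. cmod (poly r (snd x))" "\<lambda>x. C * cmod (bpoly p (fst x) (snd x))" z \<zeta>] le that
    by (force intro!: continuous_intros)
  \<comment> \<open>By minimality no linear factor of r can be cancelled while keeping some bound;
    both zero-freeness claims end in this contradiction.\<close>
  have fac: False if rr': "r = [:-\<mu>, 1:] * r'" and "maj r' C'" for \<mu> r' C'
  proof -
    have "r' \<noteq> 0" using r(1) rr' by auto
    then have "degree r = degree r' + 1" unfolding rr' by (subst degree_mult_eq) auto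
    with rmin[OF \<open>r' \<noteq> 0\<close> that(2)] show False by simp
  qed
  have div: "cmod (poly r' \<zeta>) \<le> C / d * cmod (bpoly p z \<zeta>)"
    if "r = [:-\<mu>, 1:] * r'" "0 < d" "d \<le> cmod (\<zeta> - \<mu>)" "cmod z < 1" "cmod \<zeta> < 1" for \<mu> r' d z \<zeta>
  proof -
    have "poly r \<zeta> = (\<zeta> - \<mu>) * poly r' \<zeta>" unfolding that(1) by (simp add: algebra_simps)
    then have "cmod (\<zeta> - \<mu>) * cmod (poly r' \<zeta>) \<le> C * cmod (bpoly p z \<zeta>)"
      using le[OF that(4,5)] by (simp add: norm_mult)
    moreover have "d * cmod (poly r' \<zeta>) \<le> cmod (\<zeta> - \<mu>) * cmod (poly r' \<zeta>)"
      by (intro mult_right_mono that) simp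
    ultimately show ?thesis using that(2) by (simp add: field_simps)
  qed
  have in_disk: "poly r \<mu> \<noteq> 0" if \<mu>: "cmod \<mu> < 1" for \<mu>
  proof
    assume "poly r \<mu> = 0"
    then obtain r' where r': "r = [:-\<mu>, 1:] * r'" by (auto simp: poly_eq_0_iff_dvd)
    \<comment> \<open>A circle between \<mu> and the boundary: outside it the cancelled factor is
      bounded below, and inside it the maximum principle for the quotient by p, which has no zeros
      there, transports the bound.\<close>
    define \<rho> where "\<rho> = (1 + cmod \<mu>) / 2"
    have \<rho>: "cmod \<mu> < \<rho>" "\<rho> < 1" "\<rho> > 0" using \<mu> by (auto simp: \<rho>_def field_simps add_pos_nonneg)
    have far: "cmod (poly r' \<zeta>) \<le> C / (\<rho> - cmod \<mu>) * cmod (bpoly p z \<zeta>)"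
      if "\<rho> \<le> cmod \<zeta>" "cmod \<zeta> < 1" "cmod z < 1" for z \<zeta>
      using that \<rho> norm_triangle_ineq2[of \<zeta> \<mu>] by (intro div[OF r']) auto
    have near: "cmod (poly r' \<zeta>) \<le> C / (\<rho> - cmod \<mu>) * cmod (bpoly p z \<zeta>)"
      if "cmod \<zeta> \<le> \<rho>" "cmod z < 1" for z \<zeta>
    proof -
      have "cmod (poly r' \<zeta> / bpoly p z \<zeta>) \<le> C / (\<rho> - cmod \<mu>)"
      proof (rule max_modulus_cball[where r = \<rho> and f = "\<lambda>\<zeta>. poly r' \<zeta> / bpoly p z \<zeta>"])
        show "continuous_on (cball 0 \<rho>) (\<lambda>\<zeta>. poly r' \<zeta> / bpoly p z \<zeta>)"
          using nz that \<rho> by (intro continuous_intros) auto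
        have "poly r' holomorphic_on ball 0 \<rho>" by (induction r') (auto intro!: holomorphic_intros)
        then show "(\<lambda>\<zeta>. poly r' \<zeta> / bpoly p z \<zeta>) holomorphic_on ball 0 \<rho>"
          using nz that \<rho> by (intro holomorphic_intros) auto
        show "cmod (poly r' w / bpoly p z w) \<le> C / (\<rho> - cmod \<mu>)" if "cmod w = \<rho>" for w
          using far[of w z] nz[of z w] that \<open>cmod z < 1\<close> \<rho> by (simp add: norm_divide divide_le_eq)
      qed (use that in auto)
      moreover have "bpoly p z \<zeta> \<noteq> 0" using nz that \<rho> by auto
      ultimately show ?thesis by (simp add: norm_divide divide_le_eq)
    qed
    have "maj r' (C / (\<rho> - cmod \<mu>))" unfolding maj_def using far near by (metis linear)
    with fac[OF r'] show False .
  qed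
  have off_zeros: "poly r \<mu> \<noteq> 0" if \<mu>: "cmod \<mu> \<le> 1" and p\<mu>: "\<And>z. cmod z \<le> 1 \<Longrightarrow> bpoly p z \<mu> \<noteq> 0" for \<mu>
  proof
    assume "poly r \<mu> = 0"
    then obtain r' where r': "r = [:-\<mu>, 1:] * r'" by (auto simp: poly_eq_0_iff_dvd)
    \<comment> \<open>The zero set of p over the closed bidisk projects to a compact set avoiding
      \<mu>, so \<mu> has a neighbourhood over which p has no zeros.\<close>
    define Z where "Z = {x \<in> cball 0 1 \<times> cball 0 1. bpoly p (fst x) (snd x) = 0}"
    have cb: "compact (cball (0::complex) 1 \<times> cball (0::complex) 1)" by (intro compact_Times) auto
    have "closed Z"
      unfolding Z_def by (intro continuous_closed_preimage_constant continuous_intros compact_imp_closed cb)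
    then have "compact Z" using compact_Int_closed[OF cb, of Z] by (simp add: Z_def Int_absorb1 Collect_mono_iff)
    then have "closed (snd ` Z)" by (intro compact_imp_closed compact_continuous_image continuous_intros)
    moreover have "\<mu> \<notin> snd ` Z" using p\<mu> by (auto simp: Z_def)
    ultimately obtain e where e: "e > 0" "\<forall>x\<in>snd ` Z. e \<le> dist \<mu> x"
      using separate_point_closed[of "snd ` Z" \<mu>] by blast
    define K where "K = cball (0::complex) 1 \<times> (cball 0 1 \<inter> cball \<mu> (e / 2))"
    have "compact K" unfolding K_def by (intro compact_Times compact_Int) auto
    moreover have "(0, \<mu>) \<in> K" using \<mu> e by (simp add: K_def)
    moreover have "continuous_on K (\<lambda>x. cmod (bpoly p (fst x) (snd x)))" by (intro continuous_intros)
    ultimately obtain x0 where x0: "x0 \<in> K" "\<And>x. x \<in> K \<Longrightarrow> cmod (bpoly p (fst x0) (snd x0)) \<le> cmod (bpoly p (fst x) (snd x))"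
      using continuous_attains_inf[of K "\<lambda>x. cmod (bpoly p (fst x) (snd x))"] by blast
    define c where "c = cmod (bpoly p (fst x0) (snd x0))"
    have c: "c > 0"
    proof (rule ccontr)
      assume "\<not> c > 0"
      then have "x0 \<in> Z" using x0(1) by (auto simp: c_def Z_def K_def)
      moreover have "dist \<mu> (snd x0) < e" using x0(1) e(1) by (auto simp: K_def)
      ultimately show False using e(2) by force
    qed
    have "bounded (poly r' ` cball 0 1)"
      by (intro compact_imp_bounded compact_continuous_image continuous_intros) simp
    then obtain M where "\<forall>x\<in>cball 0 1. cmod (poly r' x) \<le> M" by (auto simp: bounded_iff)
    then have M: "\<And>\<zeta>. cmod \<zeta> \<le> 1 \<Longrightarrow> cmod (poly r' \<zeta>) \<le> M" by simp
    have M0: "M \<ge> 0" using order_trans[OF norm_ge_zero M[of 0]] by simp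
    \<comment> \<open>Near \<mu> the bound comes from |p| \<ge> c, elsewhere from |\<zeta> - \<mu>|
      > e / 2; hence the maximum of two constants.\<close>
    have "maj r' (max (M / c) (C / (e / 2)))"
      unfolding maj_def
    proof (intro allI impI)
      fix z \<zeta> :: complex assume z: "cmod z < 1" "cmod \<zeta> < 1"
      show "cmod (poly r' \<zeta>) \<le> max (M / c) (C / (e / 2)) * cmod (bpoly p z \<zeta>)"
      proof (cases "dist \<mu> \<zeta> \<le> e / 2")
        case True
        then have "c \<le> cmod (bpoly p z \<zeta>)" using x0(2)[of "(z, \<zeta>)"] z by (simp add: c_def K_def)
        then have "M / c * c \<le> M / c * cmod (bpoly p z \<zeta>)" using M0 c by (intro mult_left_mono) auto
        moreover have "\<dots> \<le> max (M / c) (C / (e / 2)) * cmod (bpoly p z \<zeta>)"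
          by (intro mult_right_mono) auto
        ultimately show ?thesis using M[of \<zeta>] z c by simp
      next
        case False
        then have "cmod (poly r' \<zeta>) \<le> C / (e / 2) * cmod (bpoly p z \<zeta>)"
          using e z by (intro div[OF r']) (auto simp: dist_norm norm_minus_commute)
        also have "\<dots> \<le> max (M / c) (C / (e / 2)) * cmod (bpoly p z \<zeta>)"
          by (intro mult_right_mono) auto
        finally show ?thesis .
      qed
    qed
    with fac[OF r'] show False .
  qed
  show thesis using that[OF r(1) C cle in_disk off_zeros] .
qed

text \<open>The set E records zeros of a slice on the circle only. Zeros inside the disk are
  excluded by Hurwitz's theorem, as the slice is a uniform limit of slices p(., t n) with |t n| < 1,
  which have none.\<close>

lemma slice_zero_free:
  assumes nz: "\<And>z \<zeta>. cmod z < 1 \<Longrightarrow> cmod \<zeta> < 1 \<Longrightarrow> bpoly p z \<zeta> \<noteq> 0"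
    and \<tau>: "cmod \<tau> = 1" and bd: "\<And>z. cmod z = 1 \<Longrightarrow> bpoly p z \<tau> \<noteq> 0" and z: "cmod z \<le> 1"
  shows "bpoly p z \<tau> \<noteq> 0"
proof (cases "cmod z = 1")
  case False
  then have z1: "z \<in> ball 0 1" using z by simp
  define t where "t n = complex_of_real (1 - 1 / real (Suc (Suc n))) * \<tau>" for n
  have "1 / real (Suc (Suc n)) \<le> 1 \<and> 1 / real (Suc (Suc n)) > 0" for n by auto
  then have t1: "cmod (t n) < 1" for n using \<tau> by (simp add: t_def norm_mult abs_if del: of_real_diff)
  have "(\<lambda>n. 1 / real (Suc (Suc n))) \<longlonglongrightarrow> 0"
    using LIMSEQ_Suc[OF LIMSEQ_inverse_real_of_nat] by (simp add: inverse_eq_divide)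
  then have "t \<longlonglongrightarrow> complex_of_real (1 - 0) * \<tau>" unfolding t_def by (intro tendsto_intros)
  then have t: "t \<longlonglongrightarrow> \<tau>" by simp
  have uc: "uniformly_continuous_on (cball 0 1 \<times> cball 0 1) (\<lambda>x. bpoly p (fst x) (snd x))"
    by (intro compact_uniformly_continuous continuous_intros compact_Times) auto
  show ?thesis
  \<comment> \<open>Hurwitz's theorem does not cover a constant limit; in that case the value is the
    one at the boundary point 1, nonzero by assumption.\<close>
  proof (cases "(\<lambda>z. bpoly p z \<tau>) constant_on ball 0 1")
    case True
    then obtain c where c: "\<And>w. w \<in> ball 0 1 \<Longrightarrow> bpoly p w \<tau> = c" by (auto simp: constant_on_def)
    have "bpoly p 1 \<tau> = c"
      by (rule continuous_constant_on_closure[of "ball 0 1" "\<lambda>w. bpoly p w \<tau>"]) (auto intro!: continuous_intros c)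
    then show ?thesis using bd[of 1] c[OF z1] by simp
  next
    case False
    show ?thesis
    proof (rule Hurwitz_no_zeros[of "ball 0 1" "\<lambda>n w. bpoly p w (t n)" "\<lambda>w. bpoly p w \<tau>"])
      fix K :: "complex set" assume K: "K \<subseteq> ball 0 1"
      show "uniform_limit K (\<lambda>n w. bpoly p w (t n)) (\<lambda>w. bpoly p w \<tau>) sequentially"
      proof (rule uniform_limitI)
        fix e :: real assume "e > 0"
        with uc obtain d where d: "d > 0" "\<forall>x\<in>cball 0 1 \<times> cball 0 1. \<forall>x'\<in>cball 0 1 \<times> cball 0 1.
            dist x' x < d \<longrightarrow> dist (bpoly p (fst x') (snd x')) (bpoly p (fst x) (snd x)) < e"
          unfolding uniformly_continuous_on_def by blast
        have "eventually (\<lambda>n. dist (t n) \<tau> < d) sequentially" by (rule tendstoD[OF t d(1)])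
        then show "\<forall>\<^sub>F n in sequentially. \<forall>w\<in>K. dist (bpoly p w (t n)) (bpoly p w \<tau>) < e"
        proof eventually_elim
          case (elim n)
          show ?case
          proof
            fix w assume "w \<in> K"
            then show "dist (bpoly p w (t n)) (bpoly p w \<tau>) < e"
              using d(2)[rule_format, of "(w, \<tau>)" "(w, t n)"] elim K \<tau> t1[of n]
              by (force simp: dist_Pair_Pair)
          qed
        qed
      qed
    qed (use nz t1 z1 False in \<open>auto intro!: holomorphic_intros\<close>)
  qed
qed (use bd in auto)

section \<open>Polynomials acting on square-summable families\<close>

definition act :: "'k set \<Rightarrow> ('k \<Rightarrow> complex) \<Rightarrow> 'k::cancel_comm_monoid_add ell2 \<Rightarrow> 'k ell2" where
  "act I c x = (\<Sum>i\<in>I. c i *\<^sub>C shift i x)"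

lemma act_add: "act I c (x + y) = act I c x + act I c y"
  by (simp add: act_def shift_add scaleC_add_right sum.distrib)

lemma act_scaleC: "act I c (d *\<^sub>C x) = d *\<^sub>C act I c x"
  by (simp add: act_def shift_scaleC scaleC_sum_right mult.commute)

lemma act_shift: "act I c (shift a x) = shift a (act I c x)"
  by (simp add: act_def shift_sum shift_scaleC shift_shift add.commute)

lemma norm_act_le: "norm (act I c x) \<le> (\<Sum>i\<in>I. cmod (c i)) * norm x"
  unfolding act_def by (rule order_trans[OF norm_sum]) (simp add: sum_distrib_right)

lemma bounded_linear_act: "bounded_linear (act I c)"
proof (rule bounded_linear_intro[of _ "\<Sum>i\<in>I. cmod (c i)"])
  show "norm (act I c x) \<le> norm x * (\<Sum>i\<in>I. cmod (c i))" for x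
    using norm_act_le[of I c x] by (simp add: mult.commute)
qed (simp_all add: act_add act_scaleC flip: scaleC_of_real)

lemmas tendsto_act [tendsto_intros] = bounded_linear.tendsto[OF bounded_linear_act]

lemma (in power_series_space) ev_act:
  assumes "z \<in> A"
  shows "ev (act I c x) z = (\<Sum>i\<in>I. c i * mn i z) * ev x z"
  using assms by (simp add: act_def ev_sum ev_shift sum_distrib_right mult.assoc)

text \<open>The adjoint of the reflected polynomial is the polynomial itself followed by a backward
  shift by the reflection degree: this turns orthogonality into vanishing of coefficients.\<close>

lemma cinner_act_reflect:
  assumes refl: "\<And>a. a \<in> I \<Longrightarrow> \<iota> a \<in> I \<and> \<iota> (\<iota> a) = a \<and> a + \<iota> a = M"
  shows "cinner x (act I (\<lambda>a. u * cnj (c (\<iota> a))) v) = cnj u * cinner (bshift M (act I c x)) v"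
proof -
  have adj: "cinner x (shift a v) = cinner (bshift a x) v" for a
    using arg_cong[OF cinner_shift[of a v x], of cnj] by (simp add: cnj_cinner)
  have reindex: "(\<Sum>a\<in>I. h (\<iota> a)) = (\<Sum>a\<in>I. h a)" for h :: "'a \<Rightarrow> complex"
    by (rule sum.reindex_bij_witness[of _ \<iota> \<iota>]) (use refl in auto)
  have "bshift M (act I c x) = (\<Sum>a\<in>I. c (\<iota> a) *\<^sub>C bshift a x)"
  proof (rule ell2_eqI)
    fix l
    have "c (\<iota> a) * coord (shift (\<iota> a) x) (M + l) = c (\<iota> a) * coord x (a + l)" if "a \<in> I" for a
    proof -
      have "M + l = \<iota> a + (a + l)" using refl[OF that] by (metis add.assoc add.commute)
      then show ?thesis by (simp only: coord_shift)
    qed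
    then have "(\<Sum>a\<in>I. c (\<iota> a) * coord (shift (\<iota> a) x) (M + l)) = (\<Sum>a\<in>I. c (\<iota> a) * coord x (a + l))"
      by (intro sum.cong) auto
    then show "coord (bshift M (act I c x)) l = coord (\<Sum>a\<in>I. c (\<iota> a) *\<^sub>C bshift a x) l"
      using reindex[of "\<lambda>a. c a * coord (shift a x) (M + l)"] by (simp add: act_def coord_sum)
  qed
  then show ?thesis
    by (simp add: act_def cinner_sum_left cinner_sum_right cinner_scaleC_left cinner_scaleC_right
        adj sum_distrib_left mult_ac)
qed

section \<open>Strong and weak limits of shifts\<close>

text \<open>The uniform bound \<open>norm (T n x) \<le> norm x\<close> makes the vectors sent to
  null sequences a closed subspace, so the basis decides.\<close>

lemma strong_null_induct:
  fixes T :: "nat \<Rightarrow> 'k ell2 \<Rightarrow> 'a::complex_hilbert"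
  assumes add: "\<And>n x y. T n (x + y) = T n x + T n y"
    and scale: "\<And>n c x. T n (c *\<^sub>C x) = c *\<^sub>C T n x"
    and le: "\<And>n x. norm (T n x) \<le> norm x"
    and basis: "\<And>k. (\<lambda>n. T n (basis k)) \<longlonglongrightarrow> 0"
  shows "(\<lambda>n. T n x) \<longlonglongrightarrow> 0"
proof -
  define V where "V = {x. (\<lambda>n. T n x) \<longlonglongrightarrow> 0}"
  have T0: "T n 0 = 0" for n using scale[of n 0 0] by simp
  have Tdiff: "T n (x - y) = T n x - T n y" for n x y
    using add[of n x "(-1) *\<^sub>C y"] scale[of n "-1" y] by (simp add: scaleC_minus_left)
  have "csubspace V"
    unfolding csubspace_def V_def
    using tendsto_add[of "\<lambda>n. T n _" 0 sequentially "\<lambda>n. T n _" 0] tendsto_scaleC[OF tendsto_const, of "\<lambda>n. T n _" 0 sequentially]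
    by (auto simp: T0 add scale)
  moreover have "closed V"
    unfolding closed_sequential_limits
  proof safe
    fix X x assume X: "\<forall>i::nat. X i \<in> V" "X \<longlonglongrightarrow> x"
    have "(\<lambda>n. T n x) \<longlonglongrightarrow> 0"
    proof (rule LIMSEQ_I)
      fix e :: real assume e: "e > 0"
      obtain i where i: "norm (X i - x) < e / 2" using LIMSEQ_D[OF X(2), of "e/2"] e by auto
      obtain N where N: "\<And>n. n \<ge> N \<Longrightarrow> norm (T n (X i)) < e / 2"
        using LIMSEQ_D[of "\<lambda>n. T n (X i)" 0 "e/2"] X(1) e by (auto simp: V_def)
      have "norm (T n x - 0) < e" if "n \<ge> N" for n
      proof -
        have "norm (T n x) \<le> norm (T n (X i)) + norm (T n (X i - x))"
          unfolding Tdiff by (metis norm_minus_commute norm_triangle_sub)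
        then show ?thesis using N[OF that] le[of n "X i - x"] i by simp
      qed
      then show "\<exists>no. \<forall>n\<ge>no. norm (T n x - 0) < e" by blast
    qed
    then show "x \<in> V" by (simp add: V_def)
  qed
  ultimately have "x \<in> V" by (rule ell2_induct) (simp add: V_def basis)
  then show ?thesis by (simp add: V_def)
qed

lemma bshift_col_tendsto_0: "(\<lambda>n. bshift (0, n) (x :: (nat \<times> nat) ell2)) \<longlonglongrightarrow> 0"
proof (rule strong_null_induct)
  fix jk :: "nat \<times> nat"
  have "bshift (0, n) (basis jk) = 0" if "n > snd jk" for n
    using that by (intro ell2_eqI) (auto simp: coord_basis)
  then show "(\<lambda>n. bshift (0, n) (basis jk)) \<longlonglongrightarrow> 0"
    by (intro tendsto_eventually eventually_sequentiallyI[of "Suc (snd jk)"]) simp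
qed (auto intro!: ell2_eqI norm_pull_le inj_plus)

text \<open>Two vectors become asymptotically orthogonal once one of them is multiplied by a high
  power of z2; the backward shift on the other side tends to 0 in norm.\<close>

lemma cinner_shift_tendsto_0: "(\<lambda>n. cinner (shift (0, n) x) (y :: (nat \<times> nat) ell2)) \<longlonglongrightarrow> 0"
  unfolding cinner_shift using tendsto_cinner[OF tendsto_const bshift_col_tendsto_0] by simp

section \<open>Multiplication by polynomials in the second variable\<close>

definition ract :: "complex poly \<Rightarrow> (nat \<times> nat) ell2 \<Rightarrow> (nat \<times> nat) ell2" where
  "ract r = act ({0} \<times> {..degree r}) (\<lambda>i. coeff r (snd i))"

lemma H2_ev_ract:
  assumes "cmod z < 1" "cmod \<zeta> < 1"
  shows "H2.ev (ract r x) (z, \<zeta>) = poly r \<zeta> * H2.ev x (z, \<zeta>)"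
proof -
  have "(\<Sum>i\<in>{0} \<times> {..degree r}. coeff r (snd i) * mono2 i (z, \<zeta>)) = (\<Sum>j\<le>degree r. coeff r j * \<zeta> ^ j)"
    by (rule sum.reindex_bij_witness[of _ "\<lambda>j. (0, j)" snd]) (auto simp: mono2_def)
  then show ?thesis
    using assms H2.ev_act[of "(z, \<zeta>)"] by (simp add: ract_def D2_def poly_altdef)
qed

lemma H2_eqI:
  assumes "\<And>z \<zeta>. cmod z < 1 \<Longrightarrow> cmod \<zeta> < 1 \<Longrightarrow> H2.ev x (z, \<zeta>) = H2.ev y (z, \<zeta>)"
  shows "x = y"
  by (rule H2.ev_eqI) (use assms in \<open>auto simp: D2_def\<close>)

lemma H2_ev_shift:
  assumes "cmod z < 1" "cmod \<zeta> < 1"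
  shows "H2.ev (shift (a, b) x) (z, \<zeta>) = z ^ a * \<zeta> ^ b * H2.ev x (z, \<zeta>)"
  using H2.ev_shift[of "(z, \<zeta>)" "(a, b)" x] assms by (simp add: D2_def mono2_def)

lemma ract_mult: "ract (q * r) x = ract q (ract r x)"
  by (rule H2_eqI) (simp add: H2_ev_ract)

lemma ract_in:
  assumes "csubspace S" "\<And>x. x \<in> S \<Longrightarrow> shift (0, 1) x \<in> S" "x \<in> S"
  shows "shift (0, n) x \<in> S" "ract r x \<in> S"
proof -
  show *: "shift (0, n) x \<in> S" for n
  proof (induction n)
    case (Suc n)
    then show ?case using assms(2)[of "shift (0, n) x"] by (simp add: shift_shift)
  qed (use assms(3) in \<open>simp flip: zero_prod_def\<close>)
  show "ract r x \<in> S"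
    unfolding ract_def act_def
    by (rule csubspace_sum[OF assms(1)], rule csubspace_scaleC[OF assms(1)]) (use * in auto)
qed

lemma norm_sum_basis:
  assumes "finite I" "inj_on f I"
  shows "(norm (\<Sum>i\<in>I. c i *\<^sub>C basis (f i)))\<^sup>2 = (\<Sum>i\<in>I. (cmod (c i))\<^sup>2)"
proof -
  have "cinner (\<Sum>i\<in>I. c i *\<^sub>C basis (f i)) (\<Sum>i\<in>I. c i *\<^sub>C basis (f i))
      = (\<Sum>k\<in>I. cnj (c k) * (\<Sum>i\<in>I. if i = k then c k else 0))"
    unfolding cinner_sum_right cinner_scaleC_right cinner_basis coord_sum coord_scaleC coord_basis
    using assms(2) by (intro sum.cong refl arg_cong2[where f = "(*)"]) (auto dest: inj_onD)
  also have "\<dots> = (\<Sum>k\<in>I. complex_of_real ((cmod (c k))\<^sup>2))"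
    unfolding complex_norm_square using assms(1) by (intro sum.cong refl) (simp add: mult.commute)
  finally show ?thesis unfolding cinner_self of_real_sum[symmetric] of_real_eq_iff .
qed

text \<open>With w = 1/\<mu>, the vector y - (w z2)^k y is divisible by z2 - \<mu>. Averaging over k
  keeps divisibility and makes the error \<open>B n y\<close> small: the averages tend strongly to 0
  even for |w| = 1, since the powers of z2 move a basis vector through orthonormal ones.\<close>

lemma linear_factor_dense:
  assumes S: "csubspace S" "\<And>x. x \<in> S \<Longrightarrow> shift (0, 1) x \<in> S"
    and \<mu>: "cmod \<mu> \<ge> 1" and y: "y \<in> S" and e: "e > 0"
  shows "\<exists>x\<in>S. norm (ract [:-\<mu>, 1:] x - y) < e"
proof -
  define w where "w = inverse \<mu>"
  have \<mu>0: "\<mu> \<noteq> 0" using \<mu> by auto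
  have w: "cmod w \<le> 1" "w * \<mu> = 1" using \<mu> \<mu>0 by (auto simp: w_def norm_inverse inverse_le_1_iff)
  define B where "B n x = (1 / complex_of_nat (Suc n)) *\<^sub>C (\<Sum>k\<in>{1..Suc n}. w ^ k *\<^sub>C shift (0, k) x)"
    for n and x :: "(nat \<times> nat) ell2"
  have "(\<lambda>n. B n y) \<longlonglongrightarrow> 0"
  proof (rule strong_null_induct)
    show "B n (x + y) = B n x + B n y" for n x y
      by (simp add: B_def shift_add scaleC_add_right sum.distrib del: sum.cl_ivl_Suc)
    show "B n (c *\<^sub>C x) = c *\<^sub>C B n x" for n c x
      by (simp add: B_def shift_scaleC scaleC_sum_right mult_ac del: sum.cl_ivl_Suc)
    show "norm (B n x) \<le> norm x" for n x
    proof -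
      have "norm (\<Sum>k\<in>{1..Suc n}. w ^ k *\<^sub>C shift (0, k) x) \<le> (\<Sum>k\<in>{1..Suc n}. norm x)"
        by (rule order_trans[OF norm_sum], rule sum_mono)
          (simp add: norm_power mult_left_le_one_le power_le_one w)
      then show ?thesis by (simp add: B_def norm_divide field_simps del: of_nat_Suc)
    qed
    fix jk :: "nat \<times> nat"
    obtain j l where jk: "jk = (j, l)" by fastforce
    have "norm (B n (basis jk)) \<le> sqrt (1 / real (Suc n))" for n
    proof -
      have "(norm (\<Sum>k\<in>{1..Suc n}. w ^ k *\<^sub>C basis (j, k + l)))\<^sup>2 = (\<Sum>k\<in>{1..Suc n}. (cmod (w ^ k))\<^sup>2)"
        by (rule norm_sum_basis) (auto simp: inj_on_def)
      also have "\<dots> \<le> (\<Sum>k\<in>{1..Suc n}. 1)"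
        by (intro sum_mono) (simp add: norm_power power_le_one w)
      finally have "(norm (B n (basis jk)))\<^sup>2 \<le> (1 / real (Suc n))\<^sup>2 * real (Suc n)"
        by (simp add: B_def jk shift_basis norm_divide power_mult_distrib power_divide divide_right_mono del: of_nat_Suc)
      also have "\<dots> = 1 / real (Suc n)" by (simp add: power2_eq_square)
      finally show ?thesis by (intro real_le_rsqrt)
    qed
    moreover have "(\<lambda>n. sqrt (1 / real (Suc n))) \<longlonglongrightarrow> sqrt 0"
      by (intro tendsto_intros LIMSEQ_inverse_real_of_nat[unfolded inverse_eq_divide])
    ultimately show "(\<lambda>n. B n (basis jk)) \<longlonglongrightarrow> 0"
      using Lim_null_comparison[of "\<lambda>n. B n (basis jk)" "\<lambda>n. sqrt (1 / real (Suc n))"] by simp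
  qed
  from LIMSEQ_D[OF this e] obtain n where n: "norm (B n y) < e" by auto
  \<comment> \<open>The explicit quotient of y - B n y by z2 - \<mu> = -\<mu> (1 - w z2): finite
    geometric sums, one for each power in the average.\<close>
  define x where "x = (- w / complex_of_nat (Suc n)) *\<^sub>C (\<Sum>k\<in>{1..Suc n}. \<Sum>i<k. w ^ i *\<^sub>C shift (0, i) y)"
  have "x \<in> S"
    unfolding x_def using ract_in(1)[OF S y]
    by (intro csubspace_scaleC[OF S(1)] csubspace_sum[OF S(1)]) auto
  moreover have "ract [:-\<mu>, 1:] x = y - B n y"
  proof -
    have lin: "ract [:-\<mu>, 1:] x = shift (0, 1) x - \<mu> *\<^sub>C x" for x
      by (rule H2_eqI) (simp add: H2_ev_ract H2_ev_shift algebra_simps)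
    have tele: "w *\<^sub>C shift (0, 1) (\<Sum>i<k. w ^ i *\<^sub>C shift (0, i) y) - (\<Sum>i<k. w ^ i *\<^sub>C shift (0, i) y)
        = w ^ k *\<^sub>C shift (0, k) y - y" for k
    proof -
      have "w *\<^sub>C shift (0, 1) (\<Sum>i<k. w ^ i *\<^sub>C shift (0, i) y) = (\<Sum>i<k. w ^ Suc i *\<^sub>C shift (0, Suc i) y)"
        by (simp add: shift_sum shift_scaleC shift_shift scaleC_sum_right)
      then show ?thesis
        using sum_lessThan_telescope[of "\<lambda>i. w ^ i *\<^sub>C shift (0, i) y" k]
        by (simp add: sum_subtractf flip: zero_prod_def)
    qed
    define N where "N = complex_of_nat (Suc n)"
    have N: "N \<noteq> 0" by (simp add: N_def del: of_nat_Suc)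
    define s where "s = (\<Sum>k\<in>{1..Suc n}. \<Sum>i<k. w ^ i *\<^sub>C shift (0, i) y)"
    have s: "w *\<^sub>C shift (0, 1) s - s = (\<Sum>k\<in>{1..Suc n}. w ^ k *\<^sub>C shift (0, k) y - y)"
      unfolding s_def shift_sum[of _ _ "{1..Suc n}"] scaleC_sum_right[of _ _ "{1..Suc n}"] sum_subtractf[symmetric]
      by (intro sum.cong refl tele)
    have "ract [:-\<mu>, 1:] x = (- 1 / N) *\<^sub>C (w *\<^sub>C shift (0, 1) s - (w * \<mu>) *\<^sub>C s)"
      unfolding lin x_def s_def[symmetric] N_def[symmetric]
      by (simp add: shift_scaleC scaleC_diff_right mult_ac)
    also have "\<dots> = (- 1 / N) *\<^sub>C (\<Sum>k\<in>{1..Suc n}. w ^ k *\<^sub>C shift (0, k) y - y)"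
      using s w(2) by simp
    also have "(\<Sum>k\<in>{1..Suc n}. w ^ k *\<^sub>C shift (0, k) y - y) = (\<Sum>k\<in>{1..Suc n}. w ^ k *\<^sub>C shift (0, k) y) - N *\<^sub>C y"
    proof -
      have "(\<Sum>k\<in>{1..Suc n}. y) = N *\<^sub>C y"
        unfolding N_def using scaleC_sum_left[of "\<lambda>_. 1" "{1..Suc n}" y] by simp
      then show ?thesis unfolding sum_subtractf by simp
    qed
    also have "(- 1 / N) *\<^sub>C \<dots> = y - B n y"
      unfolding scaleC_diff_right B_def N_def[symmetric] using N
      by (simp add: scaleC_minus_left)
    finally show ?thesis .
  qed
  ultimately show ?thesis using n by (intro bexI[of _ x]) auto
qed

text \<open>The fundamental theorem of algebra splits off linear factors, whose zeros lie outside
  the open disk. Each factor maps S into itself with dense range, and boundedness lets the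
  approximations be composed.\<close>

lemma ract_dense:
  assumes S: "csubspace S" "\<And>x. x \<in> S \<Longrightarrow> shift (0, 1) x \<in> S"
    and "r \<noteq> 0" "\<And>\<mu>. cmod \<mu> < 1 \<Longrightarrow> poly r \<mu> \<noteq> 0" "y \<in> S" "e > 0"
  shows "\<exists>x\<in>S. norm (ract r x - y) < e"
  using assms(3-)
proof (induction "degree r" arbitrary: r y e)
  case 0
  then obtain c where c: "r = [:c:]" "c \<noteq> 0" by (metis degree_0_id pCons_0_0 of_nat_0 degree_eq_zeroE)
  have "ract r ((1 / c) *\<^sub>C y) = y" by (rule H2_eqI) (simp add: H2_ev_ract c)
  then show ?case using 0 csubspace_scaleC[OF S(1)] by (intro bexI[of _ "(1 / c) *\<^sub>C y"]) auto
next
  case (Suc d)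
  from Suc.hyps(2) have "\<not> constant (poly r)" by (simp add: constant_degree flip: Suc.hyps(2))
  then obtain \<mu> where "poly r \<mu> = 0" using fundamental_theorem_of_algebra by blast
  then obtain r' where r': "r = [:-\<mu>, 1:] * r'" by (auto simp: poly_eq_0_iff_dvd)
  have "r' \<noteq> 0" using Suc.prems(1) r' by auto
  then have deg: "d = degree r'" using Suc.hyps(2) unfolding r' by (subst (asm) degree_mult_eq) auto
  have nz: "poly r' \<nu> \<noteq> 0" if "cmod \<nu> < 1" for \<nu> using Suc.prems(2)[OF that] unfolding r' by auto
  have \<mu>: "cmod \<mu> \<ge> 1" using Suc.prems(2)[of \<mu>] \<open>poly r \<mu> = 0\<close> by force
  obtain x where x: "x \<in> S" "norm (ract [:-\<mu>, 1:] x - y) < e / 2"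
    using linear_factor_dense[OF S \<mu> \<open>y \<in> S\<close>, of "e / 2"] Suc.prems(4) by auto
  define q where "q = [:-\<mu>, 1:]"
  obtain K where K: "K > 0" "\<And>v. norm (ract q v) \<le> norm v * K"
    using bounded_linear.pos_bounded[OF bounded_linear_act] unfolding ract_def by blast
  obtain v where v: "v \<in> S" "norm (ract r' v - x) < e / (2 * K)"
    using Suc.hyps(1)[OF deg \<open>r' \<noteq> 0\<close> nz x(1), of "e / (2 * K)"] Suc.prems(4) K(1) by auto
  have "norm (ract q (ract r' v) - ract q x) \<le> norm (ract r' v - x) * K"
    using K(2)[of "ract r' v - x"]
    unfolding ract_def by (simp add: linear_diff[OF bounded_linear.linear[OF bounded_linear_act]])
  also have "\<dots> < e / 2" using v(2) K(1) by (simp add: field_simps)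
  finally have "norm (ract r v - y) < e"
    unfolding r' ract_mult q_def[symmetric]
    using norm_triangle_lt[of "ract q (ract r' v) - ract q x" "ract q x - y" e] x(2)[folded q_def]
    by simp
  then show ?case using v(1) by blast
qed

section \<open>Multiplication by a rational inner function\<close>

locale rational_inner =
  fixes p :: "complex poly poly" and m n :: nat
  assumes deg: "deg1 p \<le> m" "deg2 p \<le> n"
    and nz: "\<And>z \<zeta>. cmod z < 1 \<Longrightarrow> cmod \<zeta> < 1 \<Longrightarrow> bpoly p z \<zeta> \<noteq> 0"
    and cop: "coprime p (reflect2 m n p)"
begin

definition pt :: "complex poly poly" where
  "pt = reflect2 m n p"

lemma pt_le:
  assumes "cmod z \<le> 1" "cmod \<zeta> \<le> 1"
  shows "cmod (bpoly pt z \<zeta>) \<le> cmod (bpoly p z \<zeta>)"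
  using le_on_closed_bidisk[of "\<lambda>x. cmod (bpoly pt (fst x) (snd x))" "\<lambda>x. cmod (bpoly p (fst x) (snd x))" z \<zeta>]
    reflect2_le[OF deg nz] assms
  by (force intro!: continuous_intros simp: pt_def)

lemma coeff_pt:
  "coeff (coeff pt i) j = (if i \<le> m \<and> j \<le> n then cnj (coeff (coeff p (m - i)) (n - j)) else 0)"
  by (simp add: pt_def coeff_reflect2)

text \<open>Both terms of the Bezout identity are controlled by |p|, because |pt| \<le> |p|; a bound
  M for |a| + |b| on the closed bidisk gives a minorant to start from.\<close>

lemma minorant_exists:
  "\<exists>r C. r \<noteq> 0 \<and> C \<ge> 0
    \<and> (\<forall>z \<zeta>. cmod z \<le> 1 \<longrightarrow> cmod \<zeta> \<le> 1 \<longrightarrow> cmod (poly r \<zeta>) \<le> C * cmod (bpoly p z \<zeta>))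
    \<and> (\<forall>\<mu>. cmod \<mu> < 1 \<longrightarrow> poly r \<mu> \<noteq> 0)
    \<and> (\<forall>\<mu>. cmod \<mu> \<le> 1 \<longrightarrow> (\<forall>z. cmod z \<le> 1 \<longrightarrow> bpoly p z \<mu> \<noteq> 0) \<longrightarrow> poly r \<mu> \<noteq> 0)"
proof -
  have p0: "p \<noteq> 0" using nz[of 0 0] by auto
  obtain a b r0 where r0: "r0 \<noteq> 0" "a * p + b * pt = [:r0:]"
    using coprime_bezout[OF cop p0] unfolding pt_def by metis
  have cb: "compact (cball (0::complex) 1 \<times> cball (0::complex) 1)" by (intro compact_Times) auto
  have "bounded ((\<lambda>x. cmod (bpoly a (fst x) (snd x)) + cmod (bpoly b (fst x) (snd x))) ` (cball 0 1 \<times> cball 0 1))"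
    by (intro compact_imp_bounded compact_continuous_image continuous_intros cb)
  then obtain M where M: "\<And>x. x \<in> cball 0 1 \<times> cball 0 1 \<Longrightarrow> cmod (bpoly a (fst x) (snd x)) + cmod (bpoly b (fst x) (snd x)) \<le> M"
    unfolding bounded_iff by force
  have "cmod (poly r0 \<zeta>) \<le> M * cmod (bpoly p z \<zeta>)" if "cmod z < 1" "cmod \<zeta> < 1" for z \<zeta>
  proof -
    have "poly r0 \<zeta> = bpoly a z \<zeta> * bpoly p z \<zeta> + bpoly b z \<zeta> * bpoly pt z \<zeta>"
      using arg_cong[OF r0(2), of "\<lambda>q. bpoly q z \<zeta>"] by (simp add: bpoly_add bpoly_mult)
    then have "cmod (poly r0 \<zeta>) \<le> cmod (bpoly a z \<zeta>) * cmod (bpoly p z \<zeta>) + cmod (bpoly b z \<zeta>) * cmod (bpoly pt z \<zeta>)"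
      by (metis norm_mult norm_triangle_ineq)
    also have "\<dots> \<le> cmod (bpoly a z \<zeta>) * cmod (bpoly p z \<zeta>) + cmod (bpoly b z \<zeta>) * cmod (bpoly p z \<zeta>)"
      using that by (intro add_left_mono mult_left_mono pt_le) auto
    also have "\<dots> = (cmod (bpoly a z \<zeta>) + cmod (bpoly b z \<zeta>)) * cmod (bpoly p z \<zeta>)"
      by (simp add: distrib_right)
    also have "\<dots> \<le> M * cmod (bpoly p z \<zeta>)"
      using M[of "(z, \<zeta>)"] that by (intro mult_right_mono) auto
    finally show ?thesis .
  qed
  note le = this
  show ?thesis
    by (rule polynomial_minorant[of p r0 M, OF nz r0(1) le]) blast+
qed

definition minorant :: "complex poly" where
  "minorant = (SOME r. \<exists>C. r \<noteq> 0 \<and> C \<ge> 0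
    \<and> (\<forall>z \<zeta>. cmod z \<le> 1 \<longrightarrow> cmod \<zeta> \<le> 1 \<longrightarrow> cmod (poly r \<zeta>) \<le> C * cmod (bpoly p z \<zeta>))
    \<and> (\<forall>\<mu>. cmod \<mu> < 1 \<longrightarrow> poly r \<mu> \<noteq> 0)
    \<and> (\<forall>\<mu>. cmod \<mu> \<le> 1 \<longrightarrow> (\<forall>z. cmod z \<le> 1 \<longrightarrow> bpoly p z \<mu> \<noteq> 0) \<longrightarrow> poly r \<mu> \<noteq> 0))"

lemma minorant_bound:
  obtains C where "C \<ge> 0"
    "\<And>z \<zeta>. cmod z \<le> 1 \<Longrightarrow> cmod \<zeta> \<le> 1 \<Longrightarrow> cmod (poly minorant \<zeta>) \<le> C * cmod (bpoly p z \<zeta>)"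
  using someI_ex[OF minorant_exists, folded minorant_def] by blast

lemma minorant_nonzero: "minorant \<noteq> 0"
  and minorant_disk: "cmod \<mu> < 1 \<Longrightarrow> poly minorant \<mu> \<noteq> 0"
  and minorant_off_zeros: "cmod \<mu> \<le> 1 \<Longrightarrow> (\<And>z. cmod z \<le> 1 \<Longrightarrow> bpoly p z \<mu> \<noteq> 0) \<Longrightarrow> poly minorant \<mu> \<noteq> 0"
  using someI_ex[OF minorant_exists, folded minorant_def] by blast+

lemma zero_free: "poly minorant \<zeta> \<noteq> 0 \<Longrightarrow> cmod z \<le> 1 \<Longrightarrow> cmod \<zeta> \<le> 1 \<Longrightarrow> bpoly p z \<zeta> \<noteq> 0"
  using minorant_bound by (metis mult_zero_right norm_le_zero_iff norm_zero)

lemma minorant_dense: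
  assumes "csubspace S" "\<And>x. x \<in> S \<Longrightarrow> shift (0, 1) x \<in> S" "y \<in> S" "e > 0"
  shows "\<exists>x\<in>S. norm (ract minorant x - y) < e"
  using ract_dense[OF assms(1,2) minorant_nonzero minorant_disk assms(3,4)] .

definition pact :: "(nat \<times> nat) ell2 \<Rightarrow> (nat \<times> nat) ell2" where
  "pact = act ({..m} \<times> {..n}) (\<lambda>a. coeff (coeff p (fst a)) (snd a))"

definition ptact :: "(nat \<times> nat) ell2 \<Rightarrow> (nat \<times> nat) ell2" where
  "ptact = act ({..m} \<times> {..n}) (\<lambda>a. coeff (coeff pt (fst a)) (snd a))"

lemma ev_pact:
  assumes "cmod z < 1" "cmod \<zeta> < 1"
  shows "H2.ev (pact x) (z, \<zeta>) = bpoly p z \<zeta> * H2.ev x (z, \<zeta>)"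
  using H2.ev_act[of "(z, \<zeta>)"] assms
  by (simp add: pact_def D2_def bpoly_eq_sum[OF deg] sum.cartesian_product mono2_def case_prod_unfold mult.assoc)

lemma ev_ptact:
  assumes "cmod z < 1" "cmod \<zeta> < 1"
  shows "H2.ev (ptact x) (z, \<zeta>) = bpoly pt z \<zeta> * H2.ev x (z, \<zeta>)"
  using H2.ev_act[of "(z, \<zeta>)"] assms
  by (simp add: ptact_def D2_def pt_def bpoly_eq_sum[OF deg1_reflect2 deg2_reflect2] sum.cartesian_product mono2_def case_prod_unfold mult.assoc)

section \<open>Division by the denominator and multiplication by the inner function\<close>

definition divp :: "(nat \<times> nat) ell2 \<Rightarrow> (nat \<times> nat) ell2" where
  "divp Y = (SOME F. \<forall>z \<zeta>. cmod z < 1 \<longrightarrow> cmod \<zeta> < 1 \<longrightarrow> bpoly p z \<zeta> * H2.ev F (z, \<zeta>) = H2.ev Y (z, \<zeta>))"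

text \<open>The coefficients of the quotient depend holomorphically on the second variable
  because they satisfy a recursion in which only p(0,z2) is inverted.\<close>

lemma divp_exists:
  assumes C: "C \<ge> 0"
    and le: "\<And>z \<zeta>. cmod z < 1 \<Longrightarrow> cmod \<zeta> < 1 \<Longrightarrow> cmod (H2.ev Y (z, \<zeta>)) \<le> C * cmod (bpoly p z \<zeta>) * cmod (H2.ev U (z, \<zeta>))"
  shows "\<exists>F. (\<forall>z \<zeta>. cmod z < 1 \<longrightarrow> cmod \<zeta> < 1 \<longrightarrow> bpoly p z \<zeta> * H2.ev F (z, \<zeta>) = H2.ev Y (z, \<zeta>))
    \<and> norm F \<le> C * norm U"
proof -
  \<comment> \<open>Each slice is divided separately by one-variable majorization;
    \<open>slice_majorized\<close> glues the quotients once their coordinates are known to be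
    holomorphic in \<zeta>.\<close>
  have "\<exists>v. (\<forall>z. cmod z < 1 \<longrightarrow> H1.ev v z = H2.ev Y (z, \<zeta>) / bpoly p z \<zeta>) \<and> norm v \<le> C * norm (slice U \<zeta>)"
    if \<zeta>: "cmod \<zeta> < 1" for \<zeta>
  proof -
    have "(\<lambda>z. H1.ev (slice Y \<zeta>) z / bpoly p z \<zeta>) holomorphic_on ball 0 1"
      using nz \<zeta> by (intro holomorphic_intros H1_ev_holomorphic) auto
    then obtain v where "\<And>z. cmod z < 1 \<Longrightarrow> H1.ev v z = H1.ev (slice Y \<zeta>) z / bpoly p z \<zeta>" "norm v \<le> C * norm (slice U \<zeta>)"
    proof (rule H1_majorized[OF _ C])
      fix z :: complex assume z: "cmod z < 1"
      show "cmod (H1.ev (slice Y \<zeta>) z / bpoly p z \<zeta>) \<le> C * cmod (H1.ev (slice U \<zeta>) z)"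
        using le[OF z \<zeta>] nz[OF z \<zeta>] by (simp add: ev_slice[OF z \<zeta>] norm_divide divide_le_eq mult_ac)
    qed blast
    then show ?thesis using \<zeta> by (auto simp: ev_slice)
  qed
  then obtain X where X: "\<And>\<zeta> z. cmod \<zeta> < 1 \<Longrightarrow> cmod z < 1 \<Longrightarrow> H1.ev (X \<zeta>) z = H2.ev Y (z, \<zeta>) / bpoly p z \<zeta>"
    "\<And>\<zeta>. cmod \<zeta> < 1 \<Longrightarrow> norm (X \<zeta>) \<le> C * norm (slice U \<zeta>)" by metis
  have act_X: "act {..m} (\<lambda>i. poly (coeff p i) \<zeta>) (X \<zeta>) = slice Y \<zeta>" if \<zeta>: "cmod \<zeta> < 1" for \<zeta>
  proof (rule H1.ev_eqI)
    fix z :: complex assume "z \<in> D1"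
    then have z: "cmod z < 1" "z \<in> D1" by (auto simp: D1_def)
    show "H1.ev (act {..m} (\<lambda>i. poly (coeff p i) \<zeta>) (X \<zeta>)) z = H1.ev (slice Y \<zeta>) z"
      using nz[OF z(1) \<zeta>] X(1)[OF \<zeta> z(1)]
      by (simp add: H1.ev_act[OF z(2)] ev_slice z \<zeta> mono1_def bpoly_eq_sum1[OF deg(1), symmetric])
  qed
  have coeffs: "(\<Sum>i\<le>m. poly (coeff p i) \<zeta> * (if i \<le> j then coord (X \<zeta>) (j - i) else 0)) = H1.ev (row j Y) \<zeta>"
    if "cmod \<zeta> < 1" for \<zeta> j
    using arg_cong[OF act_X[OF that], of "\<lambda>v. coord v j"]
    by (simp add: act_def coord_sum coord_shift_nat coord_slice[OF that])
  have hol: "(\<lambda>\<zeta>. coord (X \<zeta>) j) holomorphic_on ball 0 1" for j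
  proof (induction j rule: less_induct)
    case (less j)
    have p0: "poly (coeff p 0) \<zeta> \<noteq> 0" if "cmod \<zeta> < 1" for \<zeta>
      using nz[of 0 \<zeta>] that by (simp add: bpoly_eq_sum1[OF deg(1)] power_0_left sum.atMost_shift)
    have polyhol: "(\<lambda>\<zeta>. poly c \<zeta>) holomorphic_on ball 0 1" for c :: "complex poly"
      by (induction c) (auto intro!: holomorphic_intros)
    define R where "R \<zeta> = (H1.ev (row j Y) \<zeta> - (\<Sum>i\<in>{1..m}. poly (coeff p i) \<zeta> * (if i \<le> j then coord (X \<zeta>) (j - i) else 0))) / poly (coeff p 0) \<zeta>" for \<zeta>
    have term_hol: "(\<lambda>\<zeta>. poly (coeff p i) \<zeta> * (if i \<le> j then coord (X \<zeta>) (j - i) else 0)) holomorphic_on ball 0 1"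
      if "i \<in> {1..m}" for i
      using that less[of "j - i"] by (cases "i \<le> j") (auto intro!: holomorphic_intros polyhol)
    have "R holomorphic_on ball 0 1"
      unfolding R_def
      by (intro holomorphic_on_divide holomorphic_on_diff holomorphic_on_sum H1_ev_holomorphic term_hol polyhol)
        (use p0 in auto)
    moreover have "R \<zeta> = coord (X \<zeta>) j" if "\<zeta> \<in> ball 0 1" for \<zeta>
    proof -
      have "{..m} = insert 0 {1..m}" by auto
      then have "poly (coeff p 0) \<zeta> * coord (X \<zeta>) j + (\<Sum>i\<in>{1..m}. poly (coeff p i) \<zeta> * (if i \<le> j then coord (X \<zeta>) (j - i) else 0)) = H1.ev (row j Y) \<zeta>"
        using coeffs[of \<zeta> j] that by simp
      then show ?thesis using p0[of \<zeta>] that by (simp add: R_def field_simps)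
    qed
    ultimately show ?case by (rule holomorphic_transform)
  qed
  obtain F where F: "\<And>\<zeta>. cmod \<zeta> < 1 \<Longrightarrow> slice F \<zeta> = X \<zeta>" "norm F \<le> C * norm U"
    using slice_majorized[of X C U, OF hol C X(2)] by blast
  have "bpoly p z \<zeta> * H2.ev F (z, \<zeta>) = H2.ev Y (z, \<zeta>)" if "cmod z < 1" "cmod \<zeta> < 1" for z \<zeta>
    using X(1)[OF that(2,1)] ev_slice[OF that, of F] F(1)[OF that(2)] nz[OF that]
    by (simp add: field_simps)
  with F(2) show ?thesis by blast
qed

lemma divp:
  assumes C: "C \<ge> 0"
    and le: "\<And>z \<zeta>. cmod z < 1 \<Longrightarrow> cmod \<zeta> < 1 \<Longrightarrow> cmod (H2.ev Y (z, \<zeta>)) \<le> C * cmod (bpoly p z \<zeta>) * cmod (H2.ev U (z, \<zeta>))"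
  shows "\<And>z \<zeta>. cmod z < 1 \<Longrightarrow> cmod \<zeta> < 1 \<Longrightarrow> H2.ev (divp Y) (z, \<zeta>) = H2.ev Y (z, \<zeta>) / bpoly p z \<zeta>"
    and "norm (divp Y) \<le> C * norm U"
proof -
  obtain F where F: "\<forall>z \<zeta>. cmod z < 1 \<longrightarrow> cmod \<zeta> < 1 \<longrightarrow> bpoly p z \<zeta> * H2.ev F (z, \<zeta>) = H2.ev Y (z, \<zeta>)"
    "norm F \<le> C * norm U" using divp_exists[OF assms] by blast
  have d: "bpoly p z \<zeta> * H2.ev (divp Y) (z, \<zeta>) = H2.ev Y (z, \<zeta>)" if "cmod z < 1" "cmod \<zeta> < 1" for z \<zeta>
    using someI[of "\<lambda>F. \<forall>z \<zeta>. cmod z < 1 \<longrightarrow> cmod \<zeta> < 1 \<longrightarrow> bpoly p z \<zeta> * H2.ev F (z, \<zeta>) = H2.ev Y (z, \<zeta>)", OF F(1)] that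
    unfolding divp_def by blast
  show ev: "H2.ev (divp Y) (z, \<zeta>) = H2.ev Y (z, \<zeta>) / bpoly p z \<zeta>" if "cmod z < 1" "cmod \<zeta> < 1" for z \<zeta>
    using d[OF that] nz[OF that] by (simp add: field_simps)
  have "divp Y = F"
  proof (rule H2_eqI)
    fix z \<zeta> :: complex assume z: "cmod z < 1" "cmod \<zeta> < 1"
    show "H2.ev (divp Y) (z, \<zeta>) = H2.ev F (z, \<zeta>)"
      using d[OF z] F(1)[rule_format, OF z, symmetric] nz[OF z] by simp
  qed
  with F(2) show "norm (divp Y) \<le> C * norm U" by simp
qed

text \<open>Multiplication by \<Theta>; the quotient exists with x itself as majorant, because |pt|
  \<le> |p|.\<close>

definition mulT :: "(nat \<times> nat) ell2 \<Rightarrow> (nat \<times> nat) ell2" where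
  "mulT x = divp (ptact x)"

text \<open>Multiplication by the bounded function r(z2) / p, r the minorant, in place of the
  possibly unbounded 1 / p.\<close>

definition mulR :: "(nat \<times> nat) ell2 \<Rightarrow> (nat \<times> nat) ell2" where
  "mulR x = divp (ract minorant x)"

lemma ptact_le:
  assumes "cmod z < 1" "cmod \<zeta> < 1"
  shows "cmod (H2.ev (ptact x) (z, \<zeta>)) \<le> 1 * cmod (bpoly p z \<zeta>) * cmod (H2.ev x (z, \<zeta>))"
  using pt_le[of z \<zeta>] assms by (simp add: ev_ptact norm_mult mult_right_mono)

lemma ev_mulT:
  assumes "cmod z < 1" "cmod \<zeta> < 1"
  shows "H2.ev (mulT x) (z, \<zeta>) = bpoly pt z \<zeta> / bpoly p z \<zeta> * H2.ev x (z, \<zeta>)"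
  unfolding mulT_def using divp(1)[of 1 "ptact x" x, OF _ ptact_le assms] by (simp add: ev_ptact assms)

lemma norm_mulT_le: "norm (mulT x) \<le> norm x"
  unfolding mulT_def using divp(2)[of 1 "ptact x" x, OF _ ptact_le] by simp

lemma ev_mulR:
  assumes "cmod z < 1" "cmod \<zeta> < 1"
  shows "H2.ev (mulR x) (z, \<zeta>) = poly minorant \<zeta> / bpoly p z \<zeta> * H2.ev x (z, \<zeta>)"
proof -
  obtain C where C: "C \<ge> 0"
    "\<And>z \<zeta>. cmod z \<le> 1 \<Longrightarrow> cmod \<zeta> \<le> 1 \<Longrightarrow> cmod (poly minorant \<zeta>) \<le> C * cmod (bpoly p z \<zeta>)"
    using minorant_bound by blast
  have "cmod (H2.ev (ract minorant x) (z, \<zeta>)) \<le> C * cmod (bpoly p z \<zeta>) * cmod (H2.ev x (z, \<zeta>))"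
    if "cmod z < 1" "cmod \<zeta> < 1" for z \<zeta>
    using C(2)[of z \<zeta>] that by (simp add: H2_ev_ract norm_mult mult_right_mono)
  from divp(1)[OF C(1) this assms] show ?thesis
    by (simp add: mulR_def H2_ev_ract assms)
qed

lemma bounded_linear_mulR: "bounded_linear mulR"
proof -
  obtain C where C: "C \<ge> 0"
    "\<And>z \<zeta>. cmod z \<le> 1 \<Longrightarrow> cmod \<zeta> \<le> 1 \<Longrightarrow> cmod (poly minorant \<zeta>) \<le> C * cmod (bpoly p z \<zeta>)"
    using minorant_bound by blast
  have "cmod (H2.ev (ract minorant x) (z, \<zeta>)) \<le> C * cmod (bpoly p z \<zeta>) * cmod (H2.ev x (z, \<zeta>))"
    if "cmod z < 1" "cmod \<zeta> < 1" for z \<zeta> x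
    using C(2)[of z \<zeta>] that by (simp add: H2_ev_ract norm_mult mult_right_mono)
  from divp(2)[OF C(1) this] have "norm (mulR x) \<le> norm x * C" for x
    by (simp add: mulR_def mult.commute)
  moreover have "mulR (x + y) = mulR x + mulR y" for x y
    by (rule H2_eqI) (simp add: ev_mulR algebra_simps)
  moreover have "mulR (r *\<^sub>R x) = r *\<^sub>R mulR x" for r x
    unfolding scaleC_of_real[symmetric] by (rule H2_eqI) (simp add: ev_mulR)
  ultimately show ?thesis by (intro bounded_linear_intro)
qed

lemma mulT_add: "mulT (x + y) = mulT x + mulT y"
  by (rule H2_eqI) (simp add: ev_mulT algebra_simps)

lemma mulT_diff: "mulT (x - y) = mulT x - mulT y"
  by (rule H2_eqI) (simp add: ev_mulT algebra_simps)

lemma mulT_scaleC: "mulT (c *\<^sub>C x) = c *\<^sub>C mulT x"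
  by (rule H2_eqI) (simp add: ev_mulT)

lemma mulT_shift: "mulT (shift a x) = shift a (mulT x)"
  by (cases a) (auto intro!: H2_eqI simp: ev_mulT H2_ev_shift)

text \<open>Testing against multiples of p cancels the denominator and leaves the polynomial pt,
  whose adjoint is explicit.\<close>

lemma mulT_pact: "mulT (pact x) = ptact x"
  by (rule H2_eqI) (simp add: ev_mulT ev_pact ev_ptact nz)

lemma mulT_sum: "mulT (sum f A) = (\<Sum>a\<in>A. mulT (f a))"
proof (induction A rule: infinite_finite_induct)
  case (insert a A)
  then show ?case by (simp add: mulT_add)
qed (use mulT_diff[of 0 0] in simp_all)

lemma bounded_linear_mulT: "bounded_linear mulT"
  by (rule bounded_linear_intro[of _ 1]) (auto simp: mulT_add mulT_scaleC norm_mulT_le simp flip: scaleC_of_real)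

section \<open>Boundary slices and the isometry property\<close>

text \<open>At a zero of p the minorant vanishes too, and the product is bounded by B times the
  modulus of the minorant; so it tends to its value 0 there.\<close>

lemma quotient_slices:
  assumes N: "continuous_on (cball 0 1 \<times> cball 0 1) (\<lambda>x. N (fst x) (snd x))"
    and hol: "\<And>\<zeta>. cmod \<zeta> \<le> 1 \<Longrightarrow> (\<lambda>z. N z \<zeta>) holomorphic_on ball 0 1"
    and le: "\<And>z \<zeta>. cmod z \<le> 1 \<Longrightarrow> cmod \<zeta> \<le> 1 \<Longrightarrow> cmod (N z \<zeta>) \<le> B * cmod (bpoly p z \<zeta>)"
  obtains G where "continuous_on (cball 0 1) G"
    "\<And>z \<zeta>. cmod z < 1 \<Longrightarrow> cmod \<zeta> \<le> 1 \<Longrightarrow> H1.ev (G \<zeta>) z = poly minorant \<zeta> * (N z \<zeta> / bpoly p z \<zeta>)"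
proof (rule continuous_slices[of "\<lambda>z \<zeta>. poly minorant \<zeta> * (N z \<zeta> / bpoly p z \<zeta>)"])
  define W where "W x = poly minorant (snd x) * (N (fst x) (snd x) / bpoly p (fst x) (snd x))" for x
  have Wle: "cmod (W x) \<le> B * cmod (poly minorant (snd x))" if "x \<in> cball 0 1 \<times> cball 0 1" for x
  proof (cases "poly minorant (snd x) = 0")
    case False
    have "bpoly p (fst x) (snd x) \<noteq> 0" using zero_free[OF False] that by auto
    then have "cmod (N (fst x) (snd x) / bpoly p (fst x) (snd x)) \<le> B"
      using le[of "fst x" "snd x"] that by (auto simp: norm_divide divide_le_eq)
    from mult_left_mono[OF this norm_ge_zero[of "poly minorant (snd x)"]] show ?thesis
      unfolding W_def norm_mult by (simp only: mult.commute)
  qed (simp add: W_def)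
  have "continuous_on (cball 0 1 \<times> cball 0 1) W"
    unfolding continuous_on_eq_continuous_within
  proof
    fix x :: "complex \<times> complex" assume x: "x \<in> cball 0 1 \<times> cball 0 1"
    show "continuous (at x within cball 0 1 \<times> cball 0 1) W"
    proof (cases "bpoly p (fst x) (snd x) = 0")
      case True
      have r0: "poly minorant (snd x) = 0"
        by (rule ccontr) (use zero_free[of "snd x" "fst x"] x True in auto)
      have "((\<lambda>y. B * cmod (poly minorant (snd y))) \<longlongrightarrow> B * cmod (poly minorant (snd x))) (at x within cball 0 1 \<times> cball 0 1)"
        by (intro tendsto_intros)
      then have "((\<lambda>y. B * cmod (poly minorant (snd y))) \<longlongrightarrow> 0) (at x within cball 0 1 \<times> cball 0 1)"
        by (simp add: r0)
      moreover have "\<forall>\<^sub>F y in at x within cball 0 1 \<times> cball 0 1. norm (W y) \<le> B * cmod (poly minorant (snd y))"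
        using Wle by (auto simp: eventually_at_filter)
      ultimately have "(W \<longlongrightarrow> 0) (at x within cball 0 1 \<times> cball 0 1)"
        by (rule Lim_null_comparison[rotated])
      then show ?thesis by (simp add: continuous_within W_def r0)
    next
      case False
      have "continuous (at x within cball 0 1 \<times> cball 0 1) (\<lambda>x. N (fst x) (snd x))"
        using N x unfolding continuous_on_eq_continuous_within by blast
      then show ?thesis
        unfolding W_def continuous_within using False by (intro tendsto_intros tendsto_bpoly)
    qed
  qed
  then show "continuous_on (cball 0 1 \<times> cball 0 1)
      (\<lambda>x. poly minorant (snd x) * (N (fst x) (snd x) / bpoly p (fst x) (snd x)))"
    by (simp add: W_def[abs_def])
  fix \<zeta> :: complex assume \<zeta>: "cmod \<zeta> \<le> 1"
  show "(\<lambda>z. poly minorant \<zeta> * (N z \<zeta> / bpoly p z \<zeta>)) holomorphic_on ball 0 1"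
  proof (cases "poly minorant \<zeta> = 0")
    case False
    then have "bpoly p z \<zeta> \<noteq> 0" if "z \<in> ball 0 1" for z using zero_free that \<zeta> by auto
    then show ?thesis using \<zeta> by (intro holomorphic_intros hol) auto
  qed simp
qed (use that in blast)

text \<open>\<open>H2.ev\<close> is tied to the open bidisk; the polynomial given by a truncation is
  evaluated up to the boundary by this sum.\<close>

definition pfun :: "(nat \<times> nat) set \<Rightarrow> (nat \<times> nat) ell2 \<Rightarrow> complex \<Rightarrow> complex \<Rightarrow> complex" where
  "pfun F x z \<zeta> = (\<Sum>k\<in>F. coord x k * (z ^ fst k * \<zeta> ^ snd k))"

lemma ev_trunc:
  assumes "cmod z < 1" "cmod \<zeta> < 1"
  shows "H2.ev (trunc F x) (z, \<zeta>) = pfun F x z \<zeta>"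
  using assms by (simp add: trunc_def H2.ev_sum H2.ev_basis D2_def pfun_def mono2_def)

lemma continuous_pfun [continuous_intros]:
  "continuous_on S f \<Longrightarrow> continuous_on S g \<Longrightarrow> continuous_on S (\<lambda>x. pfun F u (f x) (g x))"
  unfolding pfun_def by (intro continuous_intros)

lemma holomorphic_pfun [holomorphic_intros]:
  "f holomorphic_on S \<Longrightarrow> (\<lambda>x. pfun F u (f x) c) holomorphic_on S"
  unfolding pfun_def by (intro holomorphic_intros)

lemma pfun_bounded:
  obtains B where "B \<ge> 0" "\<And>z \<zeta>. cmod z \<le> 1 \<Longrightarrow> cmod \<zeta> \<le> 1 \<Longrightarrow> cmod (pfun F x z \<zeta>) \<le> B"
proof
  show "(\<Sum>k\<in>F. cmod (coord x k)) \<ge> 0" by (intro sum_nonneg) simp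
  show "cmod (pfun F x z \<zeta>) \<le> (\<Sum>k\<in>F. cmod (coord x k))" if "cmod z \<le> 1" "cmod \<zeta> \<le> 1" for z \<zeta>
    unfolding pfun_def using that
    by (intro order_trans[OF norm_sum] sum_mono)
      (auto simp: norm_mult norm_power intro!: mult_left_le mult_le_one power_le_one)
qed

lemma pt_torus:
  assumes "cmod z = 1" "cmod \<zeta> = 1"
  shows "cmod (bpoly pt z \<zeta>) = cmod (bpoly p z \<zeta>)"
  using bpoly_reflect2_torus[OF deg assms] by (simp add: pt_def)

text \<open>Over a point \<tau> of the circle where the minorant does not vanish, p has no zeros in
  the closed disk and |pt / p| = 1 on the circle, so both slices have equal norm; where it vanishes
  both slices are 0. Averaging over \<tau> gives the equality.\<close>

lemma norm_mulT_minorant_trunc: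
  "norm (mulT (ract minorant (trunc F x))) = norm (ract minorant (trunc F x))"
proof -
  obtain B where B: "B \<ge> 0" "\<And>z \<zeta>. cmod z \<le> 1 \<Longrightarrow> cmod \<zeta> \<le> 1 \<Longrightarrow> cmod (pfun F x z \<zeta>) \<le> B"
    using pfun_bounded[of F x] by blast
  obtain G where G: "continuous_on (cball 0 1) G"
    "\<And>z \<zeta>. cmod z < 1 \<Longrightarrow> cmod \<zeta> \<le> 1 \<Longrightarrow> H1.ev (G \<zeta>) z = poly minorant \<zeta> * (bpoly pt z \<zeta> * pfun F x z \<zeta> / bpoly p z \<zeta>)"
  proof (rule quotient_slices[of "\<lambda>z \<zeta>. bpoly pt z \<zeta> * pfun F x z \<zeta>" B])
    show "cmod (bpoly pt z \<zeta> * pfun F x z \<zeta>) \<le> B * cmod (bpoly p z \<zeta>)"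
      if "cmod z \<le> 1" "cmod \<zeta> \<le> 1" for z \<zeta>
      using mult_mono[OF pt_le[OF that] B(2)[OF that]] by (simp add: norm_mult mult.commute)
  qed (auto intro!: continuous_intros holomorphic_intros)
  obtain G' where G': "continuous_on (cball 0 1) G'"
    "\<And>z \<zeta>. cmod z < 1 \<Longrightarrow> cmod \<zeta> \<le> 1 \<Longrightarrow> H1.ev (G' \<zeta>) z = poly minorant \<zeta> * pfun F x z \<zeta>"
    by (rule continuous_slices[of "\<lambda>z \<zeta>. poly minorant \<zeta> * pfun F x z \<zeta>"])
      (auto intro!: continuous_intros holomorphic_intros)
  have eq: "norm (G \<tau>) = norm (G' \<tau>)" if \<tau>: "cmod \<tau> = 1" for \<tau>
  proof (cases "poly minorant \<tau> = 0")
    case True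
    have "G \<tau> = G' \<tau>"
      by (rule H1.ev_eqI) (use True \<tau> in \<open>simp add: G G' D1_def\<close>)
    then show ?thesis by simp
  next
    case False
    have nz': "bpoly p z \<tau> \<noteq> 0" if "cmod z \<le> 1" for z using zero_free[OF False that] \<tau> by simp
    have "(\<lambda>K. circle_avg K (\<lambda>w. (cmod (poly minorant \<tau> * (bpoly pt w \<tau> * pfun F x w \<tau> / bpoly p w \<tau>)))\<^sup>2)) \<longlonglongrightarrow> (norm (G \<tau>))\<^sup>2"
      by (rule circle_avg_norm_scalar) (use nz' \<tau> in \<open>auto intro!: continuous_intros simp: G\<close>)
    moreover have "(\<lambda>K. circle_avg K (\<lambda>w. (cmod (poly minorant \<tau> * pfun F x w \<tau>))\<^sup>2)) \<longlonglongrightarrow> (norm (G' \<tau>))\<^sup>2"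
      by (rule circle_avg_norm_scalar) (use \<tau> in \<open>auto intro!: continuous_intros simp: G'\<close>)
    moreover have "circle_avg K (\<lambda>w. (cmod (poly minorant \<tau> * (bpoly pt w \<tau> * pfun F x w \<tau> / bpoly p w \<tau>)))\<^sup>2)
        = circle_avg K (\<lambda>w. (cmod (poly minorant \<tau> * pfun F x w \<tau>))\<^sup>2)" for K
      by (rule circle_avg_cong) (use nz' \<tau> in \<open>simp add: norm_mult norm_divide pt_torus\<close>)
    ultimately have "(norm (G \<tau>))\<^sup>2 = (norm (G' \<tau>))\<^sup>2" by (simp add: LIMSEQ_unique)
    then show ?thesis by (simp add: power2_eq_iff_nonneg)
  qed
  have "(\<lambda>K. circle_avg K (\<lambda>w. (norm (G w))\<^sup>2)) \<longlonglongrightarrow> (norm (mulT (ract minorant (trunc F x))))\<^sup>2"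
    by (rule circle_avg_norm_slices[OF G(1)]) (simp add: G(2) ev_mulT H2_ev_ract ev_trunc)
  moreover have "(\<lambda>K. circle_avg K (\<lambda>w. (norm (G' w))\<^sup>2)) \<longlonglongrightarrow> (norm (ract minorant (trunc F x)))\<^sup>2"
    by (rule circle_avg_norm_slices[OF G'(1)]) (simp add: G'(2) H2_ev_ract ev_trunc)
  moreover have "circle_avg K (\<lambda>w. (norm (G w))\<^sup>2) = circle_avg K (\<lambda>w. (norm (G' w))\<^sup>2)" for K
    by (rule circle_avg_cong) (simp add: eq)
  ultimately have "(norm (mulT (ract minorant (trunc F x))))\<^sup>2 = (norm (ract minorant (trunc F x)))\<^sup>2"
    by (simp add: LIMSEQ_unique)
  then show ?thesis by (simp add: power2_eq_iff_nonneg)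
qed

text \<open>Isometry passes from minorant multiples of polynomials to all minorant multiples by
  truncation, and to everything by density. Only the lower bound is at stake, since
  \<open>mulT\<close> is known to be a contraction.\<close>

lemma norm_mulT [simp]: "norm (mulT x) = norm x"
proof -
  note cts = bounded_linear.tendsto[OF bounded_linear_mulT] bounded_linear.tendsto[OF bounded_linear_act]
  have r: "norm (mulT (ract minorant y)) = norm (ract minorant y)" for y
  proof (rule tendsto_unique)
    show "((\<lambda>F. norm (mulT (ract minorant (trunc F y)))) \<longlongrightarrow> norm (mulT (ract minorant y))) (finite_subsets_at_top UNIV)"
      unfolding ract_def by (intro tendsto_norm cts tendsto_trunc)
    show "((\<lambda>F. norm (mulT (ract minorant (trunc F y)))) \<longlongrightarrow> norm (ract minorant y)) (finite_subsets_at_top UNIV)"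
      unfolding norm_mulT_minorant_trunc unfolding ract_def by (intro tendsto_norm cts tendsto_trunc)
  qed simp
  have "norm x \<le> norm (mulT x)"
  proof (rule field_le_epsilon)
    fix e :: real assume "e > 0"
    then obtain y where y: "norm (ract minorant y - x) < e / 2"
      using minorant_dense[of UNIV x "e / 2"] by (auto simp: csubspace_def)
    have "norm x \<le> norm (ract minorant y) + norm (ract minorant y - x)"
      by (metis norm_minus_commute norm_triangle_sub)
    also have "norm (ract minorant y) = norm (mulT x + mulT (ract minorant y - x))"
      by (simp add: r[symmetric] mulT_diff)
    also have "\<dots> \<le> norm (mulT x) + norm (ract minorant y - x)"
      by (rule order_trans[OF norm_triangle_ineq]) (simp add: norm_mulT_le)
    finally show "norm x \<le> norm (mulT x) + e" using y by simp
  qed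
  then show ?thesis using norm_mulT_le[of x] by simp
qed

end

section \<open>Model spaces\<close>

lemma act_cong: "(\<And>a. a \<in> I \<Longrightarrow> c a = d a) \<Longrightarrow> act I c = act I d"
  by (auto simp: act_def intro!: sum.cong)

text \<open>Nonnegativity on a subspace says that its numerical range lies in the half plane
  \<open>inner a w \<ge> b\<close>. Being homogeneous and continuous in h, the condition survives
  limits of vectors that are not normalized.\<close>

definition form :: "'k::cancel_comm_monoid_add \<Rightarrow> complex \<Rightarrow> real \<Rightarrow> 'k ell2 \<Rightarrow> real" where
  "form e a b h = inner a (cinner (shift e h) h) - b * (norm h)\<^sup>2"

abbreviation form1 :: "complex \<Rightarrow> real \<Rightarrow> nat ell2 \<Rightarrow> real" where
  "form1 \<equiv> form 1"

abbreviation form2 :: "complex \<Rightarrow> real \<Rightarrow> (nat \<times> nat) ell2 \<Rightarrow> real" where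
  "form2 \<equiv> form (1, 0)"

lemma form_scaleC: "form e a b (c *\<^sub>C h) = (cmod c)\<^sup>2 * form e a b h"
proof -
  have "cinner (shift e (c *\<^sub>C h)) (c *\<^sub>C h) = (cmod c)\<^sup>2 *\<^sub>R cinner (shift e h) h"
    by (simp add: shift_scaleC cinner_scaleC_left cinner_scaleC_right scaleR_conv_of_real
        complex_norm_square mult_ac del: of_real_power)
  then show ?thesis by (simp add: form_def power_mult_distrib algebra_simps)
qed

lemma form_shift: "form e a b (shift k f) = form e a b f"
proof -
  have "shift e (shift k f) = shift k (shift e f)" by (simp add: shift_shift add.commute)
  then show ?thesis by (simp add: form_def)
qed

lemma tendsto_form: "(f \<longlongrightarrow> l) F \<Longrightarrow> ((\<lambda>x. form e a b (f x)) \<longlongrightarrow> form e a b l) F"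
  unfolding form_def by (intro tendsto_intros)

lemma continuous_on_form: "continuous_on S f \<Longrightarrow> continuous_on S (\<lambda>x. form e a b (f x))"
  unfolding form_def by (intro continuous_intros)

lemma form_nonneg_closure:
  assumes "\<And>e. e > 0 \<Longrightarrow> \<exists>x. norm (x - y) < e \<and> form c a b x \<ge> 0"
  shows "form c a b y \<ge> 0"
proof -
  have "\<exists>x. norm (x - y) < 1 / real (Suc n) \<and> form c a b x \<ge> 0" for n
    by (rule assms) simp
  then obtain X where X: "\<And>n. norm (X n - y) < 1 / real (Suc n)" "\<And>n. form c a b (X n) \<ge> 0" by metis
  have "(\<lambda>n. X n - y) \<longlonglongrightarrow> 0"
    by (rule Lim_null_comparison[OF _ LIMSEQ_inverse_real_of_nat])
      (use X(1) in \<open>auto simp: inverse_eq_divide intro!: always_eventually less_imp_le\<close>)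
  then have "X \<longlonglongrightarrow> y" by (rule LIM_zero_cancel)
  then have "(\<lambda>n. form c a b (X n)) \<longlonglongrightarrow> form c a b y" by (rule tendsto_form)
  then show ?thesis using X(2) by (intro LIMSEQ_le_const) auto
qed

text \<open>Multiplication by z1 acts inside each slice, so the form of a function is the limit of
  the means of the forms of its boundary slices.\<close>

lemma circle_avg_form:
  assumes G: "continuous_on (cball 0 1) G"
    and ev: "\<And>z \<zeta>. cmod z < 1 \<Longrightarrow> cmod \<zeta> < 1 \<Longrightarrow> H1.ev (G \<zeta>) z = H2.ev F (z, \<zeta>)"
  shows "(\<lambda>K. circle_avg K (\<lambda>w. form1 a b (G w))) \<longlonglongrightarrow> form2 a b F"
proof -
  have inner_avg: "circle_avg K (\<lambda>w. inner a (g w)) = inner a (circle_avg K g)" for K g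
    by (simp add: circle_avg_def inner_sum_right)
  have ev': "H1.ev (shift 1 (G \<zeta>)) z = H2.ev (shift (1, 0) F) (z, \<zeta>)" if "cmod z < 1" "cmod \<zeta> < 1" for z \<zeta>
    using that ev[OF that] H1.ev_shift[of z 1 "G \<zeta>"] by (simp add: H2_ev_shift D1_def mono1_def)
  show ?thesis
    unfolding form_def circle_avg_diff inner_avg circle_avg_cmult
    by (intro tendsto_intros circle_avg_cinner_slices circle_avg_norm_slices continuous_intros G ev ev')
qed

context rational_inner
begin

section \<open>Model spaces described through the product with the denominator\<close>

definition model :: "(nat \<times> nat) ell2 set" where
  "model = {x. \<forall>u. cinner x (mulT u) = 0}"

definition model_inf :: "(nat \<times> nat) ell2 set" where
  "model_inf = {x. \<forall>k. shift (0, k) x \<in> model}"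

lemma csubspace_model: "csubspace model"
  by (auto simp: csubspace_def model_def cinner_add_left cinner_scaleC_left)

lemma csubspace_model_inf: "csubspace model_inf"
  using csubspace_model by (auto simp: csubspace_def model_inf_def shift_add shift_scaleC)
    (metis bounded_linear.linear bounded_linear_shift linear_0)

lemma shift_model_inf: "x \<in> model_inf \<Longrightarrow> shift (0, j) x \<in> model_inf"
  by (simp add: model_inf_def shift_shift)

text \<open>Multiplication by the slice of \<Theta> at \<tau>; the choice is justified where the
  minorant does not vanish, that is, where p(., \<tau>) has no zeros in the closed disk.\<close>

definition mult1 :: "complex \<Rightarrow> nat ell2 \<Rightarrow> nat ell2" where
  "mult1 \<tau> u = (SOME v. \<forall>z. cmod z < 1 \<longrightarrow> H1.ev v z = bpoly pt z \<tau> / bpoly p z \<tau> * H1.ev u z)"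

definition model1 :: "complex \<Rightarrow> nat ell2 set" where
  "model1 \<tau> = {x. \<forall>u. cinner x (mult1 \<tau> u) = 0}"

definition pact1 :: "complex \<Rightarrow> nat ell2 \<Rightarrow> nat ell2" where
  "pact1 \<tau> = act {..m} (\<lambda>i. poly (coeff p i) \<tau>)"

definition ptact1 :: "complex \<Rightarrow> nat ell2 \<Rightarrow> nat ell2" where
  "ptact1 \<tau> = act {..m} (\<lambda>i. poly (coeff pt i) \<tau>)"

lemma ev_pact1: "cmod z < 1 \<Longrightarrow> H1.ev (pact1 \<tau> x) z = bpoly p z \<tau> * H1.ev x z"
  using H1.ev_act[of z] by (simp add: pact1_def D1_def mono1_def bpoly_eq_sum1[OF deg(1)])

lemma ev_ptact1: "cmod z < 1 \<Longrightarrow> H1.ev (ptact1 \<tau> x) z = bpoly pt z \<tau> * H1.ev x z"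
  using H1.ev_act[of z] by (simp add: ptact1_def D1_def mono1_def pt_def bpoly_eq_sum1[OF deg1_reflect2])

lemma H1_eqI: "(\<And>z. cmod z < 1 \<Longrightarrow> H1.ev x z = H1.ev y z) \<Longrightarrow> x = y"
  by (rule H1.ev_eqI) (simp add: D1_def)

lemma ev_mult1:
  assumes \<tau>: "cmod \<tau> \<le> 1" "poly minorant \<tau> \<noteq> 0" and z: "cmod z < 1"
  shows "H1.ev (mult1 \<tau> u) z = bpoly pt z \<tau> / bpoly p z \<tau> * H1.ev u z"
proof -
  have nz': "bpoly p z \<tau> \<noteq> 0" if "cmod z \<le> 1" for z using zero_free[OF \<tau>(2) that \<tau>(1)] .
  have "(\<lambda>z. bpoly pt z \<tau> / bpoly p z \<tau> * H1.ev u z) holomorphic_on ball 0 1"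
    using nz' by (intro holomorphic_intros H1_ev_holomorphic) auto
  then have "\<exists>v. \<forall>z. cmod z < 1 \<longrightarrow> H1.ev v z = bpoly pt z \<tau> / bpoly p z \<tau> * H1.ev u z"
  proof (rule H1_majorized[of _ 1 u])
    fix z :: complex assume z: "cmod z < 1"
    then have "cmod (bpoly pt z \<tau> / bpoly p z \<tau>) \<le> 1"
      using pt_le[of z \<tau>] \<tau> nz'[of z] by (simp add: norm_divide)
    from mult_right_mono[OF this norm_ge_zero[of "H1.ev u z"]]
    show "cmod (bpoly pt z \<tau> / bpoly p z \<tau> * H1.ev u z) \<le> 1 * cmod (H1.ev u z)"
      by (simp only: norm_mult)
  qed auto
  from someI_ex[OF this, folded mult1_def] show ?thesis using z by blast
qed

text \<open>Since the conjugate of \<tau> is 1/\<tau>, the slice of the two-variable reflection is,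
  up to the factor \<tau>^n, the one-variable reflection of degree m of the slice of p.\<close>

lemma coeff_pt1:
  assumes "cmod \<tau> = 1" "i \<le> m"
  shows "poly (coeff pt i) \<tau> = \<tau> ^ n * cnj (poly (coeff p (m - i)) \<tau>)"
proof -
  have c1: "\<tau> * cnj \<tau> = 1" using assms by (simp add: complex_norm_square[symmetric])
  have inv: "\<tau> ^ n * cnj \<tau> ^ k = \<tau> ^ (n - k)" if "k \<le> n" for k
  proof -
    have "\<tau> ^ k * cnj \<tau> ^ k = 1" using c1 by (simp flip: power_mult_distrib)
    moreover have "\<tau> ^ n = \<tau> ^ (n - k) * \<tau> ^ k" using that by (simp flip: power_add)
    ultimately show ?thesis by (simp add: mult.assoc)
  qed
  have dp: "degree (coeff p k) \<le> n" for k using degree_coeff_le_deg2[of p k] deg by linarith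
  have dt: "degree (coeff pt k) \<le> n" for k
    using degree_coeff_le_deg2[of pt k] deg2_reflect2[of m n p] by (simp add: pt_def)
  have "\<tau> ^ n * cnj (poly (coeff p (m - i)) \<tau>) = (\<Sum>j\<le>n. cnj (coeff (coeff p (m - i)) j) * \<tau> ^ (n - j))"
    unfolding poly_eq_sum_atMost[OF dp]
    by (simp add: sum_distrib_left) (intro sum.cong refl, simp add: inv[symmetric] mult_ac)
  also have "\<dots> = (\<Sum>j\<le>n. cnj (coeff (coeff p (m - i)) (n - j)) * \<tau> ^ j)"
    by (rule sum.reindex_bij_witness[of _ "\<lambda>j. n - j" "\<lambda>j. n - j"]) auto
  also have "\<dots> = poly (coeff pt i) \<tau>"
    unfolding poly_eq_sum_atMost[OF dt] by (simp add: coeff_pt assms)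
  finally show ?thesis by simp
qed

lemma cinner_ptact1:
  assumes "cmod \<tau> = 1"
  shows "cinner x (ptact1 \<tau> v) = cnj (\<tau> ^ n) * cinner (bshift m (pact1 \<tau> x)) v"
proof -
  have "ptact1 \<tau> = act {..m} (\<lambda>a. \<tau> ^ n * cnj (poly (coeff p (m - a)) \<tau>))"
    unfolding ptact1_def by (rule act_cong) (simp add: coeff_pt1 assms)
  then show ?thesis
    using cinner_act_reflect[of "{..m}" "\<lambda>a. m - a" m x "\<tau> ^ n" "\<lambda>a. poly (coeff p a) \<tau>" v]
    by (simp add: pact1_def)
qed

text \<open>Here 1 / p(., \<tau>) is bounded, so the multiples of the slice of \<Theta> are those of
  pt(., \<tau>), and moving pt to the other side leaves p followed by a backward shift by m. The
  model space thus consists of polynomials of degree below m divided by p(., \<tau>).\<close>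

lemma model1_iff:
  assumes \<tau>: "cmod \<tau> = 1" "poly minorant \<tau> \<noteq> 0"
  shows "x \<in> model1 \<tau> \<longleftrightarrow> (\<forall>l. coord (pact1 \<tau> x) (m + l) = 0)"
proof
  assume x: "x \<in> model1 \<tau>"
  have nz': "bpoly p z \<tau> \<noteq> 0" if "cmod z \<le> 1" for z using zero_free[OF \<tau>(2) that] \<tau>(1) by simp
  show "\<forall>l. coord (pact1 \<tau> x) (m + l) = 0"
  proof
    fix l
    have "mult1 \<tau> (pact1 \<tau> (basis l)) = ptact1 \<tau> (basis l)"
      by (rule H1_eqI) (simp add: ev_mult1 \<tau> ev_pact1 ev_ptact1 nz')
    then have "cinner x (ptact1 \<tau> (basis l)) = 0" using x by (metis (mono_tags, lifting) mem_Collect_eq model1_def)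
    then show "coord (pact1 \<tau> x) (m + l) = 0" using \<tau>(1) by (auto simp: cinner_ptact1)
  qed
next
  assume x: "\<forall>l. coord (pact1 \<tau> x) (m + l) = 0"
  have nz': "bpoly p z \<tau> \<noteq> 0" if "cmod z \<le> 1" for z using zero_free[OF \<tau>(2) that] \<tau>(1) by simp
  obtain C where C: "C \<ge> 0"
    "\<And>z \<zeta>. cmod z \<le> 1 \<Longrightarrow> cmod \<zeta> \<le> 1 \<Longrightarrow> cmod (poly minorant \<zeta>) \<le> C * cmod (bpoly p z \<zeta>)"
    using minorant_bound by blast
  have bs: "bshift m (pact1 \<tau> x) = 0" by (rule ell2_eqI) (use x in simp)
  have "cinner x (mult1 \<tau> u) = 0" for u
  proof -
    have "(\<lambda>z. H1.ev u z / bpoly p z \<tau>) holomorphic_on ball 0 1"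
      using nz' by (intro holomorphic_intros H1_ev_holomorphic) auto
    then have "\<exists>v. \<forall>z. cmod z < 1 \<longrightarrow> H1.ev v z = H1.ev u z / bpoly p z \<tau>"
    \<comment> \<open>The constant bounds 1 / |p(z, \<tau>)|: it is the minorant inequality divided
      by the nonzero value at \<tau>.\<close>
    proof (rule H1_majorized[of _ "C / cmod (poly minorant \<tau>)" u])
      fix z :: complex assume z: "cmod z < 1"
      have "cmod (poly minorant \<tau>) \<le> C * cmod (bpoly p z \<tau>)" using C(2)[of z \<tau>] z \<tau> by simp
      then have "1 / cmod (bpoly p z \<tau>) \<le> C / cmod (poly minorant \<tau>)"
        using \<tau>(2) nz'[of z] z by (simp add: field_simps)
      from mult_right_mono[OF this norm_ge_zero[of "H1.ev u z"]]
      show "cmod (H1.ev u z / bpoly p z \<tau>) \<le> C / cmod (poly minorant \<tau>) * cmod (H1.ev u z)"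
        by (simp add: norm_divide)
    qed (use C(1) in auto)
    then obtain v where v: "\<And>z. cmod z < 1 \<Longrightarrow> H1.ev v z = H1.ev u z / bpoly p z \<tau>" by blast
    have "mult1 \<tau> u = ptact1 \<tau> v"
      by (rule H1_eqI) (simp add: ev_mult1 \<tau> ev_ptact1 v)
    then show ?thesis by (simp add: cinner_ptact1 \<tau> bs)
  qed
  then show "x \<in> model1 \<tau>" by (simp add: model1_def)
qed

lemma cinner_ptact: "cinner x (ptact v) = cinner (bshift (m, n) (pact x)) v"
proof -
  have "ptact = act ({..m} \<times> {..n}) (\<lambda>a. 1 * cnj (coeff (coeff p (fst (m - fst a, n - snd a))) (snd (m - fst a, n - snd a))))"
    unfolding ptact_def by (rule act_cong) (auto simp: coeff_pt)
  then show ?thesis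
    using cinner_act_reflect[of "{..m} \<times> {..n}" "\<lambda>a. (m - fst a, n - snd a)" "(m, n)" x 1
        "\<lambda>a. coeff (coeff p (fst a)) (snd a)" v]
    by (auto simp: pact_def)
qed

section \<open>From the slices to the bidisk\<close>

text \<open>Orthogonality of f alone would only remove coefficients of p f with both exponents
  large. Shifting by z2^n beforehand compensates the backward shift by n, so the exponent of z2
  becomes arbitrary.\<close>

lemma coord_pact_model_inf:
  assumes f: "f \<in> model_inf"
  shows "coord (pact f) (m + l, j) = 0"
proof -
  have "shift (0, n) f \<in> model" using f by (simp add: model_inf_def)
  then have "cinner (shift (0, n) f) (mulT (pact (basis (l, j)))) = 0" by (simp add: model_def)
  then have "coord (pact (shift (0, n) f)) ((0, n) + (m + l, j)) = 0"
    by (simp add: mulT_pact cinner_ptact)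
  then show ?thesis unfolding pact_def act_shift coord_shift .
qed

text \<open>The elements whose slices are continuous up to the boundary; the square of the minorant
  compensates the zeros of the denominator.\<close>

definition nice :: "(nat \<times> nat) set \<Rightarrow> (nat \<times> nat) ell2 \<Rightarrow> (nat \<times> nat) ell2" where
  "nice F x = ract minorant (mulR (trunc F x))"

lemma ev_nice:
  assumes "cmod z < 1" "cmod \<zeta> < 1"
  shows "H2.ev (nice F x) (z, \<zeta>) = poly minorant \<zeta> * (poly minorant \<zeta> * pfun F x z \<zeta> / bpoly p z \<zeta>)"
  by (simp add: nice_def H2_ev_ract ev_mulR ev_trunc assms)

text \<open>One factor of the minorant makes the quotient by p bounded, the second makes it
  continuous up to the boundary. Multiplied by p, a boundary slice is a polynomial of degree below
  m, which is the criterion of \<open>model1_iff\<close>.\<close>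

lemma nice_slices:
  assumes F: "finite F" and x: "\<And>l j. coord x (m + l, j) = 0"
  obtains G where "continuous_on (cball 0 1) G"
    "\<And>z \<zeta>. cmod z < 1 \<Longrightarrow> cmod \<zeta> \<le> 1 \<Longrightarrow> H1.ev (G \<zeta>) z = poly minorant \<zeta> * (poly minorant \<zeta> * pfun F x z \<zeta> / bpoly p z \<zeta>)"
    "\<And>\<tau>. cmod \<tau> \<le> 1 \<Longrightarrow> poly minorant \<tau> = 0 \<Longrightarrow> G \<tau> = 0"
    "\<And>\<tau>. cmod \<tau> = 1 \<Longrightarrow> poly minorant \<tau> \<noteq> 0 \<Longrightarrow> G \<tau> \<in> model1 \<tau>"
proof -
  obtain C where C: "C \<ge> 0"
    "\<And>z \<zeta>. cmod z \<le> 1 \<Longrightarrow> cmod \<zeta> \<le> 1 \<Longrightarrow> cmod (poly minorant \<zeta>) \<le> C * cmod (bpoly p z \<zeta>)"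
    using minorant_bound by blast
  obtain B where B: "B \<ge> 0" "\<And>z \<zeta>. cmod z \<le> 1 \<Longrightarrow> cmod \<zeta> \<le> 1 \<Longrightarrow> cmod (pfun F x z \<zeta>) \<le> B"
    using pfun_bounded[of F x] by blast
  obtain G where G: "continuous_on (cball 0 1) G"
    "\<And>z \<zeta>. cmod z < 1 \<Longrightarrow> cmod \<zeta> \<le> 1 \<Longrightarrow> H1.ev (G \<zeta>) z = poly minorant \<zeta> * (poly minorant \<zeta> * pfun F x z \<zeta> / bpoly p z \<zeta>)"
  proof (rule quotient_slices[of "\<lambda>z \<zeta>. poly minorant \<zeta> * pfun F x z \<zeta>" "B * C"])
    show "cmod (poly minorant \<zeta> * pfun F x z \<zeta>) \<le> B * C * cmod (bpoly p z \<zeta>)"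
      if "cmod z \<le> 1" "cmod \<zeta> \<le> 1" for z \<zeta>
      using mult_mono[OF B(2)[OF that] C(2)[OF that]] B(1) by (simp add: norm_mult mult_ac)
  qed (auto intro!: continuous_intros holomorphic_intros)
  have "G \<tau> = 0" if "cmod \<tau> \<le> 1" "poly minorant \<tau> = 0" for \<tau>
    by (rule H1_eqI) (use that in \<open>simp add: G\<close>)
  moreover have "G \<tau> \<in> model1 \<tau>" if \<tau>: "cmod \<tau> = 1" "poly minorant \<tau> \<noteq> 0" for \<tau>
  proof -
    have nz': "bpoly p z \<tau> \<noteq> 0" if "cmod z \<le> 1" for z using zero_free[OF \<tau>(2) that] \<tau>(1) by simp
    define v where "v = (\<Sum>k\<in>F. ((poly minorant \<tau>)\<^sup>2 * coord x k * \<tau> ^ snd k) *\<^sub>C basis (fst k))"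
    have "pact1 \<tau> (G \<tau>) = v"
    proof (rule H1_eqI)
      fix z :: complex assume z: "cmod z < 1"
      then have "z \<in> D1" by (simp add: D1_def)
      then have "H1.ev v z = (poly minorant \<tau>)\<^sup>2 * pfun F x z \<tau>"
        by (simp add: v_def H1.ev_sum H1.ev_basis pfun_def mono1_def sum_distrib_left mult_ac)
      then show "H1.ev (pact1 \<tau> (G \<tau>)) z = H1.ev v z"
        using z \<tau> nz'[of z] by (simp add: ev_pact1 G power2_eq_square)
    qed
    moreover have "coord v (m + l) = 0" for l
      unfolding v_def coord_sum
    proof (rule sum.neutral, rule ballI)
      fix k assume "k \<in> F"
      show "coord (((poly minorant \<tau>)\<^sup>2 * coord x k * \<tau> ^ snd k) *\<^sub>C basis (fst k)) (m + l) = 0"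
        using x[of l "snd k"] by (auto simp: coord_basis)
    qed
    ultimately show ?thesis by (simp add: model1_iff \<tau>)
  qed
  ultimately show thesis using that G by blast
qed

text \<open>Truncating f could leave the model space, whereas truncating p f keeps its z1-degree
  below m. Dividing by p again costs two minorant factors, which density removes.\<close>

lemma form2_nonneg_model_inf:
  assumes pos: "\<And>\<tau> h. cmod \<tau> = 1 \<Longrightarrow> poly minorant \<tau> \<noteq> 0 \<Longrightarrow> h \<in> model1 \<tau> \<Longrightarrow> form1 a b h \<ge> 0"
    and f: "f \<in> model_inf"
  shows "form2 a b f \<ge> 0"
proof -
  have nice: "form2 a b (nice F x) \<ge> 0" if F: "finite F" and x: "\<And>l j. coord x (m + l, j) = 0" for F x
  proof -
    obtain G where G: "continuous_on (cball 0 1) G"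
      "\<And>z \<zeta>. cmod z < 1 \<Longrightarrow> cmod \<zeta> \<le> 1 \<Longrightarrow> H1.ev (G \<zeta>) z = poly minorant \<zeta> * (poly minorant \<zeta> * pfun F x z \<zeta> / bpoly p z \<zeta>)"
      "\<And>\<tau>. cmod \<tau> \<le> 1 \<Longrightarrow> poly minorant \<tau> = 0 \<Longrightarrow> G \<tau> = 0"
      "\<And>\<tau>. cmod \<tau> = 1 \<Longrightarrow> poly minorant \<tau> \<noteq> 0 \<Longrightarrow> G \<tau> \<in> model1 \<tau>"
      using nice_slices[of F x, OF F x] by blast
    have "(\<lambda>K. circle_avg K (\<lambda>w. form1 a b (G w))) \<longlonglongrightarrow> form2 a b (nice F x)"
      by (rule circle_avg_form[OF G(1)]) (simp add: G(2) ev_nice)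
    moreover have "circle_avg K (\<lambda>w. form1 a b (G w)) \<ge> circle_avg K (\<lambda>w. 0)" for K
    proof (rule circle_avg_mono)
      fix \<tau> :: complex assume "cmod \<tau> = 1"
      then show "form1 a b (G \<tau>) \<ge> 0"
        using pos[of \<tau>] G(3)[of \<tau>] G(4)[of \<tau>] by (cases "poly minorant \<tau> = 0") (auto simp: form_def)
    qed
    ultimately show ?thesis by (intro LIMSEQ_le_const[of _ _ 0]) (auto simp: circle_avg_def)
  qed
  have rr: "form2 a b (ract minorant (ract minorant g)) \<ge> 0" if g: "g \<in> model_inf" for g
  proof -
    have eq: "ract minorant (mulR (pact g)) = ract minorant (ract minorant g)"
      by (rule H2_eqI) (simp add: H2_ev_ract ev_mulR ev_pact nz)
    have "((\<lambda>F. nice F (pact g)) \<longlongrightarrow> ract minorant (mulR (pact g))) (finite_subsets_at_top UNIV)"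
      unfolding nice_def ract_def
      by (intro tendsto_act bounded_linear.tendsto[OF bounded_linear_mulR] tendsto_trunc)
    from tendsto_form[OF this, of "(1, 0)" a b] show ?thesis
      unfolding eq
      by (rule tendsto_lowerbound)
        (auto intro!: eventually_finite_subsets_at_top_weakI nice coord_pact_model_inf[OF g] simp del: One_nat_def)
  qed
  \<comment> \<open>Strips one minorant factor; it is applied with q the minorant and afterwards
    with q = 1.\<close>
  have cont: "form2 a b (ract q y) \<ge> 0"
    if pos': "\<And>x. x \<in> model_inf \<Longrightarrow> form2 a b (ract q (ract minorant x)) \<ge> 0" and y: "y \<in> model_inf" for q y
  proof (rule form_nonneg_closure)
    fix e :: real assume e: "e > 0"
    obtain K where K: "K > 0" "\<And>v. norm (ract q v) \<le> norm v * K"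
      using bounded_linear.pos_bounded[OF bounded_linear_act] unfolding ract_def by blast
    obtain x where x: "x \<in> model_inf" "norm (ract minorant x - y) < e / K"
      using minorant_dense[OF csubspace_model_inf shift_model_inf y, of "e / K"] e K(1) by auto
    have "norm (ract q (ract minorant x) - ract q y) \<le> norm (ract minorant x - y) * K"
      using K(2)[of "ract minorant x - y"]
      unfolding ract_def by (simp add: linear_diff[OF bounded_linear.linear[OF bounded_linear_act]])
    also have "\<dots> < e" using x(2) K(1) by (simp add: field_simps)
    finally show "\<exists>x. norm (x - ract q y) < e \<and> form2 a b x \<ge> 0" using pos'[OF x(1)] by blast
  qed
  have one: "ract 1 y = y" for y by (rule H2_eqI) (simp add: H2_ev_ract)
  have r1: "form2 a b (ract minorant y) \<ge> 0" if "y \<in> model_inf" for y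
    using cont[OF rr that] .
  have "form2 a b (ract 1 f) \<ge> 0" by (rule cont[OF _ f]) (simp only: one r1)
  then show ?thesis by (simp only: one)
qed

end

section \<open>From the bidisk to the slices\<close>

context rational_inner
begin

text \<open>Inner products over the bidisk are limits of means of inner products of slices, and
  multiplication by z2^k merely multiplies the slice at w by the scalar w^k, so orthogonality within
  each slice suffices.\<close>

lemma nice_in_model_inf:
  assumes F: "finite F" and x: "\<And>l j. coord x (m + l, j) = 0"
  shows "nice F x \<in> model_inf"
proof -
  obtain G where G: "continuous_on (cball 0 1) G"
    "\<And>z \<zeta>. cmod z < 1 \<Longrightarrow> cmod \<zeta> \<le> 1 \<Longrightarrow> H1.ev (G \<zeta>) z = poly minorant \<zeta> * (poly minorant \<zeta> * pfun F x z \<zeta> / bpoly p z \<zeta>)"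
    "\<And>\<tau>. cmod \<tau> \<le> 1 \<Longrightarrow> poly minorant \<tau> = 0 \<Longrightarrow> G \<tau> = 0"
    "\<And>\<tau>. cmod \<tau> = 1 \<Longrightarrow> poly minorant \<tau> \<noteq> 0 \<Longrightarrow> G \<tau> \<in> model1 \<tau>"
    using nice_slices[of F x, OF F x] by blast
  have fin: "cinner (shift (0, k) (nice F x)) (mulT (ract minorant (trunc F' u))) = 0" for k F' u
  proof -
    obtain B where B: "B \<ge> 0" "\<And>z \<zeta>. cmod z \<le> 1 \<Longrightarrow> cmod \<zeta> \<le> 1 \<Longrightarrow> cmod (pfun F' u z \<zeta>) \<le> B"
      using pfun_bounded[of F' u] by blast
    obtain H where H: "continuous_on (cball 0 1) H"
      "\<And>z \<zeta>. cmod z < 1 \<Longrightarrow> cmod \<zeta> \<le> 1 \<Longrightarrow> H1.ev (H \<zeta>) z = poly minorant \<zeta> * (bpoly pt z \<zeta> * pfun F' u z \<zeta> / bpoly p z \<zeta>)"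
    proof (rule quotient_slices[of "\<lambda>z \<zeta>. bpoly pt z \<zeta> * pfun F' u z \<zeta>" B])
      show "cmod (bpoly pt z \<zeta> * pfun F' u z \<zeta>) \<le> B * cmod (bpoly p z \<zeta>)"
        if "cmod z \<le> 1" "cmod \<zeta> \<le> 1" for z \<zeta>
        using mult_mono[OF pt_le[OF that] B(2)[OF that]] by (simp add: norm_mult mult.commute)
    qed (auto intro!: continuous_intros holomorphic_intros)
    have orth: "cinner (w ^ k *\<^sub>C G w) (H w) = 0" if w: "cmod w = 1" for w
    proof (cases "poly minorant w = 0")
      case False
      \<comment> \<open>The slice at w of the minorant times the truncation of u; multiplying it by
        the slice of \<Theta> gives \<open>H w\<close>.\<close>
      define v where "v = (\<Sum>i\<in>F'. (poly minorant w * coord u i * w ^ snd i) *\<^sub>C basis (fst i))"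
      have "mult1 w v = H w"
      proof (rule H1_eqI)
        fix z :: complex assume z: "cmod z < 1"
        then have "z \<in> D1" by (simp add: D1_def)
        then have "H1.ev v z = poly minorant w * pfun F' u z w"
          by (simp add: v_def H1.ev_sum H1.ev_basis pfun_def mono1_def sum_distrib_left mult_ac)
        then show "H1.ev (mult1 w v) z = H1.ev (H w) z"
          using z w False by (simp add: ev_mult1 H)
      qed
      moreover have "cinner (G w) (mult1 w v) = 0" using G(4)[OF w False] by (simp add: model1_def)
      ultimately show ?thesis by (simp add: cinner_scaleC_left)
    qed (simp add: G(3) w)
    have "(\<lambda>K. circle_avg K (\<lambda>w. cinner (w ^ k *\<^sub>C G w) (H w)))
        \<longlonglongrightarrow> cinner (shift (0, k) (nice F x)) (mulT (ract minorant (trunc F' u)))"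
      by (rule circle_avg_cinner_slices)
        (auto intro!: continuous_intros G(1) H(1) simp: G(2) H(2) H2_ev_shift ev_nice ev_mulT H2_ev_ract ev_trunc)
    moreover have "circle_avg K (\<lambda>w. cinner (w ^ k *\<^sub>C G w) (H w)) = 0" for K
      using circle_avg_cong[OF orth] by (simp add: circle_avg_def)
    ultimately show ?thesis by (simp add: LIMSEQ_const_iff)
  qed
  have r: "cinner (shift (0, k) (nice F x)) (mulT (ract minorant u)) = 0" for k u
  proof (rule tendsto_unique)
    show "((\<lambda>F'. cinner (shift (0, k) (nice F x)) (mulT (ract minorant (trunc F' u)))) \<longlongrightarrow>
        cinner (shift (0, k) (nice F x)) (mulT (ract minorant u))) (finite_subsets_at_top UNIV)"
      unfolding ract_def
      by (intro tendsto_cinner tendsto_const bounded_linear.tendsto[OF bounded_linear_mulT] tendsto_act tendsto_trunc)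
    show "((\<lambda>F'. cinner (shift (0, k) (nice F x)) (mulT (ract minorant (trunc F' u)))) \<longlongrightarrow> 0) (finite_subsets_at_top UNIV)"
      by (simp add: fin)
  qed simp
  have "cinner (shift (0, k) (nice F x)) (mulT u) = 0" for k u
  proof -
    have "cmod (cinner (shift (0, k) (nice F x)) (mulT u)) \<le> 0 + e" if e: "e > 0" for e
    proof -
      define M where "M = norm (nice F x) + 1"
      have M: "M > 0" by (simp add: M_def add_nonneg_pos)
      obtain v where v: "norm (ract minorant v - u) < e / M"
        using minorant_dense[of UNIV u "e / M"] e M by (auto simp: csubspace_def)
      have "cinner (shift (0, k) (nice F x)) (mulT u) = - cinner (shift (0, k) (nice F x)) (mulT (ract minorant v - u))"
        by (simp add: mulT_diff cinner_diff_right r)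
      then have "cmod (cinner (shift (0, k) (nice F x)) (mulT u)) \<le> norm (nice F x) * norm (ract minorant v - u)"
        using cinner_bound[of "shift (0, k) (nice F x)" "mulT (ract minorant v - u)"] by simp
      also have "\<dots> \<le> M * (e / M)" using v by (intro mult_mono) (auto simp: M_def)
      finally show ?thesis using M by simp
    qed
    then have "cmod (cinner (shift (0, k) (nice F x)) (mulT u)) \<le> 0" by (rule field_le_epsilon)
    then show ?thesis by simp
  qed
  then show ?thesis by (simp add: model_inf_def model_def)
qed

text \<open>Multiplying a function in the first variable by Fejer-type polynomials in the second one
  concentrates it on a single slice.\<close>

lemma form1_nonneg_model1:
  assumes pos: "\<And>f. f \<in> model_inf \<Longrightarrow> form2 a b f \<ge> 0"
    and \<tau>: "cmod \<tau> = 1" "poly minorant \<tau> \<noteq> 0" and h: "h \<in> model1 \<tau>"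
  shows "form1 a b h \<ge> 0"
proof -
  define F where "F = {..<m} \<times> {0::nat}"
  \<comment> \<open>The polynomial p(., \<tau>) h of degree below m, regarded as constant in z2:
    then \<open>nice F x\<close> lies in \<open>model_inf\<close>, and its slice at \<tau> is a
    nonzero multiple of h.\<close>
  define x where "x = (\<Sum>i<m. coord (pact1 \<tau> h) i *\<^sub>C basis (i, 0::nat))"
  have F: "finite F" by (simp add: F_def)
  have cx: "coord x (i, j) = (if i < m \<and> j = 0 then coord (pact1 \<tau> h) i else 0)" for i j
  proof -
    have "coord x (i, j) = (\<Sum>k<m. if k = i then (if j = 0 then coord (pact1 \<tau> h) i else 0) else 0)"
      unfolding x_def coord_sum by (intro sum.cong) (auto simp: coord_basis)
    then show ?thesis by simp
  qed
  have cx0: "coord x (m + l, j) = 0" for l j by (simp add: cx)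
  obtain G where G: "continuous_on (cball 0 1) G"
    "\<And>z \<zeta>. cmod z < 1 \<Longrightarrow> cmod \<zeta> \<le> 1 \<Longrightarrow> H1.ev (G \<zeta>) z = poly minorant \<zeta> * (poly minorant \<zeta> * pfun F x z \<zeta> / bpoly p z \<zeta>)"
    by (rule nice_slices[of F x, OF F cx0]) (rule that, assumption, simp)
  have nice: "nice F x \<in> model_inf" by (rule nice_in_model_inf[OF F]) (simp add: cx)
  have G\<tau>: "G \<tau> = ((poly minorant \<tau>)\<^sup>2) *\<^sub>C h"
  proof (rule H1_eqI)
    fix z :: complex assume z: "cmod z < 1"
    have nz': "bpoly p z \<tau> \<noteq> 0" using zero_free[OF \<tau>(2)] z \<tau>(1) by simp
    have "(\<lambda>i. coord (pact1 \<tau> h) i * z ^ i) sums (\<Sum>i<m. coord (pact1 \<tau> h) i * z ^ i)"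
    proof (rule sums_finite)
      fix i assume "i \<notin> {..<m}"
      then have "coord (pact1 \<tau> h) (m + (i - m)) = 0" using h by (simp only: model1_iff[OF \<tau>])
      then show "coord (pact1 \<tau> h) i * z ^ i = 0" using \<open>i \<notin> {..<m}\<close> by simp
    qed simp
    then have "H1.ev (pact1 \<tau> h) z = (\<Sum>i<m. coord (pact1 \<tau> h) i * z ^ i)"
      using H1_ev_sums[OF z, of "pact1 \<tau> h"] sums_unique2 by blast
    moreover have "pfun F x z \<tau> = (\<Sum>i<m. coord (pact1 \<tau> h) i * z ^ i)"
      unfolding pfun_def F_def
      by (rule sum.reindex_bij_witness[of _ "\<lambda>i. (i, 0)" fst]) (auto simp: cx)
    ultimately have "pfun F x z \<tau> = bpoly p z \<tau> * H1.ev h z" by (simp add: ev_pact1 z)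
    then show "H1.ev (G \<tau>) z = H1.ev ((poly minorant \<tau>)\<^sup>2 *\<^sub>C h) z"
      using z \<tau> nz' by (simp add: G power2_eq_square)
  qed
  define g where "g w = form1 a b (G w)" for w
  have gc: "continuous_on (cball 0 1) g" unfolding g_def by (intro continuous_on_form G(1))
  have "g \<tau> \<ge> 0"
  proof (rule ccontr)
    assume neg: "\<not> g \<tau> \<ge> 0"
    \<comment> \<open>Half the gap, so that g stays below -c on an arc around \<tau>.\<close>
    define c where "c = - g \<tau> / 2"
    have c: "c > 0" using neg by (simp add: c_def)
    have "\<exists>d>0. \<forall>w\<in>cball 0 1. dist w \<tau> < d \<longrightarrow> dist (g w) (g \<tau>) < c"
      using gc \<tau> c unfolding continuous_on_iff by force
    then obtain d where d: "d > 0" "\<And>w. cmod w = 1 \<Longrightarrow> dist w \<tau> < d \<Longrightarrow> dist (g w) (g \<tau>) < c" by auto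
    have "bounded (g ` cball 0 1)" by (intro compact_imp_bounded compact_continuous_image gc) simp
    then obtain M where M: "\<And>w. cmod w = 1 \<Longrightarrow> \<bar>g w\<bar> \<le> M" by (force simp: bounded_iff)
    have M0: "M \<ge> 0" using order_trans[OF abs_ge_zero M[of 1]] by simp
    \<comment> \<open>A geometric sum in w times the conjugate of \<tau>; on the circle its squared
      modulus is N times the Fejer kernel centred at \<tau>.\<close>
    define t where "t N w = (\<Sum>k<N. w ^ k *\<^sub>C cnj \<tau> ^ k)" for N w
    \<comment> \<open>Near \<tau> the first term suffices; away from it the geometric sum is at most
      2 / d, whatever N is, and this produces the constant 4 / d^2.\<close>
    have up: "(cmod (t N w))\<^sup>2 * g w \<le> - c * (cmod (t N w))\<^sup>2 + (M + c) * (4 / d\<^sup>2)" if w: "cmod w = 1" for N w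
    proof (cases "dist w \<tau> < d")
      case True
      have "g w \<le> - c" using d(2)[OF w True] by (simp add: c_def dist_real_def abs_less_iff)
      then have "(cmod (t N w))\<^sup>2 * g w \<le> (cmod (t N w))\<^sup>2 * (- c)" by (intro mult_left_mono) auto
      moreover have "(M + c) * (4 / d\<^sup>2) \<ge> 0" using M0 c by simp
      ultimately show ?thesis by (simp add: mult.commute)
    next
      case False
      define v where "v = w * cnj \<tau>"
      have \<tau>1: "cnj \<tau> * \<tau> = 1" using \<tau>(1) by (simp add: complex_norm_square[symmetric] mult.commute)
      have "w - \<tau> = (v - 1) * \<tau>" using \<tau>1 by (simp add: v_def algebra_simps)
      then have dv: "cmod (1 - v) \<ge> d"
        using False \<tau>(1) by (simp add: dist_norm norm_mult norm_minus_commute)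
      have cv: "cmod v = 1" using w \<tau> by (simp add: v_def norm_mult)
      have "(1 - v) * t N w = 1 - v ^ N"
        unfolding t_def v_def by (simp add: power_mult_distrib[symmetric] one_diff_power_eq)
      then have "cmod (1 - v) * cmod (t N w) = cmod (1 - v ^ N)" by (metis norm_mult)
      also have "\<dots> \<le> 2" using norm_triangle_ineq4[of 1 "v ^ N"] cv by (simp add: norm_power)
      finally have "d * cmod (t N w) \<le> 2" using mult_right_mono[OF dv norm_ge_zero[of "t N w"]] by linarith
      then have "cmod (t N w) \<le> 2 / d" using d(1) by (simp add: field_simps)
      then have "(cmod (t N w))\<^sup>2 \<le> (2 / d)\<^sup>2" by (intro power_mono) auto
      then have t2: "(cmod (t N w))\<^sup>2 \<le> 4 / d\<^sup>2" by (simp add: power_divide)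
      have "(cmod (t N w))\<^sup>2 * (g w + c) \<le> (cmod (t N w))\<^sup>2 * (M + c)"
        using M[OF w] by (intro mult_left_mono) (auto simp: abs_le_iff)
      also have "\<dots> \<le> (4 / d\<^sup>2) * (M + c)"
        using t2 c M0 by (intro mult_right_mono) auto
      finally have "(cmod (t N w))\<^sup>2 * (g w + c) \<le> (4 / d\<^sup>2) * (M + c)" .
      then show ?thesis by (simp add: algebra_simps)
    qed
    have neg_bound: "0 \<le> - c * real N + (M + c) * (4 / d\<^sup>2)" for N
    proof -
      define f where "f = (\<Sum>k<N. cnj \<tau> ^ k *\<^sub>C shift (0, k) (nice F x))"
      have "f \<in> model_inf"
        unfolding f_def
        by (intro csubspace_sum[OF csubspace_model_inf] csubspace_scaleC[OF csubspace_model_inf] shift_model_inf nice)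
      then have "0 \<le> form2 a b f" by (rule pos)
      also have "form2 a b f \<le> - c * real N + (M + c) * (4 / d\<^sup>2)"
      proof (rule LIMSEQ_le_const2)
        have "continuous_on (cball 0 1) (t N)" unfolding t_def by (intro continuous_intros)
        moreover have evf: "H2.ev f (z, \<zeta>) = t N \<zeta> * H2.ev (nice F x) (z, \<zeta>)"
          if "cmod z < 1" "cmod \<zeta> < 1" for z \<zeta>
          using that by (simp add: f_def H2.ev_sum H2_ev_shift t_def sum_distrib_left mult_ac)
        ultimately show "(\<lambda>K. circle_avg K (\<lambda>w. form1 a b (t N w *\<^sub>C G w))) \<longlonglongrightarrow> form2 a b f"
          by (intro circle_avg_form continuous_intros G(1))
            (simp_all add: G(2) evf ev_nice)
        have "circle_avg K (\<lambda>w. form1 a b (t N w *\<^sub>C G w)) \<le> - c * real N + (M + c) * (4 / d\<^sup>2)"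
          if K: "K \<ge> N" "K > 0" for K
        proof -
          \<comment> \<open>Padding the coefficients by zeros up to K makes Parseval over K nodes
            exact: the mean of |t N|^2 is N.\<close>
          define y where "y k = (if k < N then cnj \<tau> ^ k else 0)" for k
          have ty: "t N w = (\<Sum>k<K. w ^ k *\<^sub>C y k)" for w
            unfolding t_def y_def by (rule sum.mono_neutral_cong_left) (use K in auto)
          have "circle_avg K (\<lambda>w. (cmod (t N w))\<^sup>2) = (\<Sum>k<K. (cmod (y k))\<^sup>2)"
            unfolding ty by (rule circle_avg_parseval_finite)
          also have "\<dots> = (\<Sum>k<N. 1)"
            by (rule sum.mono_neutral_cong_right) (use K \<tau> in \<open>auto simp: y_def norm_power\<close>)
          finally have tN: "circle_avg K (\<lambda>w. (cmod (t N w))\<^sup>2) = real N" by simp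
          have "circle_avg K (\<lambda>w. form1 a b (t N w *\<^sub>C G w))
              \<le> circle_avg K (\<lambda>w. - c * (cmod (t N w))\<^sup>2 + (M + c) * (4 / d\<^sup>2))"
            by (rule circle_avg_mono) (use up in \<open>simp add: form_scaleC g_def\<close>)
          also have "\<dots> = - c * real N + (M + c) * (4 / d\<^sup>2)"
            unfolding circle_avg_add circle_avg_cmult tN using K by (simp add: circle_avg_const)
          finally show ?thesis .
        qed
        then show "\<exists>K0. \<forall>K\<ge>K0. circle_avg K (\<lambda>w. form1 a b (t N w *\<^sub>C G w)) \<le> - c * real N + (M + c) * (4 / d\<^sup>2)"
          by (intro exI[of _ "Suc N"]) auto
      qed
      finally show ?thesis .
    qed
    \<comment> \<open>The negative term grows linearly in N while the contribution from far away
      stays bounded.\<close>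
    obtain N where "real N > (M + c) * (4 / d\<^sup>2) / c" using reals_Archimedean2 by blast
    then have "c * real N > (M + c) * (4 / d\<^sup>2)" using c by (simp only: pos_divide_less_eq mult.commute)
    with neg_bound[of N] show False by simp
  qed
  then have "(cmod ((poly minorant \<tau>)\<^sup>2))\<^sup>2 * form1 a b h \<ge> 0" by (simp add: g_def G\<tau> form_scaleC)
  then show ?thesis using \<tau>(2) by (simp add: zero_le_mult_iff)
qed

end

section \<open>Asymptotics under high powers of the variables\<close>

lemma power2_norm_diff: "(norm (x - y))\<^sup>2 = (norm x)\<^sup>2 + (norm (y::'a::real_inner))\<^sup>2 - 2 * inner x y"
  by (simp add: power2_norm_eq_inner inner_diff_left inner_diff_right inner_commute)

lemma power2_norm_add_orthogonal:
  "inner x y = 0 \<Longrightarrow> (norm (x + y))\<^sup>2 = (norm x)\<^sup>2 + (norm (y::'a::real_inner))\<^sup>2"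
  by (simp add: power2_norm_eq_inner inner_add_left inner_add_right inner_commute)

lemma cinner_0_imp_inner_0: "cinner x y = 0 \<Longrightarrow> inner x y = 0"
  by (metis Re_cinner zero_complex.sel(1))

lemma form_perturb:
  "\<bar>form e a b x - form e a b y\<bar> \<le> (cmod a + \<bar>b\<bar>) * (norm (x - y) * (norm x + norm y))"
proof -
  have "cinner (shift e x) x - cinner (shift e y) y
      = cinner (shift e (x - y)) x + cinner (shift e y) (x - y)"
    by (simp add: shift_diff cinner_diff_left cinner_diff_right)
  then have "cmod (cinner (shift e x) x - cinner (shift e y) y)
      \<le> norm (x - y) * norm x + norm y * norm (x - y)"
    by (metis (no_types, lifting) add_mono cinner_bound norm_shift norm_triangle_mono)
  then have 1: "\<bar>inner a (cinner (shift e x) x - cinner (shift e y) y)\<bar> \<le> cmod a * (norm (x - y) * (norm x + norm y))"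
    by (intro order_trans[OF Cauchy_Schwarz_ineq2] mult_left_mono) (auto simp: algebra_simps)
  have "\<bar>(norm x)\<^sup>2 - (norm y)\<^sup>2\<bar> = \<bar>norm x - norm y\<bar> * (norm x + norm y)"
    by (simp add: power2_eq_square square_diff_square_factored abs_mult)
  also have "\<dots> \<le> norm (x - y) * (norm x + norm y)"
    by (intro mult_right_mono norm_triangle_ineq3) auto
  finally have "\<bar>b * ((norm x)\<^sup>2 - (norm y)\<^sup>2)\<bar> \<le> \<bar>b\<bar> * (norm (x - y) * (norm x + norm y))"
    by (simp add: abs_mult mult_left_mono)
  moreover have "form e a b x - form e a b y
      = inner a (cinner (shift e x) x - cinner (shift e y) y) - b * ((norm x)\<^sup>2 - (norm y)\<^sup>2)"
    by (simp add: form_def inner_diff_right algebra_simps)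
  ultimately show ?thesis using 1 by (simp add: distrib_right abs_le_iff)
qed

context rational_inner
begin

text \<open>The range of the isometry is asymptotically everything: far out, a monomial is
  reproduced by the partial sums of the conjugated coefficients.\<close>

lemma mulT_approx_basis:
  assumes e: "e > 0"
  shows "\<exists>K. \<forall>k\<ge>K. \<exists>u. norm (shift (k, k) (basis (a, b)) - mulT u) < e"
proof -
  \<comment> \<open>The coefficients of \<Theta>, since \<open>basis 0\<close> is the constant 1;
    their squared norm is 1 because \<open>mulT\<close> is an isometry.\<close>
  define \<theta> where "\<theta> = mulT (basis 0)"
  have n\<theta>: "(norm \<theta>)\<^sup>2 = 1" by (simp add: \<theta>_def)
  have "eventually (\<lambda>F. (\<Sum>k\<in>F. (cmod (coord \<theta> k))\<^sup>2) > 1 - e\<^sup>2) (finite_subsets_at_top UNIV)"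
    using norm_ell2_has_sum[of \<theta>] e unfolding has_sum_def n\<theta>
    by (intro order_tendstoD(1)[where y = 1]) auto
  then obtain F where F: "finite F" "(\<Sum>k\<in>F. (cmod (coord \<theta> k))\<^sup>2) > 1 - e\<^sup>2"
    unfolding eventually_finite_subsets_at_top by auto
  have "\<exists>K. fst ` F \<subseteq> {..<K}" "\<exists>K. snd ` F \<subseteq> {..<K}"
    using finite_imageI[OF F(1), of fst] finite_imageI[OF F(1), of snd] unfolding finite_nat_iff_bounded by auto
  then obtain K1 K2 where K: "fst ` F \<subseteq> {..<K1}" "snd ` F \<subseteq> {..<K2}" by blast
  have "\<exists>u. norm (shift (k, k) (basis (a, b)) - mulT u) < e" if k: "k \<ge> max K1 K2" for k
  proof -
    define J where "J = {..k + a} \<times> {..k + b}"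
    define f where "f \<gamma> = (k + a - fst \<gamma>, k + b - snd \<gamma>)" for \<gamma> :: "nat \<times> nat"
    define c where "c \<gamma> = cnj (coord \<theta> \<gamma>)" for \<gamma>
    \<comment> \<open>The conjugated coefficients, reflected at (k + a, k + b): the product with
      \<Theta> then has coefficient s at this index and squared norm s, so its squared distance to
      the monomial is 1 - 2 s + s = 1 - s.\<close>
    define u where "u = (\<Sum>\<gamma>\<in>J. c \<gamma> *\<^sub>C basis (f \<gamma>))"
    define s where "s = (\<Sum>\<gamma>\<in>J. (cmod (coord \<theta> \<gamma>))\<^sup>2)"
    have J: "finite J" "inj_on f J" by (auto simp: J_def f_def inj_on_def)
    have fJ: "f \<gamma> + \<gamma> = (k + a, k + b)" if "\<gamma> \<in> J" for \<gamma>
      using that by (cases \<gamma>) (auto simp: J_def f_def)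
    have nu: "(norm (mulT u))\<^sup>2 = s"
      unfolding u_def s_def norm_mulT norm_sum_basis[OF J] by (simp add: c_def)
    have "mulT (basis (f \<gamma>)) = shift (f \<gamma>) \<theta>" for \<gamma>
      unfolding \<theta>_def mulT_shift[symmetric] shift_basis by simp
    then have Tu: "mulT u = (\<Sum>\<gamma>\<in>J. c \<gamma> *\<^sub>C shift (f \<gamma>) \<theta>)"
      by (simp add: u_def mulT_sum mulT_scaleC)
    have "coord (mulT u) (k + a, k + b) = (\<Sum>\<gamma>\<in>J. complex_of_real ((cmod (coord \<theta> \<gamma>))\<^sup>2))"
      unfolding Tu coord_sum
    proof (rule sum.cong[OF refl])
      fix \<gamma> assume "\<gamma> \<in> J"
      then have "coord (shift (f \<gamma>) \<theta>) (k + a, k + b) = coord \<theta> \<gamma>"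
        using coord_shift[of "f \<gamma>" \<theta> \<gamma>] fJ by simp
      then show "coord (c \<gamma> *\<^sub>C shift (f \<gamma>) \<theta>) (k + a, k + b) = complex_of_real ((cmod (coord \<theta> \<gamma>))\<^sup>2)"
        unfolding coord_scaleC c_def complex_norm_square by (simp add: mult.commute)
    qed
    then have "cinner (mulT u) (basis (k + a, k + b)) = complex_of_real s" by (simp add: s_def)
    then have i: "inner (basis (k + a, k + b)) (mulT u) = s"
      by (metis Re_cinner Re_complex_of_real inner_commute)
    have "(norm (shift (k, k) (basis (a, b)) - mulT u))\<^sup>2 = 1 - s"
      by (simp add: shift_basis power2_norm_diff i nu del: norm_mulT)
    also have "F \<subseteq> J"
    proof
      fix \<gamma> assume "\<gamma> \<in> F"
      then have "fst \<gamma> < K1" "snd \<gamma> < K2" using K by auto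
      then show "\<gamma> \<in> J" using k by (cases \<gamma>) (auto simp: J_def)
    qed
    then have "(\<Sum>k\<in>F. (cmod (coord \<theta> k))\<^sup>2) \<le> s" unfolding s_def using J by (intro sum_mono2) auto
    then have "1 - s < e\<^sup>2" using F(2) by simp
    finally show ?thesis using e power2_less_imp_less by (intro exI[of _ u]) fastforce
  qed
  then show ?thesis by blast
qed

text \<open>Stands in for \<Theta> L^2 = L^2 on the torus: after a high power of z1 z2 any vector
  comes close to the range of \<open>mulT\<close>. Such vectors form a closed subspace containing
  the basis.\<close>

lemma mulT_approx:
  assumes "e > 0"
  shows "\<exists>K. \<forall>k\<ge>K. \<exists>u. norm (shift (k, k) x - mulT u) < e"
proof -
  define V where "V = {x. \<forall>e>0. \<exists>K. \<forall>k\<ge>K. \<exists>u. norm (shift (k, k) x - mulT u) < e}"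
  have VI: "x \<in> V" if "\<And>e. e > 0 \<Longrightarrow> \<exists>K. \<forall>k\<ge>K. \<exists>u. norm (shift (k, k) x - mulT u) < e" for x
    using that by (simp add: V_def)
  have VD: "\<exists>K. \<forall>k\<ge>K. \<exists>u. norm (shift (k, k) x - mulT u) < e" if "x \<in> V" "e > 0" for x e
    using that by (simp add: V_def)
  have T0: "mulT 0 = 0" using mulT_diff[of 0 0] by simp
  have s0: "shift k 0 = 0" for k :: "nat \<times> nat" using shift_diff[of k 0 0] by simp
  have "csubspace V"
    unfolding csubspace_def
  proof (intro conjI ballI allI)
    show "0 \<in> V" by (rule VI) (intro exI[of _ 0] allI impI, simp add: s0 T0)
    fix x y assume x: "x \<in> V" and y: "y \<in> V"
    show "x + y \<in> V"
    proof (rule VI)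
      fix e :: real assume e: "e > 0"
      obtain K1 where K1: "\<forall>k\<ge>K1. \<exists>u. norm (shift (k, k) x - mulT u) < e / 2" using VD[OF x, of "e/2"] e by auto
      obtain K2 where K2: "\<forall>k\<ge>K2. \<exists>u. norm (shift (k, k) y - mulT u) < e / 2" using VD[OF y, of "e/2"] e by auto
      show "\<exists>K. \<forall>k\<ge>K. \<exists>u. norm (shift (k, k) (x + y) - mulT u) < e"
      proof (intro exI[of _ "max K1 K2"] allI impI)
        fix k assume "max K1 K2 \<le> k"
        then obtain u v where uv: "norm (shift (k, k) x - mulT u) < e / 2" "norm (shift (k, k) y - mulT v) < e / 2"
          using K1 K2 by (meson max.boundedE)
        have "shift (k, k) (x + y) - mulT (u + v) = (shift (k, k) x - mulT u) + (shift (k, k) y - mulT v)"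
          by (simp add: shift_add mulT_add)
        then have "norm (shift (k, k) (x + y) - mulT (u + v)) < e"
          using norm_triangle_lt[of "shift (k, k) x - mulT u" "shift (k, k) y - mulT v" e] uv by simp
        then show "\<exists>u. norm (shift (k, k) (x + y) - mulT u) < e" by blast
      qed
    qed
  next
    fix c x assume x: "x \<in> V"
    show "c *\<^sub>C x \<in> V"
    proof (rule VI)
      fix e :: real assume e: "e > 0"
      have c1: "cmod c + 1 > 0" by (simp add: add_nonneg_pos)
      obtain K where K: "\<forall>k\<ge>K. \<exists>u. norm (shift (k, k) x - mulT u) < e / (cmod c + 1)"
        using VD[OF x, of "e / (cmod c + 1)"] e c1 by auto
      show "\<exists>K. \<forall>k\<ge>K. \<exists>u. norm (shift (k, k) (c *\<^sub>C x) - mulT u) < e"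
      proof (intro exI[of _ K] allI impI)
        fix k assume "K \<le> k"
        then obtain u where u: "norm (shift (k, k) x - mulT u) < e / (cmod c + 1)" using K by blast
        have "shift (k, k) (c *\<^sub>C x) - mulT (c *\<^sub>C u) = c *\<^sub>C (shift (k, k) x - mulT u)"
          by (simp add: shift_scaleC mulT_scaleC scaleC_diff_right)
        then have "norm (shift (k, k) (c *\<^sub>C x) - mulT (c *\<^sub>C u)) \<le> (cmod c + 1) * norm (shift (k, k) x - mulT u)"
          by (simp add: mult_right_mono)
        also have "\<dots> < e" using u c1 by (simp add: field_simps)
        finally show "\<exists>u. norm (shift (k, k) (c *\<^sub>C x) - mulT u) < e" by blast
      qed
    qed
  qed
  moreover have "closed V"
    unfolding closed_sequential_limits
  proof safe
    fix X x assume X: "\<forall>i::nat. X i \<in> V" "X \<longlonglongrightarrow> x"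
    show "x \<in> V"
    proof (rule VI)
      fix e :: real assume e: "e > 0"
      obtain i where i: "norm (X i - x) < e / 2" using LIMSEQ_D[OF X(2), of "e/2"] e by auto
      obtain K where K: "\<forall>k\<ge>K. \<exists>u. norm (shift (k, k) (X i) - mulT u) < e / 2"
        using VD[of "X i" "e/2"] X(1) e by auto
      show "\<exists>K. \<forall>k\<ge>K. \<exists>u. norm (shift (k, k) x - mulT u) < e"
      proof (intro exI[of _ K] allI impI)
        fix k assume "K \<le> k"
        then obtain u where u: "norm (shift (k, k) (X i) - mulT u) < e / 2" using K by blast
        have eq: "shift (k, k) x - mulT u = (shift (k, k) (X i) - mulT u) - shift (k, k) (X i - x)"
          by (simp add: shift_diff)
        have "norm (shift (k, k) x - mulT u) \<le> norm (shift (k, k) (X i) - mulT u) + norm (X i - x)"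
          unfolding eq using norm_triangle_ineq4[of "shift (k, k) (X i) - mulT u" "shift (k, k) (X i - x)"]
          unfolding norm_shift .
        then show "\<exists>u. norm (shift (k, k) x - mulT u) < e" using u i by (intro exI[of _ u]) simp
      qed
    qed
  qed
  ultimately have "x \<in> V"
    by (rule ell2_induct) (auto intro!: VI mulT_approx_basis)
  then show ?thesis using VD assms by blast
qed

text \<open>An element of the largest z2-invariant subspace of the model space becomes, after
  multiplication by a high power of z2, asymptotically an element of B: its A-components
  converge after undoing the shift, and the limit generates a z1-invariant space, which is
  impossible within the model space unless the limit vanishes.\<close>

lemma form2_nonneg_transfer:
  assumes A: "csubspace A" "\<And>x. x \<in> A \<Longrightarrow> shift (1, 0) x \<in> A"
    and B: "csubspace B" "\<And>x. x \<in> B \<Longrightarrow> shift (0, 1) x \<in> B"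
    and orth: "\<And>x y. x \<in> A \<Longrightarrow> y \<in> B \<Longrightarrow> cinner x y = 0"
    and decomp: "model = {x + y | x y. x \<in> A \<and> y \<in> B}"
    and pos: "\<And>f. f \<in> B \<Longrightarrow> form2 a b f \<ge> 0"
    and f: "f \<in> model_inf"
  shows "form2 a b f \<ge> 0"
proof -
  have "\<exists>x y. x \<in> A \<and> y \<in> B \<and> shift (0, N) f = x + y" for N
    using f by (force simp: model_inf_def decomp)
  then obtain s t where st: "\<And>N. s N \<in> A" "\<And>N. t N \<in> B" "\<And>N. shift (0, N) f = s N + t N" by metis
  have shB: "shift (0, M) x \<in> B" if "x \<in> B" for M x by (rule ract_in(1)[OF B that])
  have shA: "shift (M, 0) x \<in> A" if "x \<in> A" for M x
  proof (induction M)
    case (Suc M)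
    then show ?case using A(2)[of "shift (M, 0) x"] by (simp add: shift_shift)
  qed (use that in \<open>simp flip: zero_prod_def\<close>)
  define d where "d N = norm (s N)" for N
  \<comment> \<open>The difference v equals t (N + M) - z2^M t N, so it lies in B and is orthogonal
    to s (N + M); Pythagoras shows that the norms d decrease and measure these differences.\<close>
  have step: "(norm (shift (0, M) (s N) - s (N + M)))\<^sup>2 = (d N)\<^sup>2 - (d (N + M))\<^sup>2" for N M
  proof -
    define v where "v = shift (0, M) (s N) - s (N + M)"
    have "s (N + M) + t (N + M) = shift (0, M) (s N) + shift (0, M) (t N)"
      using st(3)[of "N + M"] st(3)[of N] shift_shift[of "(0, M)" "(0, N)" f]
      by (simp add: shift_add add.commute)
    then have "v = t (N + M) - shift (0, M) (t N)" by (simp add: v_def algebra_simps)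
    then have "v \<in> B" using st(2) shB B(1) by (simp add: csubspace_diff)
    then have "inner (s (N + M)) v = 0" using orth st(1) by (simp add: cinner_0_imp_inner_0)
    then have "(norm (s (N + M) + v))\<^sup>2 = (norm (s (N + M)))\<^sup>2 + (norm v)\<^sup>2"
      by (rule power2_norm_add_orthogonal)
    moreover have "s (N + M) + v = shift (0, M) (s N)" by (simp add: v_def)
    ultimately show ?thesis by (simp add: d_def v_def)
  qed
  have d0: "d N \<ge> 0" for N by (simp add: d_def)
  have dec: "d (N + M) \<le> d N" for N M
  proof (rule power2_le_imp_le)
    show "(d (N + M))\<^sup>2 \<le> (d N)\<^sup>2" using step[where N=N and M=M] zero_le_power2 by (metis diff_ge_0_iff_ge)
  qed (rule d0)
  have "decseq d"
    unfolding decseq_def using dec by (metis le_add_diff_inverse)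
  then obtain L where L: "d \<longlonglongrightarrow> L" "\<And>N. L \<le> d N"
    using decseq_convergent[of d 0] d0 by metis
  have L0: "0 \<le> L" using L(1) d0 by (intro LIMSEQ_le_const) auto
  have "L \<le> 0 + e'" if e': "e' > 0" for e'
  proof -
    define e where "e = e' / 2"
    have e: "e > 0" using e' by (simp add: e_def)
    have "(\<lambda>N. (d N)\<^sup>2 - L\<^sup>2) \<longlonglongrightarrow> L\<^sup>2 - L\<^sup>2" by (intro tendsto_intros L)
    then have "eventually (\<lambda>N. (d N)\<^sup>2 - L\<^sup>2 < e\<^sup>2) sequentially"
      using e by (intro order_tendstoD(2)) auto
    then obtain N where N: "(d N)\<^sup>2 - L\<^sup>2 < e\<^sup>2" by (auto simp: eventually_sequentially)
    obtain k u where u: "norm (shift (k, k) (s N) - mulT u) < e" using mulT_approx[OF e, of "s N"] by blast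
    \<comment> \<open>By invariance of A this lies in the model space and is orthogonal to
      \<open>mulT u\<close>. It is also close to (z1 z2)^k s N, hence to \<open>mulT u\<close>
      itself, which is possible only if it is small.\<close>
    define y where "y = shift (k, 0) (s (N + k))"
    have "y + 0 \<in> model" unfolding decomp y_def using shA[OF st(1)] csubspace_0[OF B(1)] by blast
    then have "cinner y (mulT u) = 0" by (simp add: model_def)
    then have "(norm (y - mulT u))\<^sup>2 = (norm y)\<^sup>2 + (norm (mulT u))\<^sup>2"
      by (simp add: power2_norm_diff cinner_0_imp_inner_0)
    then have "(norm y)\<^sup>2 \<le> (norm (y - mulT u))\<^sup>2" by simp
    then have y1: "norm y \<le> norm (y - mulT u)" by (rule power2_le_imp_le) simp
    have "shift (k, k) (s N) - y = shift (k, 0) (shift (0, k) (s N) - s (N + k))"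
      by (simp add: y_def shift_diff shift_shift)
    then have "(norm (shift (k, k) (s N) - y))\<^sup>2 = (d N)\<^sup>2 - (d (N + k))\<^sup>2" by (simp add: step)
    also have "\<dots> \<le> (d N)\<^sup>2 - L\<^sup>2" using L(2)[of "N + k"] L0 by (simp add: power_mono)
    also have "\<dots> < e\<^sup>2" by (rule N)
    finally have y2: "norm (shift (k, k) (s N) - y) < e" using e by (simp add: power2_less_imp_less)
    have "norm (y - mulT u) \<le> norm (shift (k, k) (s N) - mulT u) + norm (shift (k, k) (s N) - y)"
      using norm_triangle_ineq4[of "shift (k, k) (s N) - mulT u" "shift (k, k) (s N) - y"] by simp
    then have "norm y < e'" using y1 y2 u by (simp add: e_def)
    moreover have "L \<le> norm y" using L(2)[of "N + k"] by (simp add: y_def d_def)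
    ultimately show ?thesis by simp
  qed
  then have "L \<le> 0" by (rule field_le_epsilon)
  with L0 L(1) have d_lim: "d \<longlonglongrightarrow> 0" by simp
  define c where "c = cmod a + \<bar>b\<bar>"
  \<comment> \<open>The form is unchanged by shifting f, and replacing the shifted f by its
    B-component t N costs at most a multiple of d N, which tends to 0.\<close>
  have "form2 a b f \<ge> - (c * (d N * (2 * norm f + d N)))" for N
  proof -
    have nt: "norm (t N) \<le> norm f + d N"
    proof -
      have "norm (s N + t N) = norm f" using arg_cong[OF st(3)[of N], of norm] by simp
      then show ?thesis using norm_triangle_ineq4[of "s N + t N" "s N"] by (simp add: d_def)
    qed
    have "shift (0, N) f - t N = s N" using st(3)[of N] by simp
    then have "\<bar>form2 a b (shift (0, N) f) - form2 a b (t N)\<bar> \<le> c * (d N * (norm f + norm (t N)))"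
      using form_perturb[of "(1, 0)" a b "shift (0, N) f" "t N"] by (simp add: c_def d_def)
    also have "\<dots> \<le> c * (d N * (2 * norm f + d N))"
      using nt d0[of N] by (intro mult_left_mono) (auto simp: c_def)
    finally show ?thesis using pos[OF st(2)[of N]] by (simp add: form_shift)
  qed
  moreover have "(\<lambda>N. - (c * (d N * (2 * norm f + d N)))) \<longlonglongrightarrow> - (c * (0 * (2 * norm f + 0)))"
    by (intro tendsto_intros d_lim)
  ultimately show ?thesis by (intro LIMSEQ_le_const2[of "\<lambda>N. - (c * (d N * (2 * norm f + d N)))" 0 "form2 a b f"]) auto
qed

section \<open>Translation between functions and coefficient families\<close>

lemma D1_iff: "z \<in> D1 \<longleftrightarrow> cmod z < 1"
  and D2_iff: "(z, \<zeta>) \<in> D2 \<longleftrightarrow> cmod z < 1 \<and> cmod \<zeta> < 1"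
  by (auto simp: D1_def D2_def)

lemma toF_mulT:
  "(\<lambda>z. (case z of (z1, z2) \<Rightarrow> bpoly pt z1 z2 / bpoly p z1 z2) * H2.toF u z) = H2.toF (mulT u)"
  by (rule ext) (auto simp: H2.toF_def D2_iff ev_mulT)

lemma model_space_eq:
  "model_space D2 mono2 (\<lambda>(z1, z2). bpoly pt z1 z2 / bpoly p z1 z2) = H2.toF ` model"
  unfolding model_space_def H2.Hsp_eq by (auto simp: toF_mulT model_def)

lemma toF_mult1:
  assumes "cmod \<tau> = 1" "poly minorant \<tau> \<noteq> 0"
  shows "(\<lambda>z. bpoly pt z \<tau> / bpoly p z \<tau> * H1.toF u z) = H1.toF (mult1 \<tau> u)"
  by (rule ext) (use assms in \<open>auto simp: H1.toF_def D1_iff ev_mult1\<close>)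

lemma model_space1_eq:
  assumes "cmod \<tau> = 1" "poly minorant \<tau> \<noteq> 0"
  shows "model_space D1 mono1 (\<lambda>z. bpoly pt z \<tau> / bpoly p z \<tau>) = H1.toF ` model1 \<tau>"
proof -
  have "hinner D1 mono1 (H1.toF x) (\<lambda>z. bpoly pt z \<tau> / bpoly p z \<tau> * H1.toF u z) = cinner x (mult1 \<tau> u)" for x u
    unfolding toF_mult1[OF assms] by simp
  then show ?thesis
    unfolding model_space_def H1.Hsp_eq model1_def by (auto simp del: times_divide_eq_left)
qed

lemma csubspace_model1: "csubspace (model1 \<tau>)"
  by (auto simp: csubspace_def model1_def cinner_add_left cinner_scaleC_left)

lemma closed_model1: "closed (model1 \<tau>)"
proof -
  have "model1 \<tau> = (\<Inter>u. {x. cinner x (mult1 \<tau> u) = 0})" by (auto simp: model1_def)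
  moreover have "closed {x. cinner x y = 0}" for y :: "nat ell2"
    by (intro closed_Collect_eq continuous_intros)
  ultimately show ?thesis by (simp add: closed_INT)
qed

end

section \<open>Half planes, convexity and the numerical ranges\<close>

lemma convex_closureI:
  fixes W :: "'a::real_normed_vector set"
  assumes "\<And>x y u. x \<in> W \<Longrightarrow> y \<in> W \<Longrightarrow> 0 \<le> u \<Longrightarrow> u \<le> 1 \<Longrightarrow> (1 - u) *\<^sub>R x + u *\<^sub>R y \<in> closure W"
  shows "convex (closure W)"
  unfolding convex_alt
proof (intro ballI allI impI)
  fix x y and u :: real assume xy: "x \<in> closure W" "y \<in> closure W" and u: "0 \<le> u \<and> u \<le> 1"
  obtain X Y where X: "\<And>n. X n \<in> W" "X \<longlonglongrightarrow> x" and Y: "\<And>n. Y n \<in> W" "Y \<longlonglongrightarrow> y"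
    using xy unfolding closure_sequential by blast
  have lim: "(\<lambda>n. (1 - u) *\<^sub>R X n + u *\<^sub>R Y n) \<longlonglongrightarrow> (1 - u) *\<^sub>R x + u *\<^sub>R y" by (intro tendsto_intros X Y)
  have mem: "(1 - u) *\<^sub>R X n + u *\<^sub>R Y n \<in> closure W" for n
    using assms[of "X n" "Y n" u] X(1) Y(1) u by blast
  show "(1 - u) *\<^sub>R x + u *\<^sub>R y \<in> closure W"
    by (rule closed_sequentially[OF closed_closure mem lim])
qed

text \<open>High powers of z2 make two vectors asymptotically orthogonal, which convexifies the
  closure of the numerical range.\<close>

lemma convex_closure_numrange:
  fixes B :: "(nat \<times> nat) ell2 set"
  assumes B: "csubspace B" "\<And>x. x \<in> B \<Longrightarrow> shift (0, 1) x \<in> B"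
  shows "convex (closure {cinner (shift (1, 0) x) x | x. x \<in> B \<and> norm x = 1})"
proof (rule convex_closureI)
  fix w1 w2 :: complex and u :: real
  assume "w1 \<in> {cinner (shift (1, 0) x) x | x. x \<in> B \<and> norm x = 1}"
    and "w2 \<in> {cinner (shift (1, 0) x) x | x. x \<in> B \<and> norm x = 1}" and u: "0 \<le> u" "u \<le> 1"
  then obtain x y where x: "x \<in> B" "norm x = 1" "w1 = cinner (shift (1, 0) x) x"
    and y: "y \<in> B" "norm y = 1" "w2 = cinner (shift (1, 0) y) y" by blast
  \<comment> \<open>Square roots of the weights, because the form is quadratic; the mixed terms
    vanish in the limit of high powers of z2.\<close>
  define \<alpha> \<beta> where "\<alpha> = complex_of_real (sqrt (1 - u))" and "\<beta> = complex_of_real (sqrt u)"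
  have ab: "\<alpha> * cnj \<alpha> = complex_of_real (1 - u)" "\<beta> * cnj \<beta> = complex_of_real u"
    using u by (simp_all add: \<alpha>_def \<beta>_def flip: of_real_mult)
  define h where "h N = \<alpha> *\<^sub>C x + \<beta> *\<^sub>C shift (0, N) y" for N
  have hB: "h N \<in> B" for N
    unfolding h_def by (intro csubspace_add[OF B(1)] csubspace_scaleC[OF B(1)] x ract_in(1)[OF B y(1)])
  have sh: "shift (1, 0) (shift (0, N) y) = shift (0, N) (shift (1, 0) y)" for N by (simp add: shift_shift)
  have lim0: "(\<lambda>N. cinner v (shift (0, N) y)) \<longlonglongrightarrow> 0" for v
    using tendsto_cnj[OF cinner_shift_tendsto_0[of y v]] by (simp add: cnj_cinner)
  have num: "(\<lambda>N. cinner (shift (1, 0) (h N)) (h N)) \<longlonglongrightarrow> complex_of_real (1 - u) * w1 + complex_of_real u * w2"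
  proof -
    have eq: "cinner (shift (1, 0) (h N)) (h N) = complex_of_real (1 - u) * w1 + complex_of_real u * w2
        + \<alpha> * cnj \<beta> * cinner (shift (1, 0) x) (shift (0, N) y)
        + \<beta> * cnj \<alpha> * cinner (shift (0, N) (shift (1, 0) y)) x" for N
      unfolding h_def shift_add shift_scaleC sh cinner_add_left cinner_add_right cinner_scaleC_left
        cinner_scaleC_right ab[symmetric] x(3) y(3)
      by (simp add: algebra_simps)
    have "(\<lambda>N. cinner (shift (1, 0) (h N)) (h N)) \<longlonglongrightarrow> complex_of_real (1 - u) * w1 + complex_of_real u * w2
        + \<alpha> * cnj \<beta> * 0 + \<beta> * cnj \<alpha> * 0"
      unfolding eq by (intro tendsto_intros lim0 cinner_shift_tendsto_0)
    then show ?thesis by simp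
  qed
  have den: "(\<lambda>N. cinner (h N) (h N)) \<longlonglongrightarrow> 1"
  proof -
    have eq: "cinner (h N) (h N) = complex_of_real (1 - u) + complex_of_real u
        + \<alpha> * cnj \<beta> * cinner x (shift (0, N) y) + \<beta> * cnj \<alpha> * cinner (shift (0, N) y) x" for N
      unfolding h_def cinner_add_left cinner_add_right cinner_scaleC_left
        cinner_scaleC_right ab[symmetric]
      by (simp add: algebra_simps cinner_self x(2) y(2))
    have "(\<lambda>N. cinner (h N) (h N)) \<longlonglongrightarrow> complex_of_real (1 - u) + complex_of_real u
        + \<alpha> * cnj \<beta> * 0 + \<beta> * cnj \<alpha> * 0"
      unfolding eq by (intro tendsto_intros lim0 cinner_shift_tendsto_0)
    then show ?thesis by simp
  qed
  have "(\<lambda>N. cinner (shift (1, 0) (h N)) (h N) / cinner (h N) (h N))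
      \<longlonglongrightarrow> (complex_of_real (1 - u) * w1 + complex_of_real u * w2) / 1"
    by (intro tendsto_divide num den) simp
  then have lim: "(\<lambda>N. cinner (shift (1, 0) (h N)) (h N) / cinner (h N) (h N)) \<longlonglongrightarrow> (1 - u) *\<^sub>R w1 + u *\<^sub>R w2"
    by (simp add: scaleR_conv_of_real)
  have "eventually (\<lambda>N. cinner (h N) (h N) \<noteq> 0) sequentially"
    by (rule tendsto_imp_eventually_ne[OF den]) simp
  then have "eventually (\<lambda>N. cinner (shift (1, 0) (h N)) (h N) / cinner (h N) (h N)
      \<in> closure {cinner (shift (1, 0) x) x | x. x \<in> B \<and> norm x = 1}) sequentially"
  proof eventually_elim
    case (elim N)
    define g where "g = complex_of_real (1 / norm (h N)) *\<^sub>C h N"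
    have nz: "norm (h N) \<noteq> 0" using elim by auto
    have "norm g = 1" using nz by (simp add: g_def norm_divide)
    moreover have "g \<in> B" unfolding g_def using hB B(1) by (simp add: csubspace_scaleC)
    moreover have "cinner (shift (1, 0) g) g = cinner (shift (1, 0) (h N)) (h N) / cinner (h N) (h N)"
      using nz by (simp add: g_def shift_scaleC cinner_scaleC_left cinner_scaleC_right cinner_self power2_eq_square)
    ultimately show ?case by (intro subsetD[OF closure_subset]) force
  qed
  from Lim_in_closed_set[OF closed_closure this sequentially_bot lim]
  show "(1 - u) *\<^sub>R w1 + u *\<^sub>R w2 \<in> closure {cinner (shift (1, 0) x) x | x. x \<in> B \<and> norm x = 1}" .
qed

lemma form_nonneg_iff:
  assumes "csubspace B"
  shows "(\<forall>f\<in>B. form e a b f \<ge> 0) \<longleftrightarrow> (\<forall>w\<in>{cinner (shift e x) x | x. x \<in> B \<and> norm x = 1}. inner a w \<ge> b)"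
proof safe
  fix x assume "\<forall>f\<in>B. form e a b f \<ge> 0" "x \<in> B" "norm x = 1"
  then show "b \<le> inner a (cinner (shift e x) x)" by (force simp: form_def)
next
  fix f assume all: "\<forall>w\<in>{cinner (shift e x) x | x. x \<in> B \<and> norm x = 1}. inner a w \<ge> b" and f: "f \<in> B"
  show "form e a b f \<ge> 0"
  proof (cases "f = 0")
    case False
    define g where "g = complex_of_real (1 / norm f) *\<^sub>C f"
    have g: "g \<in> B" "norm g = 1" using f False assms by (auto simp: g_def norm_divide csubspace_scaleC)
    then have "b \<le> inner a (cinner (shift e g) g)" using all by blast
    then have "form e a b g \<ge> 0" using g by (simp add: form_def)
    then show ?thesis using False by (simp add: g_def form_scaleC zero_le_mult_iff norm_divide)
  qed (simp add: form_def)
qed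

theorem theorem3p5:
  fixes p pt :: "complex poly poly" and m n :: nat
    and \<Theta> :: "complex \<times> complex \<Rightarrow> complex"
    and E :: "complex set"
    and S1 S2 :: "(complex \<times> complex \<Rightarrow> complex) set"
  assumes deg_p: "deg1 p \<le> m" "deg2 p \<le> n"
    and pt_def: "pt = reflect2 m n p"
    and degree: "max (deg1 p) (deg1 pt) = m" "max (deg2 p) (deg2 pt) = n"
    and no_zeros: "\<forall>z1 z2. cmod z1 < 1 \<longrightarrow> cmod z2 < 1 \<longrightarrow> bpoly p z1 z2 \<noteq> 0"
    and coprime: "coprime p pt"
    and Theta_def: "\<Theta> = (\<lambda>(z1, z2). bpoly pt z1 z2 / bpoly p z1 z2)"
    and E_def: "E = {\<tau>. cmod \<tau> = 1 \<and> (\<exists>\<tau>1. cmod \<tau>1 = 1 \<and> bpoly p \<tau>1 \<tau> = 0)}"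
    and S1: "closed_subspace D2 mono2 S1" and S2: "closed_subspace D2 mono2 S2"
    and orth: "\<forall>f\<in>S1. \<forall>g\<in>S2. hinner D2 mono2 f g = 0"
    and decomp: "model_space D2 mono2 \<Theta> = {(\<lambda>z. f z + g z) | f g. f \<in> S1 \<and> g \<in> S2}"
    and inv1: "\<forall>f\<in>S1. (\<lambda>z. fst z * f z) \<in> S1"
    and inv2: "\<forall>f\<in>S2. (\<lambda>z. snd z * f z) \<in> S2"
  shows "closure (numrange D2 mono2 S2 (compression D2 mono2 S2 fst)) =
         closure (convex hull (\<Union>\<tau>\<in>sphere 0 1 - E.
            numrange D1 mono1 (model_space D1 mono1 (\<lambda>z. \<Theta> (z, \<tau>)))
              (compression D1 mono1 (model_space D1 mono1 (\<lambda>z. \<Theta> (z, \<tau>))) (\<lambda>z. z))))"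
proof -
  interpret R: rational_inner p m n
    by unfold_locales (use deg_p no_zeros coprime pt_def in auto)
  have pt: "R.pt = pt" by (simp add: R.pt_def pt_def)
  obtain A where A: "csubspace A" "closed A" "S1 = H2.toF ` A" using H2.closed_subspaceD[OF S1] .
  obtain B where B: "csubspace B" "closed B" "S2 = H2.toF ` B" using H2.closed_subspaceD[OF S2] .
  have sh: "(\<lambda>z. mono2 k z * H2.toF x z) = H2.toF (shift k x)" for k x
    by (auto simp: H2.toF_def H2.ev_shift)
  have sh1: "(\<lambda>z. fst z * H2.toF x z) = H2.toF (shift (1, 0) x)" for x
    using sh[of "(1, 0)" x] by (simp add: mono2_def)
  have sh2: "(\<lambda>z. snd z * H2.toF x z) = H2.toF (shift (0, 1) x)" for x
    using sh[of "(0, 1)" x] by (simp add: mono2_def)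
  have shA: "shift (1, 0) x \<in> A" if "x \<in> A" for x
    using inv1 that by (force simp: A(3) sh1)
  have shB: "shift (0, 1) x \<in> B" if "x \<in> B" for x
    using inv2 that by (force simp: B(3) sh2)
  have AB: "cinner x y = 0" if "x \<in> A" "y \<in> B" for x y
    using orth that by (force simp: A(3) B(3))
  have "H2.toF ` R.model = {(\<lambda>z. f z + g z) | f g. f \<in> H2.toF ` A \<and> g \<in> H2.toF ` B}"
    using decomp R.model_space_eq unfolding Theta_def pt A(3) B(3) by simp
  also have "\<dots> = {H2.toF (x + y) | x y. x \<in> A \<and> y \<in> B}" unfolding H2.toF_add by blast
  also have "\<dots> = H2.toF ` {x + y | x y. x \<in> A \<and> y \<in> B}" by blast
  finally have "H2.toF ` R.model = H2.toF ` {x + y | x y. x \<in> A \<and> y \<in> B}" .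
  moreover have "inj H2.toF" by (simp add: inj_def)
  ultimately have model: "R.model = {x + y | x y. x \<in> A \<and> y \<in> B}"
    by (simp only: inj_image_eq_iff)
  \<comment> \<open>Invariance under z2 puts all shifts of B inside the model space, with
    A-component 0.\<close>
  have B_inf: "f \<in> R.model_inf" if "f \<in> B" for f
  proof -
    have "0 + shift (0, k) f \<in> R.model" for k
      unfolding model using csubspace_0[OF A(1)] ract_in(1)[OF B(1) shB that] by blast
    then show ?thesis by (simp add: R.model_inf_def)
  qed
  define W where "W = {cinner (shift (1, 0) x) x | x. x \<in> B \<and> norm x = 1}"
  define U where "U \<tau> = {cinner (shift 1 x) x | x. x \<in> R.model1 \<tau> \<and> norm x = 1}" for \<tau>
  have lhs: "numrange D2 mono2 S2 (compression D2 mono2 S2 fst) = W"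
    unfolding B(3) W_def by (rule H2.numrange_compression[OF B(1,2)]) (rule sh1)
  \<comment> \<open>Ties the minorant to E: on the circle its zeros are exactly the points of E, one
    direction by the minorant inequality, the other by its least degree together with
    \<open>slice_zero_free\<close>.\<close>
  have \<tau>: "poly R.minorant \<tau> \<noteq> 0 \<longleftrightarrow> \<tau> \<notin> E" if "cmod \<tau> = 1" for \<tau>
  proof
    assume "poly R.minorant \<tau> \<noteq> 0"
    then show "\<tau> \<notin> E" using R.zero_free[of \<tau>] that by (auto simp: E_def)
  next
    assume "\<tau> \<notin> E"
    then have "bpoly p z \<tau> \<noteq> 0" if "cmod z \<le> 1" for z
      using slice_zero_free[of p \<tau> z, OF R.nz \<open>cmod \<tau> = 1\<close> _ that] \<open>cmod \<tau> = 1\<close> by (auto simp: E_def)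
    then show "poly R.minorant \<tau> \<noteq> 0" using that by (intro R.minorant_off_zeros) auto
  qed
  have rhs: "numrange D1 mono1 (model_space D1 mono1 (\<lambda>z. \<Theta> (z, \<tau>)))
      (compression D1 mono1 (model_space D1 mono1 (\<lambda>z. \<Theta> (z, \<tau>))) (\<lambda>z. z)) = U \<tau>"
    if "\<tau> \<in> sphere 0 1 - E" for \<tau>
  proof -
    have t: "cmod \<tau> = 1" "poly R.minorant \<tau> \<noteq> 0" using that \<tau> by auto
    have ms: "model_space D1 mono1 (\<lambda>z. \<Theta> (z, \<tau>)) = H1.toF ` R.model1 \<tau>"
      using R.model_space1_eq[OF t] by (simp add: Theta_def pt)
    have "(\<lambda>z. z * H1.toF x z) = H1.toF (shift 1 x)" for x
      by (auto simp: H1.toF_def H1.ev_shift mono1_def)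
    then show ?thesis
      unfolding ms U_def by (intro H1.numrange_compression R.csubspace_model1 R.closed_model1)
  qed
  \<comment> \<open>The same half planes contain both sets. One direction climbs from B to
    \<open>model_inf\<close> by \<open>form2_nonneg_transfer\<close> and descends to the slices; the
    other uses that B is part of \<open>model_inf\<close>.\<close>
  have core: "(\<forall>w\<in>W. inner a w \<ge> b) \<longleftrightarrow> (\<forall>\<tau>\<in>sphere 0 1 - E. \<forall>w\<in>U \<tau>. inner a w \<ge> b)" for a b
  proof -
    have "(\<forall>f\<in>B. form2 a b f \<ge> 0) \<longleftrightarrow> (\<forall>\<tau>\<in>sphere 0 1 - E. \<forall>h\<in>R.model1 \<tau>. form1 a b h \<ge> 0)"
    proof
      assume "\<forall>f\<in>B. form2 a b f \<ge> 0"
      then have "form2 a b f \<ge> 0" if "f \<in> R.model_inf" for f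
        using R.form2_nonneg_transfer[of A B a b f, OF A(1) shA B(1) shB AB model _ that] by blast
      then show "\<forall>\<tau>\<in>sphere 0 1 - E. \<forall>h\<in>R.model1 \<tau>. form1 a b h \<ge> 0"
        using R.form1_nonneg_model1[of a b] \<tau> by auto
    next
      assume "\<forall>\<tau>\<in>sphere 0 1 - E. \<forall>h\<in>R.model1 \<tau>. form1 a b h \<ge> 0"
      then have "form1 a b h \<ge> 0" if "cmod \<tau> = 1" "poly R.minorant \<tau> \<noteq> 0" "h \<in> R.model1 \<tau>" for \<tau> h
        using that \<tau> by auto
      then show "\<forall>f\<in>B. form2 a b f \<ge> 0" using R.form2_nonneg_model_inf B_inf by blast
    qed
    then show ?thesis
      unfolding W_def U_def form_nonneg_iff[OF B(1)] form_nonneg_iff[OF R.csubspace_model1] .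
  qed
  \<comment> \<open>A closed convex set is determined by the half planes containing it, so each
    inclusion follows by separating a point from the larger set. For \<open>closure W\<close>
    convexity is supplied by \<open>convex_closure_numrange\<close>.\<close>
  have "closure W = closure (convex hull (\<Union>\<tau>\<in>sphere 0 1 - E. U \<tau>))"
  proof (rule antisym)
    define C where "C = closure (convex hull (\<Union>\<tau>\<in>sphere 0 1 - E. U \<tau>))"
    have "W \<subseteq> C"
    proof
      fix w assume w: "w \<in> W"
      show "w \<in> C"
      proof (rule ccontr)
        assume "w \<notin> C"
        then obtain a b where ab: "inner a w < b" "\<And>x. x \<in> C \<Longrightarrow> inner a x > b"
          using separating_hyperplane_closed_point[of C w] by (auto simp: C_def convex_closure)
        have "U \<tau> \<subseteq> C" if "\<tau> \<in> sphere 0 1 - E" for \<tau>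
          using that hull_subset[of "\<Union>\<tau>\<in>sphere 0 1 - E. U \<tau>" convex] closure_subset unfolding C_def by blast
        then have "\<forall>\<tau>\<in>sphere 0 1 - E. \<forall>w\<in>U \<tau>. inner a w \<ge> b" using ab(2) by (meson less_imp_le subsetD)
        then have "inner a w \<ge> b" using core[of b a] w by blast
        with ab(1) show False by simp
      qed
    qed
    then show "closure W \<subseteq> closure (convex hull (\<Union>\<tau>\<in>sphere 0 1 - E. U \<tau>))"
      unfolding C_def by (intro closure_minimal) auto
  next
    have conv: "convex (closure W)" unfolding W_def by (rule convex_closure_numrange[OF B(1) shB])
    have "U \<tau> \<subseteq> closure W" if t: "\<tau> \<in> sphere 0 1 - E" for \<tau>
    proof
      fix w assume w: "w \<in> U \<tau>"
      show "w \<in> closure W"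
      proof (rule ccontr)
        assume "w \<notin> closure W"
        then obtain a b where ab: "inner a w < b" "\<And>x. x \<in> closure W \<Longrightarrow> inner a x > b"
          using separating_hyperplane_closed_point[of "closure W" w] conv by auto
        have "\<forall>w\<in>W. inner a w \<ge> b" using ab(2) closure_subset by (meson less_imp_le subsetD)
        then have "inner a w \<ge> b" using core[of b a] w t by blast
        with ab(1) show False by simp
      qed
    qed
    then have "(\<Union>\<tau>\<in>sphere 0 1 - E. U \<tau>) \<subseteq> closure W" by blast
    then show "closure (convex hull (\<Union>\<tau>\<in>sphere 0 1 - E. U \<tau>)) \<subseteq> closure W"
      by (intro closure_minimal hull_minimal conv) auto
  qed
  moreover have "(\<Union>\<tau>\<in>sphere 0 1 - E. numrange D1 mono1 (model_space D1 mono1 (\<lambda>z. \<Theta> (z, \<tau>)))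
      (compression D1 mono1 (model_space D1 mono1 (\<lambda>z. \<Theta> (z, \<tau>))) (\<lambda>z. z))) = (\<Union>\<tau>\<in>sphere 0 1 - E. U \<tau>)"
    by (rule SUP_cong[OF refl rhs])
  ultimately show ?thesis unfolding lhs by (simp only:)
qed

end
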